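(* Let $d\ge 1$, let $\Omega\subset\mathbb R^d$ be a bounded Lipschitz polyhedral domain, and fix constants $M_\rho,\rho_*>0$, $0<r_*\le 1$, $c_G,C_G>0$, and the shape-regularity and quasi-uniformity constants of the mesh family. There exist constants $\delta_0,c,C>0$, depending only on $d$, $\Omega$, $M_\rho,\rho_*,r_*$, the uniform mesh constants, and $c_G,C_G$, such that the following holds for every $0<\delta\le\delta_0$, every admissible kernel $\rho$, every admissible polytope $P$ and kernel partition $\mathscr Z_q$, every mesh $\mathcal T_h$ in the family, and every admissible local solver $G_h$ (all as described in the context). With the nonlocal stiffness matrix $A_h$ and the preconditioner $$B_h=G_h+\beta\delta^2D_h^{-1},$$ one has $$\sigma\!\left(B_h^{1/2}A_hB_h^{1/2}\right)\subset[c,C],$$ where $\sigma$ denotes the spectrum, and moreover $$\kappa\!\left(B_h^{1/2}A_hB_h^{1/2}\right)\le\frac Cc ,$$ where $\kappa(X)$ is the spectral condition number of a symmetric positive definite matrix $X$. In particular the constants $\delta_0,c,C$ are independent of $h$, $\delta$, $\delta/h$, $P$ and $q$.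
   Context: $B_r$ is the open ball of radius $r$ centered at $0$ in $\mathbb R^d$; $E_0v$ is the extension of $v\in L^2(\Omega)$ by zero to $\mathbb R^d$. Admissible kernel: $\rho\in L^1(B_1)$, $\rho(z)=\rho(-z)$ and $\rho(z)\ge 0$ for a.e. $z\in B_1$, $\|\rho\|_{L^1(B_1)}\le M_\rho$, and $\rho(z)\ge\rho_*$ for a.e. $z\in B_{r_*}$. Set $\mu_\rho=\int_{B_1}\rho(z)\,dz$ and $\beta=1/(2\mu_\rho)$. Admissible polytope and partition: $P\subset\mathbb R^d$ is a $d$-dimensional polytope with $P=-P$ and $B_{1/2}\subset P\subset\overline{B_1}$. $\mathscr Z_q$ is a finite partition of $P$ into polytopal cells $Z$ of positive measure, covering $P$ without positive-measure overlap, such that $Z\in\mathscr Z_q$ implies $-Z\in\mathscr Z_q$, with $q:=\max_{Z\in\mathscr Z_q}\operatorname{diam}Z$ satisfying $0<q\le r_*/2$. Averaged kernel: $\rho^{\rm av}|_Z=\frac1{|Z|}\int_{Z\cap B_1}\rho(z)\,dz$ for each $Z\in\mathscr Z_q$, and $\rho^{\rm av}=0$ outside $P$. Bilinear form: for $u,v\in L^2(\Omega)$, $$a_{\delta,\rho^{\rm av}}(u,v)=\delta^{-(d+2)}\int_{\mathbb R^d}\int_{\mathbb R^d}\rho^{\rm av}\!\left(\tfrac{y-x}{\delta}\right)\bigl(E_0u(y)-E_0u(x)\bigr)\bigl(E_0v(y)-E_0v(x)\bigr)\,dy\,dx .$$ Meshes: $\mathcal T_h$ ranges over a family of conforming simplicial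 meshes of $\Omega$ fitted to $\partial\Omega$, with $h=\max_{T\in\mathcal T_h}\operatorname{diam}T$, which is uniformly shape regular and globally quasi-uniform (the "uniform mesh constants" are the shape-regularity and quasi-uniformity constants). $V_h^0$ is the space of $v_h\in C^0(\overline\Omega)$ that are affine on every $T\in\mathcal T_h$ and vanish on $\partial\Omega$; $N_h=\dim V_h^0$; $\{\phi_i\}_{i=1}^{N_h}$ is its nodal basis (interior nodes). Matrices ($1\le i,j\le N_h$): $(A_h)_{ij}=a_{\delta,\rho^{\rm av}}(\phi_j,\phi_i)$; $(K_h)_{ij}=\int_\Omega\nabla\phi_j\cdot\nabla\phi_i\,dx$; $D_h$ is the diagonal (lumped mass) matrix with $(D_h)_{ii}=\int_\Omega\phi_i\,dx$. Admissible local solver: $G_h\in\mathbb R^{N_h\times N_h}$ is symmetric and $c_GX^TK_h^{-1}X\le X^TG_hX\le C_GX^TK_h^{-1}X$ for all $X\in\mathbb R^{N_h}$, with $c_G,C_G$ independent of $h,\delta,\rho,P,q$. *)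

theory Defs
  imports "HOL-Analysis.Analysis" "Jordan_Normal_Form.Spectral_Radius"
    "Jordan_Normal_Form.Gauss_Jordan_Elimination"
begin

section \<open>Polyhedral Lipschitz domains\<close>

text \<open>Near every boundary point, the set is the open region above the graph of a Lipschitz function
  over the hyperplane orthogonal to some unit vector \<open>e\<close>; the orthogonal projection of \<open>y\<close> onto
  that hyperplane is \<open>y - (e \<bullet> y) e\<close>.\<close>

definition lipschitz_boundary :: "'a::euclidean_space set \<Rightarrow> bool" where
  "lipschitz_boundary \<Omega> \<longleftrightarrow>
     (\<forall>x\<in>frontier \<Omega>. \<exists>e r L \<gamma>. norm e = 1 \<and> 0 < r \<and> L-lipschitz_on {y. inner e y = 0} \<gamma> \<and>
        \<Omega> \<inter> ball x r = {y \<in> ball x r. \<gamma> (y - inner e y *\<^sub>R e) < inner e y})"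

text \<open>The library's \<^const>\<open>polytope\<close> is convex; a polyhedral domain need not be, hence the finite
  union.\<close>

definition lipschitz_polyhedral_domain :: "'a::euclidean_space set \<Rightarrow> bool" where
  "lipschitz_polyhedral_domain \<Omega> \<longleftrightarrow>
     \<Omega> \<noteq> {} \<and> open \<Omega> \<and> connected \<Omega> \<and> bounded \<Omega> \<and> lipschitz_boundary \<Omega> \<and>
     (\<exists>\<F>. finite \<F> \<and> (\<forall>F\<in>\<F>. polytope F) \<and> closure \<Omega> = \<Union>\<F>)"

section \<open>Kernels\<close>

text \<open>Only the values of \<open>\<rho>\<close> on the unit ball matter.\<close>

definition admissible_kernel :: "real \<Rightarrow> real \<Rightarrow> real \<Rightarrow> ('a::euclidean_space \<Rightarrow> real) \<Rightarrow> bool" where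
  "admissible_kernel M\<rho> \<rho>\<^sub>0 r\<^sub>0 \<rho> \<longleftrightarrow>
     set_integrable lebesgue (ball 0 1) \<rho> \<and>
     (AE z in lebesgue. z \<in> ball 0 1 \<longrightarrow> \<rho> z = \<rho> (- z) \<and> 0 \<le> \<rho> z) \<and>
     (LINT z:ball 0 1|lebesgue. \<bar>\<rho> z\<bar>) \<le> M\<rho> \<and>
     (AE z in lebesgue. z \<in> ball 0 r\<^sub>0 \<longrightarrow> \<rho>\<^sub>0 \<le> \<rho> z)"

definition kernel_mass :: "('a::euclidean_space \<Rightarrow> real) \<Rightarrow> real" where
  "kernel_mass \<rho> = (LINT z:ball 0 1|lebesgue. \<rho> z)"

definition beta_const :: "('a::euclidean_space \<Rightarrow> real) \<Rightarrow> real" where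
  "beta_const \<rho> = 1 / (2 * kernel_mass \<rho>)"

definition admissible_polytope :: "'a::euclidean_space set \<Rightarrow> bool" where
  "admissible_polytope P \<longleftrightarrow>
     polytope P \<and> aff_dim P = int DIM('a) \<and> uminus ` P = P \<and>
     ball 0 (1/2) \<subseteq> P \<and> P \<subseteq> cball 0 1"

definition mesh_size :: "'a::euclidean_space set set \<Rightarrow> real" where
  "mesh_size \<Z> = Max (diameter ` \<Z>)"

definition admissible_partition :: "real \<Rightarrow> 'a::euclidean_space set \<Rightarrow> 'a set set \<Rightarrow> bool" where
  "admissible_partition r\<^sub>0 P \<Z> \<longleftrightarrow>
     finite \<Z> \<and>
     (\<forall>Z\<in>\<Z>. polytope Z \<and> 0 < measure lebesgue Z) \<and>
     \<Union>\<Z> = P \<and>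
     (\<forall>Z\<in>\<Z>. \<forall>Z'\<in>\<Z>. Z \<noteq> Z' \<longrightarrow> negligible (Z \<inter> Z')) \<and>
     (\<forall>Z\<in>\<Z>. uminus ` Z \<in> \<Z>) \<and>
     0 < mesh_size \<Z> \<and> mesh_size \<Z> \<le> r\<^sub>0 / 2"

text \<open>The closed cells overlap in a null set, on which the averaged kernel is not determined. Using
  the (pairwise disjoint) interiors fixes the value \<open>0\<close> on the null set of cell boundaries.\<close>

definition averaged_kernel ::
  "'a::euclidean_space set set \<Rightarrow> ('a \<Rightarrow> real) \<Rightarrow> 'a \<Rightarrow> real" where
  "averaged_kernel \<Z> \<rho> z =
     (\<Sum>Z\<in>\<Z>. indicator (interior Z) z *
        (1 / measure lebesgue Z * (LINT w:Z \<inter> ball 0 1|lebesgue. \<rho> w)))"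

section \<open>The nonlocal bilinear form\<close>

definition zero_ext :: "'a set \<Rightarrow> ('a \<Rightarrow> real) \<Rightarrow> 'a \<Rightarrow> real" where
  "zero_ext \<Omega> v x = (if x \<in> \<Omega> then v x else 0)"

definition nonlocal_form ::
  "'a::euclidean_space set \<Rightarrow> real \<Rightarrow> ('a \<Rightarrow> real) \<Rightarrow> ('a \<Rightarrow> real) \<Rightarrow> ('a \<Rightarrow> real) \<Rightarrow> real" where
  "nonlocal_form \<Omega> \<delta> \<rho> u v =
     1 / \<delta> ^ (DIM('a) + 2) *
     (LINT x|lebesgue. LINT y|lebesgue.
        \<rho> ((y - x) /\<^sub>R \<delta>) * (zero_ext \<Omega> u y - zero_ext \<Omega> u x) * (zero_ext \<Omega> v y - zero_ext \<Omega> v x))"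

section \<open>Meshes and the finite element space\<close>

text \<open>\<^const>\<open>triangulation\<close> provides finiteness and conformity: any two elements meet in a common
  (possibly empty) face. Being fitted to the boundary is \<open>\<Union>\<T> = closure \<Omega>\<close>.\<close>

definition conforming_mesh :: "'a::euclidean_space set \<Rightarrow> 'a set set \<Rightarrow> bool" where
  "conforming_mesh \<Omega> \<T> \<longleftrightarrow>
     triangulation \<T> \<and> (\<forall>T\<in>\<T>. int DIM('a) simplex T) \<and> \<Union>\<T> = closure \<Omega>"

definition inball_diameter :: "'a::euclidean_space set \<Rightarrow> real" where
  "inball_diameter T = 2 * Sup {r. 0 \<le> r \<and> (\<exists>z. cball z r \<subseteq> T)}"

definition shape_regular :: "real \<Rightarrow> 'a::euclidean_space set set \<Rightarrow> bool" where
  "shape_regular C\<^sub>s \<T> \<longleftrightarrow> (\<forall>T\<in>\<T>. diameter T \<le> C\<^sub>s * inball_diameter T)"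

definition quasi_uniform :: "real \<Rightarrow> 'a::euclidean_space set set \<Rightarrow> bool" where
  "quasi_uniform C\<^sub>q \<T> \<longleftrightarrow> (\<forall>T\<in>\<T>. mesh_size \<T> \<le> C\<^sub>q * diameter T)"

text \<open>A function on \<open>closure \<Omega>\<close> is represented by the function on the whole space that vanishes
  elsewhere.\<close>

definition fe_space :: "'a::euclidean_space set \<Rightarrow> 'a set set \<Rightarrow> ('a \<Rightarrow> real) set" where
  "fe_space \<Omega> \<T> = {v. continuous_on (closure \<Omega>) v \<and>
     (\<forall>T\<in>\<T>. \<exists>a b. \<forall>x\<in>T. v x = inner a x + b) \<and>
     (\<forall>x\<in>frontier \<Omega>. v x = 0) \<and> (\<forall>x. x \<notin> closure \<Omega> \<longrightarrow> v x = 0)}"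

definition interior_nodes :: "'a::euclidean_space set \<Rightarrow> 'a set set \<Rightarrow> 'a set" where
  "interior_nodes \<Omega> \<T> = {p \<in> \<Omega>. \<exists>T\<in>\<T>. p extreme_point_of T}"

text \<open>\<open>p\<close> enumerates the interior nodes by \<open>{..<N}\<close>, so that \<open>N\<close> is the number of nodal basis
  functions, i.e. the dimension of \<^const>\<open>fe_space\<close>; these conditions determine each \<open>\<phi> i\<close> with
  \<open>i < N\<close> uniquely.\<close>

definition nodal_basis ::
  "'a::euclidean_space set \<Rightarrow> 'a set set \<Rightarrow> nat \<Rightarrow> (nat \<Rightarrow> 'a) \<Rightarrow> (nat \<Rightarrow> 'a \<Rightarrow> real) \<Rightarrow> bool" where
  "nodal_basis \<Omega> \<T> N p \<phi> \<longleftrightarrow>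
     bij_betw p {..<N} (interior_nodes \<Omega> \<T>) \<and>
     (\<forall>i<N. \<phi> i \<in> fe_space \<Omega> \<T> \<and> (\<forall>j<N. \<phi> i (p j) = (if i = j then 1 else 0)))"

section \<open>Matrices\<close>

text \<open>For finite element functions the classical gradient exists off the null set of element
  boundaries and coincides almost everywhere with the weak gradient.\<close>

definition grad :: "('a::euclidean_space \<Rightarrow> real) \<Rightarrow> 'a \<Rightarrow> 'a" where
  "grad f x = (THE D. GDERIV f x :> D)"

definition nonlocal_stiffness_mat ::
  "'a::euclidean_space set \<Rightarrow> real \<Rightarrow> ('a \<Rightarrow> real) \<Rightarrow> nat \<Rightarrow> (nat \<Rightarrow> 'a \<Rightarrow> real) \<Rightarrow> real Matrix.mat" where
  "nonlocal_stiffness_mat \<Omega> \<delta> \<rho> N \<phi> =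
     Matrix.mat N N (\<lambda>(i, j). nonlocal_form \<Omega> \<delta> \<rho> (\<phi> j) (\<phi> i))"

definition local_stiffness_mat ::
  "'a::euclidean_space set \<Rightarrow> nat \<Rightarrow> (nat \<Rightarrow> 'a \<Rightarrow> real) \<Rightarrow> real Matrix.mat" where
  "local_stiffness_mat \<Omega> N \<phi> =
     Matrix.mat N N (\<lambda>(i, j). LINT x:\<Omega>|lebesgue. inner (grad (\<phi> j) x) (grad (\<phi> i) x))"

definition lumped_mass_mat ::
  "'a::euclidean_space set \<Rightarrow> nat \<Rightarrow> (nat \<Rightarrow> 'a \<Rightarrow> real) \<Rightarrow> real Matrix.mat" where
  "lumped_mass_mat \<Omega> N \<phi> =
     Matrix.mat N N (\<lambda>(i, j). if i = j then (LINT x:\<Omega>|lebesgue. \<phi> i x) else 0)"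

abbreviation mat_inv :: "real Matrix.mat \<Rightarrow> real Matrix.mat" where
  "mat_inv A \<equiv> the (mat_inverse A)"

definition quad_form :: "real Matrix.mat \<Rightarrow> real Matrix.vec \<Rightarrow> real" where
  "quad_form A X = scalar_prod X (A *\<^sub>v X)"

definition local_solver :: "real \<Rightarrow> real \<Rightarrow> real Matrix.mat \<Rightarrow> nat \<Rightarrow> real Matrix.mat \<Rightarrow> bool" where
  "local_solver c\<^sub>G C\<^sub>G K N G \<longleftrightarrow>
     G \<in> carrier_mat N N \<and> transpose_mat G = G \<and>
     (\<forall>X\<in>carrier_vec N. c\<^sub>G * quad_form (mat_inv K) X \<le> quad_form G X \<and>
                        quad_form G X \<le> C\<^sub>G * quad_form (mat_inv K) X)"

definition preconditioner ::
  "'a::euclidean_space set \<Rightarrow> real \<Rightarrow> ('a \<Rightarrow> real) \<Rightarrow> nat \<Rightarrow> (nat \<Rightarrow> 'a \<Rightarrow> real) \<Rightarrow>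
   real Matrix.mat \<Rightarrow> real Matrix.mat" where
  "preconditioner \<Omega> \<delta> \<rho> N \<phi> G =
     G + (beta_const \<rho> * \<delta>\<^sup>2) \<cdot>\<^sub>m mat_inv (lumped_mass_mat \<Omega> N \<phi>)"

text \<open>The principal square root of a symmetric positive semidefinite matrix.\<close>

definition mat_sqrt :: "real Matrix.mat \<Rightarrow> real Matrix.mat" where
  "mat_sqrt B = (THE S. S \<in> carrier_mat (dim_row B) (dim_row B) \<and> transpose_mat S = S \<and>
     (\<forall>X\<in>carrier_vec (dim_row B). 0 \<le> quad_form S X) \<and> S * S = B)"

text \<open>Spectral condition number; meaningful for symmetric positive definite matrices of positive
  size, whose eigenvalues are all real.\<close>

definition spectral_cond :: "real Matrix.mat \<Rightarrow> real" where
  "spectral_cond X = Max (spectrum X) / Min (spectrum X)"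

end

theory Submission
  imports Defs
begin

text \<open>
  Write \<open>u\<close> for the finite element function with coefficient vector \<open>X\<close>. The inverse of the
  preconditioner is, up to constants, the parallel sum of \<open>K\<^sub>h\<close> and \<open>\<delta>\<^bsup>-2\<^esup> D\<^sub>h\<close>, so one has to compare
  \<open>a(u,u)\<close> with the infimum of \<open>|\<nabla>v|\<^sup>2 + \<delta>\<^bsup>-2\<^esup> \<parallel>w\<parallel>\<^sup>2\<close> over the splittings \<open>u = v + w\<close> in the finite
  element space. The upper bound follows from \<open>\<parallel>v(\<cdot> + s) - v\<parallel> \<le> |s| \<parallel>\<nabla>v\<parallel>\<close> and \<open>\<parallel>w(\<cdot> + s) - w\<parallel> \<le> 2 \<parallel>w\<parallel>\<close>.

  For the lower bound, if \<open>\<delta>\<close> is small compared with \<open>h\<close>, then a fixed fraction of every simplex has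
  distance at least \<open>\<delta>\<close> from its boundary, where \<open>u\<close> is affine, so \<open>v = u\<close> works. Otherwise \<open>v\<close> is the
  nodal interpolant of an average of \<open>u\<close> at scale \<open>\<delta>\<close>, multiplied by a cutoff that vanishes outside \<open>\<Omega>\<close>.
  At a point \<open>z\<close> all errors are bounded by the oscillation \<open>\<integral> (u(y) - u(z))\<^sup>2 dy\<close> over a ball of radius
  comparable with \<open>\<delta>\<close>; near the boundary this uses that the ball contains a fixed fraction of the
  complement of the Lipschitz domain, where \<open>u = 0\<close>. Finally \<open>\<parallel>u(\<cdot> + 2s) - u\<parallel> \<le> 2 \<parallel>u(\<cdot> + s) - u\<parallel>\<close> reduces
  the radius of that ball to the one on which the averaged kernel is bounded below.
\<close>

section \<open>Exterior balls of a Lipschitz domain\<close>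

text \<open>The parallel sum enters by duality: the spectrum is read off from
  \<open>quad_form A (B *\<^sub>v x)\<close> against \<open>quad_form B x\<close>, and any splitting
  of the single vector \<open>B *\<^sub>v x\<close> bounds the latter by Cauchy-Schwarz, so neither
  \<open>A\<close> nor \<open>B\<close> is ever inverted.

  The obstacle is that no constant may see the ratio of h and \<delta>. The interpolant of an
  average is comparable with \<open>u\<close> only if the vertices of a cell lie within a fixed
  multiple of \<delta> of its points; on a fine mesh, conversely, the form does not control the
  gradient of \<open>u\<close> itself. The regimes meet at mesh size \<open>H * \<delta>\<close>,
  with \<open>H\<close> chosen from the mesh constants so that above it every simplex contains a
  ball of radius \<delta>. Below it, shifts up to \<open>(H + 2) * \<delta>\<close> suffice, and a
  fixed number of halvings brings them down to \<open>r\<^sub>0 / 2 * \<delta>\<close>.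

  \<open>P\<close> and its partition enter only through the averaged kernel: it is nonnegative,
  vanishes outside the closed unit ball, has at most the mass of \<rho>, and is at least
  \<open>\<rho>\<^sub>0\<close> near the origin. The bound on \<delta> is the reach of the exterior
  balls of \<Omega>.\<close>

lemma exterior_ball_at_frontier_point:
  fixes \<Omega> :: "'a::euclidean_space set"
  assumes lip: "lipschitz_boundary \<Omega>" and x: "x \<in> frontier \<Omega>"
  shows "\<exists>r c. 0 < r \<and> 0 < c \<and> c \<le> 1 \<and>
    (\<forall>x' s. x' \<in> ball x r - \<Omega> \<and> 0 < s \<and> s \<le> r \<longrightarrow> (\<exists>y. ball y (c * s) \<subseteq> ball x' s - \<Omega>))"
proof -
  obtain e r L \<gamma> where e: "norm e = 1" and r: "0 < r" and L: "L-lipschitz_on {y. inner e y = 0} \<gamma>"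
    and eq: "\<Omega> \<inter> ball x r = {y \<in> ball x r. \<gamma> (y - inner e y *\<^sub>R e) < inner e y}"
    using lip x unfolding lipschitz_boundary_def by blast
  have L0: "0 \<le> L" using L by (rule lipschitz_on_nonneg)
  have ee: "inner e e = 1" using e by (simp add: norm_eq_1)
  define pr where "pr y = y - inner e y *\<^sub>R e" for y
  have pr0: "pr y \<in> {y. inner e y = 0}" for y by (simp add: pr_def inner_diff_right ee)
  \<comment> \<open>Below the graph, going down by \<open>s / 2\<close> along \<open>e\<close>
    leaves room for a deviation \<open>w\<close>: it raises the point by at most
    \<open>norm w\<close> and lowers the graph by at most \<open>L * norm w\<close>. With
    \<open>(L + 1) * c = 1 / 2\<close> these two together never use up \<open>s / 2\<close>.\<close>
  define c where "c = 1 / (2 * (L + 1))"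
  have c: "0 < c" "c \<le> 1 / 2" "(L + 1) * c = 1 / 2" using L0 by (auto simp: c_def field_simps)
  have "\<exists>y. ball y (c * s) \<subseteq> ball x' s - \<Omega>"
    if x': "x' \<in> ball x (r / 2)" "x' \<notin> \<Omega>" and s: "0 < s" "s \<le> r / 2" for x' s
  proof (intro exI subsetI)
    fix z assume z: "z \<in> ball (x' - (s / 2) *\<^sub>R e) (c * s)"
    define w where "w = z - (x' - (s / 2) *\<^sub>R e)"
    have wn: "norm w < c * s" using z by (simp add: w_def dist_norm norm_minus_commute)
    have zeq: "z = x' - (s / 2) *\<^sub>R e + w" by (simp add: w_def)
    have "dist x' z \<le> s / 2 + norm w"
    proof -
      have "dist x' z = norm ((s / 2) *\<^sub>R e - w)" by (simp add: zeq dist_norm)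
      also have "\<dots> \<le> norm ((s / 2) *\<^sub>R e) + norm w" by (rule norm_triangle_ineq4)
      finally show ?thesis using s e by simp
    qed
    moreover have "c * s \<le> s / 2" using c s by (simp add: field_simps)
    ultimately have zs: "dist x' z < s" using wn by linarith
    have zr: "z \<in> ball x r"
      using x'(1) zs s dist_triangle[of x z x'] by simp
    have x'r: "x' \<in> ball x r" using x'(1) r by simp
    have "inner e x' \<le> \<gamma> (pr x')" using eq x' x'r unfolding pr_def by force
    also have "\<dots> \<le> \<gamma> (pr z) + L * norm w"
    proof -
      have "pr z - pr x' = w - inner e w *\<^sub>R e"
        by (simp add: pr_def zeq inner_add_right inner_diff_right ee algebra_simps)
      moreover have "norm (w - inner e w *\<^sub>R e) \<le> norm w"
      proof -
        have "(norm (w - inner e w *\<^sub>R e))\<^sup>2 = (norm w)\<^sup>2 - (inner e w)\<^sup>2"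
          unfolding power2_norm_eq_inner
          by (simp add: inner_diff_left inner_diff_right ee inner_commute[of w e] power2_eq_square)
        then have "(norm (w - inner e w *\<^sub>R e))\<^sup>2 \<le> (norm w)\<^sup>2" by simp
        then show ?thesis by (rule power2_le_imp_le[OF _ norm_ge_zero])
      qed
      moreover have "dist (\<gamma> (pr x')) (\<gamma> (pr z)) \<le> L * dist (pr x') (pr z)"
        by (rule lipschitz_onD[OF L pr0 pr0])
      moreover have "dist (pr x') (pr z) = norm (pr z - pr x')" by (simp add: dist_norm norm_minus_commute)
      ultimately have "dist (\<gamma> (pr x')) (\<gamma> (pr z)) \<le> L * dist (pr x') (pr z)" "dist (pr x') (pr z) \<le> norm w"
        by simp_all
      then have "dist (\<gamma> (pr x')) (\<gamma> (pr z)) \<le> L * norm w"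
        using L0 by (meson mult_left_mono order_trans)
      then show ?thesis by (simp add: dist_real_def)
    qed
    finally have "inner e x' \<le> \<gamma> (pr z) + L * norm w" .
    moreover have "inner e z \<le> inner e x' - s / 2 + norm w"
      using norm_cauchy_schwarz[of e w] e by (simp add: zeq inner_add_right inner_diff_right ee)
    moreover have "(L + 1) * norm w \<le> s / 2"
    proof -
      have "(L + 1) * norm w \<le> (L + 1) * (c * s)" using wn L0 by (intro mult_left_mono) auto
      also have "\<dots> = ((L + 1) * c) * s" by simp
      also have "\<dots> = s / 2" by (simp only: c(3))
      finally show ?thesis .
    qed
    ultimately have "inner e z \<le> \<gamma> (pr z)" by (simp add: algebra_simps)
    then have "z \<notin> \<Omega>" using eq zr unfolding pr_def by force
    then show "z \<in> ball x' s - \<Omega>" using zs by simp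
  qed
  then show ?thesis using r c by (intro exI[of _ "r / 2"] exI[of _ c]) auto
qed

text \<open>Compactness of the frontier: the radii and ratios of finitely many charts are replaced
  by their minima. This is why the local version covers every point \<open>x'\<close> outside
  \<Omega> near the chart point, and not only the chart point itself.\<close>

lemma exterior_ball_condition:
  fixes \<Omega> :: "'a::euclidean_space set"
  assumes lip: "lipschitz_boundary \<Omega>" and bd: "bounded \<Omega>" and op: "open \<Omega>"
  shows "\<exists>s\<^sub>0 c. 0 < s\<^sub>0 \<and> 0 < c \<and> c \<le> 1 \<and>
    (\<forall>x s. x \<in> frontier \<Omega> \<and> 0 < s \<and> s \<le> s\<^sub>0 \<longrightarrow> (\<exists>y. ball y (c * s) \<subseteq> ball x s - \<Omega>))"
proof -
  have "\<forall>x\<in>frontier \<Omega>. \<exists>r c. 0 < r \<and> 0 < c \<and> c \<le> 1 \<and>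
    (\<forall>x' s. x' \<in> ball x r - \<Omega> \<and> 0 < s \<and> s \<le> r \<longrightarrow> (\<exists>y. ball y (c * s) \<subseteq> ball x' s - \<Omega>))"
    using exterior_ball_at_frontier_point[OF lip] by blast
  then obtain r c where rc: "\<And>x. x \<in> frontier \<Omega> \<Longrightarrow> 0 < r x \<and> 0 < c x \<and> c x \<le> 1 \<and>
    (\<forall>x' s. x' \<in> ball x (r x) - \<Omega> \<and> 0 < s \<and> s \<le> r x \<longrightarrow> (\<exists>y. ball y (c x * s) \<subseteq> ball x' s - \<Omega>))"
    by metis
  have "compact (frontier \<Omega>)" using bd by (rule compact_frontier_bounded)
  then obtain F where F: "F \<subseteq> frontier \<Omega>" "finite F" "frontier \<Omega> \<subseteq> (\<Union>x\<in>F. ball x (r x))"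
    by (rule compactE_image[of _ "frontier \<Omega>" "\<lambda>x. ball x (r x)"]) (use rc in auto)
  \<comment> \<open>Inserting 1 keeps the minimum meaningful if \<open>F\<close> is empty and, for
    \<open>c0\<close> below, yields \<open>c0 \<le> 1\<close>.\<close>
  define s\<^sub>0 where "s\<^sub>0 = Min (insert 1 (r ` F))"
  define c0 where "c0 = Min (insert 1 (c ` F))"
  have s0: "0 < s\<^sub>0" "\<And>x. x \<in> F \<Longrightarrow> s\<^sub>0 \<le> r x" using F rc by (auto simp: s\<^sub>0_def)
  have c0: "0 < c0" "c0 \<le> 1" "\<And>x. x \<in> F \<Longrightarrow> c0 \<le> c x" using F rc by (auto simp: c0_def)
  have "\<exists>y. ball y (c0 * s) \<subseteq> ball x s - \<Omega>" if x: "x \<in> frontier \<Omega>" and s: "0 < s" "s \<le> s\<^sub>0" for x s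
  proof -
    obtain z where z: "z \<in> F" "x \<in> ball z (r z)" using F x by blast
    have "x \<notin> \<Omega>" using x op by (simp add: frontier_def interior_open)
    then obtain y where "ball y (c z * s) \<subseteq> ball x s - \<Omega>" using rc[of z] z F s s0(2)[of z] by fastforce
    moreover have "c0 * s \<le> c z * s" using c0(3) z s by simp
    ultimately show ?thesis by (meson subset_ball subset_trans)
  qed
  with s0 c0 show ?thesis by blast
qed

text \<open>A frontier point in the interior of the closure would have an exterior ball inside the
  closure, but an open set that misses \<Omega> also misses its closure. The mesh covers only the
  closure of \<Omega>; this rules out slits and puts the interiors of the cells into
  \<Omega>.\<close>

lemma interior_closure_lipschitz:
  fixes \<Omega> :: "'a::euclidean_space set"
  assumes lip: "lipschitz_boundary \<Omega>" and bd: "bounded \<Omega>" and op: "open \<Omega>"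
  shows "interior (closure \<Omega>) = \<Omega>"
proof (intro equalityI subsetI)
  fix x assume x: "x \<in> interior (closure \<Omega>)"
  show "x \<in> \<Omega>"
  proof (rule ccontr)
    assume "x \<notin> \<Omega>"
    then have fr: "x \<in> frontier \<Omega>" using x op interior_subset by (auto simp: frontier_def interior_open)
    obtain s\<^sub>0 c where sc: "0 < s\<^sub>0" "0 < c" "\<And>s. 0 < s \<Longrightarrow> s \<le> s\<^sub>0 \<Longrightarrow> \<exists>y. ball y (c * s) \<subseteq> ball x s - \<Omega>"
      using exterior_ball_condition[OF assms] fr by metis
    obtain e where e: "0 < e" "ball x e \<subseteq> closure \<Omega>" using x by (auto simp: mem_interior)
    define s where "s = min s\<^sub>0 e"
    have s: "0 < s" "s \<le> s\<^sub>0" "s \<le> e" using sc e by (auto simp: s_def)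
    obtain y where y: "ball y (c * s) \<subseteq> ball x s - \<Omega>" using sc(3)[OF s(1,2)] by blast
    have "ball y (c * s) \<inter> \<Omega> = {}" using y by blast
    then have "ball y (c * s) \<inter> closure \<Omega> = {}" by (simp add: open_Int_closure_eq_empty)
    moreover have "y \<in> ball y (c * s)" using sc s by simp
    moreover have "ball y (c * s) \<subseteq> closure \<Omega>"
      using y e(2) s(3) by (meson Diff_subset subset_ball subset_trans)
    ultimately show False by blast
  qed
qed (use op in \<open>meson closure_subset interior_maximal subsetD\<close>)

section \<open>Translation energies\<close>

lemma lborel_integral_translate:
  fixes f :: "'a::euclidean_space \<Rightarrow> real"
  assumes [measurable]: "f \<in> borel_measurable borel"
  shows "(LINT y|lborel. f y) = (LINT s|lborel. f (c + s))"
proof -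
  have "(LINT y|lborel. f y) = (LINT y|distr lborel borel ((+) c). f y)" by (simp add: lborel_distr_plus)
  also have "\<dots> = (LINT s|lborel. f (c + s))" by (rule integral_distr) auto
  finally show ?thesis .
qed

lemma lborel_integral_scale:
  fixes f :: "'a::euclidean_space \<Rightarrow> real"
  assumes [measurable]: "f \<in> borel_measurable borel" and c: "0 < c"
  shows "(LINT y|lborel. f y) = c ^ DIM('a) * (LINT s|lborel. f (c *\<^sub>R s))"
proof -
  have "(LINT y|lborel. f y) = (LINT y|density (distr lborel borel (\<lambda>x. 0 + c *\<^sub>R x)) (\<lambda>_. ennreal (c ^ DIM('a))). f y)"
    using lborel_affine[of c "0::'a"] c by (simp add: ennreal_power)
  also have "\<dots> = (LINT y|distr lborel borel (\<lambda>x. 0 + c *\<^sub>R x). c ^ DIM('a) *\<^sub>R f y)"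
    using c by (intro integral_density) auto
  also have "\<dots> = (LINT s|lborel. c ^ DIM('a) *\<^sub>R f (0 + c *\<^sub>R s))" by (rule integral_distr) auto
  finally show ?thesis by simp
qed

lemma lborel_integrable_bounded:
  fixes f :: "'a::euclidean_space \<Rightarrow> real"
  assumes "f \<in> borel_measurable borel" "\<And>x. \<bar>f x\<bar> \<le> M" "\<And>x. R \<le> norm x \<Longrightarrow> f x = 0"
  shows "integrable lborel f"
proof (rule integrableI_bounded_set[where A = "ball 0 R" and B = M])
  show "emeasure lborel (ball (0::'a) R) < \<infinity>" by (rule emeasure_bounded_finite) simp
qed (use assms in auto)

text \<open>Bounded Borel functions of bounded support: all integrals below exist.\<close>

definition bbb :: "('a::euclidean_space \<Rightarrow> real) \<Rightarrow> bool" where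
  "bbb f \<longleftrightarrow> f \<in> borel_measurable borel \<and> (\<exists>M. \<forall>x. \<bar>f x\<bar> \<le> M) \<and> (\<exists>R. \<forall>x. R \<le> norm x \<longrightarrow> f x = 0)"

lemma bbb_measurable: "bbb f \<Longrightarrow> f \<in> borel_measurable borel"
  by (simp add: bbb_def)

lemma bbb_integrable: "bbb f \<Longrightarrow> integrable lborel f"
  using lborel_integrable_bounded unfolding bbb_def by metis

lemma bbb_mult_right:
  assumes f: "bbb f" and g: "g \<in> borel_measurable borel" and b: "\<And>x. \<bar>g x\<bar> \<le> M"
  shows "bbb (\<lambda>x. f x * g x)"
proof -
  obtain M' R where "\<And>x. \<bar>f x\<bar> \<le> M'" "\<And>x. R \<le> norm x \<Longrightarrow> f x = 0" using f unfolding bbb_def by blast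
  moreover have "\<bar>f x * g x\<bar> \<le> M' * M" for x
    unfolding abs_mult using calculation(1)[of x] b[of x] by (intro mult_mono) auto
  ultimately show ?thesis using bbb_measurable[OF f] g
    unfolding bbb_def by (intro conjI exI[of _ "M' * M"] exI[of _ R]) auto
qed

lemma bbb_mult:
  assumes "bbb f" "bbb g"
  shows "bbb (\<lambda>x. f x * g x)"
  using assms bbb_mult_right[OF assms(1)] unfolding bbb_def by metis

lemma bbb_add:
  assumes "bbb f" "bbb g"
  shows "bbb (\<lambda>x. f x + g x)"
proof -
  obtain M R where 1: "\<And>x. \<bar>f x\<bar> \<le> M" "\<And>x. R \<le> norm x \<Longrightarrow> f x = 0" using assms unfolding bbb_def by blast
  obtain M' R' where 2: "\<And>x. \<bar>g x\<bar> \<le> M'" "\<And>x. R' \<le> norm x \<Longrightarrow> g x = 0" using assms unfolding bbb_def by blast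
  have "\<bar>f x + g x\<bar> \<le> M + M'" for x using 1(1)[of x] 2(1)[of x] by linarith
  moreover have "max R R' \<le> norm x \<longrightarrow> f x + g x = 0" for x using 1(2)[of x] 2(2)[of x] by auto
  ultimately show ?thesis using assms unfolding bbb_def by (metis borel_measurable_add)
qed

lemma bbb_scale: "bbb f \<Longrightarrow> bbb (\<lambda>x. c * f x)"
  using bbb_mult_right[of f "\<lambda>_. c" "\<bar>c\<bar>"] by (simp add: mult.commute)

lemma bbb_sum:
  assumes "\<And>i. i \<in> I \<Longrightarrow> bbb (f i)"
  shows "bbb (\<lambda>x. \<Sum>i\<in>I. f i x)"
  using assms
proof (induction I rule: infinite_finite_induct)
  case (insert i I)
  then show ?case by (simp add: bbb_add)
qed (auto simp: bbb_def)

lemma bbb_translate: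
  assumes "bbb f"
  shows "bbb (\<lambda>x. f (c + x))"
proof -
  obtain M R where 1: "\<And>x. \<bar>f x\<bar> \<le> M" "\<And>x. R \<le> norm x \<Longrightarrow> f x = 0" using assms unfolding bbb_def by blast
  have "R + norm c \<le> norm x \<longrightarrow> f (c + x) = 0" for x
    using 1(2)[of "c + x"] norm_triangle_ineq4[of "c + x" c] by auto
  moreover have "(\<lambda>x. f (c + x)) \<in> borel_measurable borel" using bbb_measurable[OF assms] by measurable
  ultimately show ?thesis using 1(1) unfolding bbb_def by blast
qed

lemma bbb_diff: "bbb f \<Longrightarrow> bbb g \<Longrightarrow> bbb (\<lambda>x. f x - g x)"
  using bbb_add[of f "\<lambda>x. - 1 * g x"] bbb_scale[of g "-1"] by simp

lemma bbb_indicator: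
  assumes "bounded A" "A \<in> sets borel"
  shows "bbb (indicator A)"
proof -
  obtain b where "\<forall>x\<in>A. norm x < b" using assms unfolding bounded_pos_less by blast
  then have "b \<le> norm x \<longrightarrow> indicator A x = (0::real)" for x by (auto simp: indicator_def)
  moreover have "\<bar>indicator A x\<bar> \<le> (1::real)" for x by (simp add: indicator_def)
  ultimately show ?thesis using assms(2) unfolding bbb_def
    by (intro conjI exI[of _ "1::real"] exI[of _ b]) auto
qed

text \<open>For \<open>u = v\<close> this is the squared L2 norm of the difference between
  \<open>u\<close> and its translate. It is bilinear because the matrix entries need two
  arguments.\<close>

definition transl :: "('a::euclidean_space \<Rightarrow> real) \<Rightarrow> ('a \<Rightarrow> real) \<Rightarrow> 'a \<Rightarrow> real" where
  "transl u v s = (LINT x|lborel. (u (x + s) - u x) * (v (x + s) - v x))"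

lemma bbb_transl_integrand:
  assumes "bbb u" "bbb v"
  shows "bbb (\<lambda>x. (u (x + s) - u x) * (v (x + s) - v x))"
  using assms bbb_translate[of u s] bbb_translate[of v s] by (intro bbb_mult bbb_diff) (simp_all add: add.commute)

text \<open>Substitute \<open>y = x + s\<close> and apply Fubini, which is justified because the
  supports of \<open>k\<close> and \<open>u\<close> confine the integrand to a bounded product set.
  The form thereby becomes a weighted integral of translation energies. The \<open>lebesgue\<close>
  version matches the definition of the form; all estimates use \<open>lborel\<close>.\<close>

lemma kernel_form:
  fixes k u v :: "'a::euclidean_space \<Rightarrow> real"
  assumes k: "bbb k" and u: "bbb u" and v: "bbb v"
  defines "f \<equiv> \<lambda>x y. k (y - x) * (u y - u x) * (v y - v x)"
  shows "(LINT x|lebesgue. LINT y|lebesgue. f x y) = (LINT s|lborel. k s * transl u v s)"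
    and "(LINT x|lborel. LINT y|lborel. f x y) = (LINT s|lborel. k s * transl u v s)"
    and "integrable lborel (\<lambda>x. LINT y|lborel. f x y)"
    and "integrable lborel (\<lambda>s. k s * transl u v s)"
    and "transl u v \<in> borel_measurable borel"
proof -
  note [measurable] = bbb_measurable[OF k] bbb_measurable[OF u] bbb_measurable[OF v]
  have fm[measurable]: "(\<lambda>p. f (fst p) (snd p)) \<in> borel_measurable (borel \<Otimes>\<^sub>M borel)"
    unfolding f_def by measurable
  have fm1[measurable]: "(\<lambda>y. f x y) \<in> borel_measurable borel" for x
    unfolding f_def by measurable
  show tm: "transl u v \<in> borel_measurable borel"
    unfolding transl_def[abs_def] by measurable
  have 1: "(LINT y|lebesgue. f x y) = (LINT y|lborel. f x y)" for x
    by (rule integral_completion) measurable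
  have "(LINT x|lebesgue. LINT y|lebesgue. f x y) = (LINT x|lebesgue. LINT y|lborel. f x y)" by (simp only: 1)
  also have "\<dots> = (LINT x|lborel. LINT y|lborel. f x y)"
    by (rule integral_completion) measurable
  finally have L: "(LINT x|lebesgue. LINT y|lebesgue. f x y) = (LINT x|lborel. LINT y|lborel. f x y)" .
  define g where "g s x = k s * ((u (x + s) - u x) * (v (x + s) - v x))" for s x
  have gm[measurable]: "(\<lambda>p. g (fst p) (snd p)) \<in> borel_measurable (borel \<Otimes>\<^sub>M borel)"
    unfolding g_def by measurable
  have fg: "(LINT y|lborel. f x y) = (LINT s|lborel. g s x)" for x
    by (subst lborel_integral_translate[where c = x]) (auto simp: f_def g_def ac_simps intro!: arg_cong[where f = "integral\<^sup>L lborel"])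
  obtain Mk Rk where K: "\<And>x. \<bar>k x\<bar> \<le> Mk" "\<And>x. Rk \<le> norm x \<Longrightarrow> k x = 0" using k unfolding bbb_def by blast
  obtain Mu Ru where U: "\<And>x. \<bar>u x\<bar> \<le> Mu" "\<And>x. Ru \<le> norm x \<Longrightarrow> u x = 0" using u unfolding bbb_def by blast
  obtain Mv where V: "\<And>x. \<bar>v x\<bar> \<le> Mv" using v unfolding bbb_def by blast
  have int: "integrable (lborel \<Otimes>\<^sub>M lborel) (\<lambda>(s, x). g s x)"
    unfolding lborel_prod
  proof (rule integrableI_bounded_set[where A = "ball 0 Rk \<times> ball 0 (Ru + Rk)" and B = "Mk * ((Mu + Mu) * (Mv + Mv))"])
    show "emeasure lborel (ball (0::'a) Rk \<times> ball (0::'a) (Ru + Rk)) < \<infinity>"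
      by (rule emeasure_bounded_finite) (simp add: bounded_Times)
    show "ball (0::'a) Rk \<times> ball (0::'a) (Ru + Rk) \<in> sets lborel"
      by (simp add: borel_open open_Times)
    show "(\<lambda>(s, x). g s x) \<in> borel_measurable lborel"
      using gm by (simp add: borel_prod case_prod_beta')
    have "\<bar>g s x\<bar> \<le> Mk * ((Mu + Mu) * (Mv + Mv))" for s x
      unfolding g_def abs_mult using K(1)[of s] U(1)[of x] U(1)[of "x + s"] V[of x] V[of "x + s"]
      by (intro mult_mono) auto
    then show "AE p \<in> ball 0 Rk \<times> ball 0 (Ru + Rk) in lborel. norm (case p of (s, x) \<Rightarrow> g s x) \<le> Mk * ((Mu + Mu) * (Mv + Mv))"
      by (intro AE_I2) auto
    have "g s x = 0" if "(s, x) \<notin> ball 0 Rk \<times> ball 0 (Ru + Rk)" for s x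
    proof (cases "Rk \<le> norm s")
      case True
      then show ?thesis using K(2) by (simp add: g_def)
    next
      case False
      then have "Ru + Rk \<le> norm x" using that by auto
      moreover have "norm x \<le> norm (x + s) + norm s" using norm_triangle_ineq4[of "x + s" s] by simp
      moreover have "0 \<le> Rk" using False norm_ge_zero[of s] by linarith
      ultimately have "Ru \<le> norm x" "Ru \<le> norm (x + s)" using False by auto
      then show ?thesis using U(2) by (simp add: g_def)
    qed
    then show "AE p in lborel. p \<notin> ball 0 Rk \<times> ball 0 (Ru + Rk) \<longrightarrow> (case p of (s, x) \<Rightarrow> g s x) = 0"
      by (intro AE_I2) (metis case_prod_conv surj_pair)
  qed
  have gt: "(LINT x|lborel. g s x) = k s * transl u v s" for s
    by (simp add: g_def transl_def)
  show 2: "(LINT x|lborel. LINT y|lborel. f x y) = (LINT s|lborel. k s * transl u v s)"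
    unfolding fg gt[symmetric] by (rule lborel_pair.Fubini_integral[OF int])
  with L show "(LINT x|lebesgue. LINT y|lebesgue. f x y) = (LINT s|lborel. k s * transl u v s)" by simp
  show "integrable lborel (\<lambda>x. LINT y|lborel. f x y)"
    unfolding fg using lborel_pair.integrable_snd[OF int] by simp
  show "integrable lborel (\<lambda>s. k s * transl u v s)"
    using lborel_pair.integrable_fst[OF int] by (simp add: gt)
qed

lemma transl_nonneg: "0 \<le> transl u u s"
  unfolding transl_def by (intro integral_nonneg_AE AE_I2) (simp add: power2_eq_square[symmetric])

lemma transl_measurable: "bbb u \<Longrightarrow> bbb v \<Longrightarrow> transl u v \<in> borel_measurable borel"
  by (rule kernel_form(5)[of "\<lambda>_. 0"]) (auto simp: bbb_def)

lemma integral_diff_square_le: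
  assumes u: "bbb u" and v: "bbb v"
  shows "(LINT x|lborel. (u x - v x)\<^sup>2) \<le> 2 * (LINT x|lborel. (u x)\<^sup>2) + 2 * (LINT x|lborel. (v x)\<^sup>2)"
proof -
  have i: "integrable lborel (\<lambda>x. (u x)\<^sup>2)" "integrable lborel (\<lambda>x. (v x)\<^sup>2)" "integrable lborel (\<lambda>x. (u x - v x)\<^sup>2)"
    using u v by (auto intro!: bbb_integrable bbb_mult bbb_diff simp: power2_eq_square)
  have "(LINT x|lborel. (u x - v x)\<^sup>2) \<le> (LINT x|lborel. 2 * (u x)\<^sup>2 + 2 * (v x)\<^sup>2)"
  proof (rule integral_mono)
    show "(u x - v x)\<^sup>2 \<le> 2 * (u x)\<^sup>2 + 2 * (v x)\<^sup>2" for x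
      using zero_le_power2[of "u x + v x"] by (simp add: power2_eq_square algebra_simps)
  qed (use i in auto)
  also have "\<dots> = 2 * (LINT x|lborel. (u x)\<^sup>2) + 2 * (LINT x|lborel. (v x)\<^sup>2)" using i by simp
  finally show ?thesis .
qed

lemma transl_le_square:
  assumes u: "bbb u"
  shows "transl u u s \<le> 4 * (LINT x|lborel. (u x)\<^sup>2)"
proof -
  have "(LINT x|lborel. (u (s + x))\<^sup>2) = (LINT x|lborel. (u x)\<^sup>2)"
    using bbb_measurable[OF u] by (subst lborel_integral_translate[of "\<lambda>x. (u x)\<^sup>2" s]) auto
  then show ?thesis
    using integral_diff_square_le[OF bbb_translate[OF u, of s] u]
    by (simp add: transl_def power2_eq_square add.commute)
qed

text \<open>A shift by \<open>2 *\<^sub>R s\<close> is two shifts by \<open>s\<close>, so its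
  difference is \<open>d (s + x) + d x\<close>. The sum is written as a difference with
  \<open>- 1 * d x\<close> to reuse \<open>integral_diff_square_le\<close>.\<close>

lemma transl_double:
  assumes u: "bbb u"
  shows "transl u u (2 *\<^sub>R s) \<le> 4 * transl u u s"
proof -
  define d where "d x = u (s + x) - u x" for x
  have d: "bbb d" unfolding d_def[abs_def] by (intro bbb_diff bbb_translate u)
  have e: "transl u u s = (LINT x|lborel. (d x)\<^sup>2)"
    by (simp add: transl_def d_def power2_eq_square add.commute)
  have "transl u u (2 *\<^sub>R s) = (LINT x|lborel. (d (s + x) - (- 1 * d x))\<^sup>2)"
    by (simp add: transl_def d_def power2_eq_square algebra_simps scaleR_2)
  also have "\<dots> \<le> 2 * (LINT x|lborel. (d (s + x))\<^sup>2) + 2 * (LINT x|lborel. (- 1 * d x)\<^sup>2)"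
    by (rule integral_diff_square_le) (intro bbb_translate bbb_scale d)+
  also have "(LINT x|lborel. (d (s + x))\<^sup>2) = (LINT x|lborel. (d x)\<^sup>2)"
    using bbb_measurable[OF d] by (subst lborel_integral_translate[of "\<lambda>x. (d x)\<^sup>2" s]) auto
  finally show ?thesis by (simp add: e)
qed

text \<open>The factor \<open>4 ^ n\<close> is the square of \<open>2 ^ n\<close>, so the bound is
  of the right order for every \<open>n\<close>: a fixed \<open>n\<close> shrinks the radius of an
  oscillation, and \<open>n\<close> tending to infinity gives the gradient bound
  \<open>transl_le_energy\<close>.\<close>

lemma transl_divide:
  assumes u: "bbb u"
  shows "transl u u s \<le> 4 ^ n * transl u u ((1 / 2 ^ n) *\<^sub>R s)"
proof (induction n)
  case (Suc n)
  have h: "transl u u ((1 / 2 ^ n) *\<^sub>R s) \<le> 4 * transl u u ((1 / 2 ^ Suc n) *\<^sub>R s)"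
    using transl_double[OF u, of "(1 / 2 ^ Suc n) *\<^sub>R s"] by simp
  note Suc
  also have "4 ^ n * transl u u ((1 / 2 ^ n) *\<^sub>R s) \<le> 4 ^ n * (4 * transl u u ((1 / 2 ^ Suc n) *\<^sub>R s))"
    by (rule mult_left_mono[OF h]) simp
  also have "\<dots> = 4 ^ Suc n * transl u u ((1 / 2 ^ Suc n) *\<^sub>R s)" by simp
  finally show ?case .
qed simp

section \<open>Local oscillation and change of radius\<close>

definition osc :: "real \<Rightarrow> ('a::euclidean_space \<Rightarrow> real) \<Rightarrow> 'a \<Rightarrow> real" where
  "osc R u z = (LINT y|lborel. indicator (ball z R) y * (u y - u z)\<^sup>2)"

text \<open>\<open>kernel_form\<close> with the indicator of a ball as kernel. It links a quantity
  attached to a point \<open>z\<close>, with which interpolation errors can be estimated, to the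
  nonlocal form. As \<open>osc\<close> is not divided by the volume of the ball, powers of the
  radius stay explicit.\<close>

lemma osc_energy:
  fixes u :: "'a::euclidean_space \<Rightarrow> real"
  assumes u: "bbb u"
  shows "(LINT z|lborel. osc R u z) = (LINT s|lborel. indicator (ball 0 R) s * transl u u s)"
    and "integrable lborel (osc R u)"
    and "integrable lborel (\<lambda>s. indicator (ball 0 R) s * transl u u s)"
proof -
  have k: "bbb (indicator (ball (0::'a) R))" by (rule bbb_indicator) auto
  have e: "osc R u z = (LINT y|lborel. indicator (ball 0 R) (y - z) * (u y - u z) * (u y - u z))" for z
    unfolding osc_def by (intro Bochner_Integration.integral_cong) (auto simp: indicator_def dist_norm norm_minus_commute power2_eq_square)
  show "(LINT z|lborel. osc R u z) = (LINT s|lborel. indicator (ball 0 R) s * transl u u s)"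
    "integrable lborel (osc R u)" "integrable lborel (\<lambda>s. indicator (ball 0 R) s * transl u u s)"
    using kernel_form[OF k u u] by (simp_all add: e[abs_def])
qed

text \<open>Rescaling the shifts by \<open>2 ^ n\<close> costs the Jacobian
  \<open>(2 ^ n) ^ DIM('a)\<close>, and \<open>transl_divide\<close> costs \<open>4 ^ n\<close>.
  Hence an oscillation over any fixed multiple of \<delta> is controlled at the radius where the
  kernel is bounded below.\<close>

lemma osc_energy_doubling:
  fixes u :: "'a::euclidean_space \<Rightarrow> real"
  assumes u: "bbb u"
  shows "(LINT z|lborel. osc (2 ^ n * R) u z) \<le> 4 ^ n * (2 ^ n) ^ DIM('a) * (LINT z|lborel. osc R u z)"
proof -
  note [measurable] = transl_measurable[OF u u]
  have b: "indicator (ball 0 (2 ^ n * R)) (2 ^ n *\<^sub>R s) = (indicator (ball 0 R) s :: real)" for s :: 'a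
    by (simp add: indicator_def)
  have "(LINT z|lborel. osc (2 ^ n * R) u z)
      = (LINT s|lborel. indicator (ball 0 (2 ^ n * R)) s * transl u u s)" by (rule osc_energy(1)[OF u])
  also have "\<dots> = (2 ^ n) ^ DIM('a) * (LINT s|lborel. indicator (ball 0 R) s * transl u u (2 ^ n *\<^sub>R s))"
  proof -
    have "(\<lambda>s. indicator (ball 0 (2 ^ n * R)) s * transl u u s) \<in> borel_measurable borel"
      by (intro borel_measurable_times borel_measurable_indicator transl_measurable u) auto
    from lborel_integral_scale[OF this, of "2 ^ n"] show ?thesis by (simp only: b) simp
  qed
  also have "(LINT s|lborel. indicator (ball 0 R) s * transl u u (2 ^ n *\<^sub>R s))
      \<le> (LINT s|lborel. 4 ^ n * (indicator (ball 0 R) s * transl u u s))"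
  proof (rule integral_mono')
    show "integrable lborel (\<lambda>s. 4 ^ n * (indicator (ball 0 R) s * transl u u s))"
      using osc_energy(3)[OF u] by simp
    show "indicator (ball 0 R) s * transl u u (2 ^ n *\<^sub>R s) \<le> 4 ^ n * (indicator (ball 0 R) s * transl u u s)" for s
      using transl_divide[OF u, of "2 ^ n *\<^sub>R s" n] by (auto simp: indicator_def)
    show "0 \<le> 4 ^ n * (indicator (ball 0 R) s * transl u u s)" for s :: 'a using transl_nonneg[of u s] by simp
  qed
  also have "\<dots> = 4 ^ n * (LINT z|lborel. osc R u z)" by (simp add: osc_energy(1)[OF u])
  finally show ?thesis by (simp add: mult_ac)
qed

lemma osc_integrable:
  assumes u: "bbb u"
  shows "integrable lborel (\<lambda>y. indicator (ball z R) y * (u y - u z)\<^sup>2)"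
    "integrable lborel (\<lambda>y. indicator (ball z R) y * \<bar>u y - u z\<bar>)"
proof -
  obtain M where M: "\<And>x. \<bar>u x\<bar> \<le> M" using u unfolding bbb_def by blast
  have d: "\<bar>u y - u z\<bar> \<le> 2 * M" for y using M[of y] M[of z] by linarith
  have "\<bar>(u y - u z)\<^sup>2\<bar> \<le> (2 * M)\<^sup>2" for y
    using power_mono[OF d[of y], of 2] by simp
  then show "integrable lborel (\<lambda>y. indicator (ball z R) y * (u y - u z)\<^sup>2)"
    using bbb_measurable[OF u] by (intro bbb_integrable bbb_mult_right bbb_indicator) auto
  show "integrable lborel (\<lambda>y. indicator (ball z R) y * \<bar>u y - u z\<bar>)"
    using bbb_measurable[OF u] d by (intro bbb_integrable bbb_mult_right[where M = "2 * M"] bbb_indicator) auto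
qed

lemma osc_nonneg: "0 \<le> osc R u z"
  unfolding osc_def by (intro integral_nonneg_AE) auto

lemma osc_mono:
  assumes u: "bbb u" and "R \<le> S"
  shows "osc R u z \<le> osc S u z"
  unfolding osc_def
  by (rule integral_mono[OF osc_integrable(1)[OF u] osc_integrable(1)[OF u]])
    (use \<open>R \<le> S\<close> in \<open>auto simp: indicator_def\<close>)

section \<open>Finite element functions\<close>

text \<open>\<open>grad\<close> is given by a definite description and is unspecified where no
  gradient exists. Its measurability is inferred from almost everywhere agreement with a piecewise
  constant function, which is legitimate because \<open>lebesgue\<close> is complete.\<close>

lemma borel_measurable_lebesgue_AE:
  fixes f g :: "'a::euclidean_space \<Rightarrow> real"
  assumes f: "f \<in> borel_measurable lebesgue" and ae: "AE x in lebesgue. f x = g x"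
  shows "g \<in> borel_measurable lebesgue"
proof (rule measurableI)
  fix S :: "real set" assume "S \<in> sets borel"
  then have S: "f -` S \<inter> space lebesgue \<in> sets lebesgue" using f by (rule measurable_sets[rotated])
  have ae2: "AE x in lebesgue. x \<in> f -` S \<inter> space lebesgue \<longleftrightarrow> x \<in> g -` S \<inter> space lebesgue"
    using ae by eventually_elim simp
  show "g -` S \<inter> space lebesgue \<in> sets lebesgue"
    by (rule completion.in_sets_AE[OF ae2 S]) simp
qed auto

definition verts :: "'a::euclidean_space set \<Rightarrow> 'a set" where
  "verts T = {p. p extreme_point_of T}"

text \<open>On a mesh cell the choice is unique, since a set with interior points determines the
  slope (\<open>cell_affine_unique\<close>). It replaces the pointwise \<open>grad\<close> in all
  computations.\<close>

definition cell_grad :: "('a::euclidean_space \<Rightarrow> real) \<Rightarrow> 'a set \<Rightarrow> 'a" where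
  "cell_grad f T = (SOME a. \<exists>b. \<forall>x\<in>T. f x = inner a x + b)"

locale fe_mesh =
  fixes \<Omega> :: "'a::euclidean_space set" and \<T> :: "'a set set"
  assumes open_dom: "open \<Omega>" and bounded_dom: "bounded \<Omega>" and lipschitz_dom: "lipschitz_boundary \<Omega>"
    and mesh: "conforming_mesh \<Omega> \<T>"
begin

lemma finite_mesh: "finite \<T>" and cover: "\<Union>\<T> = closure \<Omega>"
  using mesh by (auto simp: conforming_mesh_def triangulation_def)

lemma frontier_dom: "frontier \<Omega> = closure \<Omega> - \<Omega>"
  using open_dom by (simp add: frontier_def interior_open)

lemma cell_simplex: "T \<in> \<T> \<Longrightarrow> int DIM('a) simplex T"
  using mesh by (auto simp: conforming_mesh_def)

lemma cell_compact: "T \<in> \<T> \<Longrightarrow> compact T"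
  and cell_convex: "T \<in> \<T> \<Longrightarrow> convex T"
  using compact_simplex convex_simplex cell_simplex by blast+

lemma cell_closed: "T \<in> \<T> \<Longrightarrow> closed T"
  and cell_bounded: "T \<in> \<T> \<Longrightarrow> bounded T"
  using cell_compact compact_imp_closed compact_imp_bounded by blast+

lemma cell_subset: "T \<in> \<T> \<Longrightarrow> T \<subseteq> closure \<Omega>"
  using cover by blast

lemma cell_interior: 
  assumes "T \<in> \<T>"
  shows "interior T \<noteq> {}"
proof -
  have ad: "aff_dim T = DIM('a)" using aff_dim_simplex[OF cell_simplex[OF assms]] .
  then have "affine hull T = UNIV" by (simp add: aff_dim_eq_full)
  then have "rel_interior T = interior T" by (rule rel_interior_interior)
  moreover have "T \<noteq> {}" using ad by auto
  ultimately show ?thesis using rel_interior_eq_empty[OF cell_convex[OF assms]] by simp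
qed

lemma cell_verts:
  assumes "T \<in> \<T>"
  shows "finite (verts T)" "card (verts T) = DIM('a) + 1" "T = convex hull (verts T)"
proof -
  obtain C where C: "\<not> affine_dependent C" "int (card C) = int DIM('a) + 1" "T = convex hull C"
    using cell_simplex[OF assms] by (auto simp: simplex_def)
  have "verts T = C" using extreme_point_of_convex_hull_affine_independent[OF C(1)] C(3) by (auto simp: verts_def)
  then show "finite (verts T)" "card (verts T) = DIM('a) + 1" "T = convex hull (verts T)"
    using C aff_independent_finite by auto
qed

lemma verts_subset: "verts T \<subseteq> T"
  by (auto simp: verts_def extreme_point_of_def)

lemma cell_convex_combination:
  assumes "T \<in> \<T>" "x \<in> T"
  obtains b where "\<forall>p\<in>verts T. 0 \<le> b p" "sum b (verts T) = 1" "(\<Sum>p\<in>verts T. b p *\<^sub>R p) = x"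
proof -
  have "x \<in> convex hull (verts T)"
    by (subst cell_verts(3)[OF assms(1), symmetric]) (rule assms(2))
  then show ?thesis unfolding convex_hull_finite[OF cell_verts(1)[OF assms(1)]] using that by blast
qed

text \<open>The intersection is a face of both cells and, as they differ, a proper face of at least
  one of them; it therefore has lower dimension and empty interior.\<close>

lemma cell_overlap_negligible:
  assumes "T \<in> \<T>" "T' \<in> \<T>" "T \<noteq> T'"
  shows "negligible (T \<inter> T')"
proof -
  have f: "(T \<inter> T') face_of T" "(T \<inter> T') face_of T'"
  proof -
    have m: "(S \<inter> S') face_of S" if "S \<in> \<T>" "S' \<in> \<T>" for S S'
      using mesh[unfolded conforming_mesh_def triangulation_def] that by blast
    show "(T \<inter> T') face_of T" using m assms by simp
    show "(T \<inter> T') face_of T'" using m[OF assms(2,1)] by (simp add: Int_commute)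
  qed
  have d: "aff_dim T = DIM('a)" "aff_dim T' = DIM('a)"
    using assms aff_dim_simplex cell_simplex by blast+
  have "T \<inter> T' \<noteq> T \<or> T \<inter> T' \<noteq> T'" using assms(3) by blast
  then have "aff_dim (T \<inter> T') < DIM('a)"
    using face_of_aff_dim_lt[OF cell_convex[OF assms(1)] f(1)] face_of_aff_dim_lt[OF cell_convex[OF assms(2)] f(2)] d
    by argo
  then have "interior (T \<inter> T') = {}" using aff_dim_nonempty_interior[of "T \<inter> T'"] by fastforce
  then show ?thesis using negligible_convex_interior convex_Int cell_convex assms by blast
qed

lemma interior_cell_subset: "T \<in> \<T> \<Longrightarrow> interior T \<subseteq> \<Omega>"
  using interior_closure_lipschitz[OF lipschitz_dom bounded_dom open_dom] interior_mono cell_subset by metis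

text \<open>The exceptional set consists of the cell frontiers and the pairwise intersections; being
  closed, it is null for \<open>lborel\<close> and not only for \<open>lebesgue\<close>. The
  quantifier over \<open>c\<close> stands inside, so that one null set serves all piecewise constant
  functions.\<close>

lemma AE_cell_partition:
  "AE x in lborel. (x \<in> closure \<Omega> \<longrightarrow> x \<in> \<Omega>) \<and> (\<forall>T\<in>\<T>. x \<in> T \<longrightarrow> x \<in> interior T) \<and>
     (\<forall>c :: 'a set \<Rightarrow> real. \<forall>T\<in>\<T>. x \<in> T \<longrightarrow> (\<Sum>S\<in>\<T>. indicator S x * c S) = c T)"
proof -
  define N where "N = (\<Union>T\<in>\<T>. frontier T) \<union> (\<Union>T\<in>\<T>. \<Union>T'\<in>\<T> - {T}. T \<inter> T')"
  have "negligible (\<Union>T\<in>\<T>. frontier T)"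
    using finite_mesh negligible_convex_frontier cell_convex by (intro negligible_Union) auto
  moreover have "negligible (\<Union>T'\<in>\<T> - {T}. T \<inter> T')" if "T \<in> \<T>" for T
    by (rule negligible_Union) (use that finite_mesh cell_overlap_negligible in blast)+
  then have "negligible (\<Union>T\<in>\<T>. \<Union>T'\<in>\<T> - {T}. T \<inter> T')"
    by (intro negligible_Union) (use finite_mesh in blast)+
  ultimately have neg: "negligible N" unfolding N_def by (rule negligible_Un)
  have "closed N" unfolding N_def
    using finite_mesh cell_closed by (intro closed_Un closed_Union ballI finite_imageI) auto
  then have "N \<in> null_sets lborel"
    using neg by (simp add: negligible_iff_null_sets null_sets_completion_iff borel_closed)
  then have "AE x in lborel. x \<notin> N" by (rule AE_not_in)
  then show ?thesis
  proof eventually_elim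
    case (elim x)
    have i: "x \<in> interior T" if "T \<in> \<T>" "x \<in> T" for T
      using that elim closure_subset by (auto simp: N_def frontier_def)
    have u: "S = T" if "T \<in> \<T>" "x \<in> T" "S \<in> \<T>" "x \<in> S" for S T
      using that elim by (auto simp: N_def)
    have "(\<Sum>S\<in>\<T>. indicator S x * c S) = c T" if "T \<in> \<T>" "x \<in> T" for T and c :: "'a set \<Rightarrow> real"
    proof -
      have "(\<Sum>S\<in>\<T>. indicator S x * c S) = (\<Sum>S\<in>\<T>. if S = T then c T else 0)"
        using u that by (intro sum.cong) (auto simp: indicator_def)
      then show ?thesis using that finite_mesh by simp
    qed
    moreover have "x \<in> \<Omega>" if "x \<in> closure \<Omega>"
      using that cover i interior_cell_subset by blast
    ultimately show ?case using i by blast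
  qed
qed

lemma integral_cells:
  fixes h :: "'a \<Rightarrow> real"
  assumes h: "integrable lborel h" and 0: "\<And>x. x \<notin> closure \<Omega> \<Longrightarrow> h x = 0"
  shows "(LINT x|lborel. h x) = (\<Sum>T\<in>\<T>. (LINT x|lborel. indicator T x * h x))"
proof -
  have i: "integrable lborel (\<lambda>x. indicator T x * h x)" if "T \<in> \<T>" for T
    using h cell_closed[OF that] integrable_mult_indicator[of T lborel h] by (simp add: borel_closed)
  have "(LINT x|lborel. h x) = (LINT x|lborel. (\<Sum>T\<in>\<T>. indicator T x * h x))"
  proof (rule integral_cong_AE)
    show "AE x in lborel. h x = (\<Sum>T\<in>\<T>. indicator T x * h x)"
      using AE_cell_partition
    proof eventually_elim
      case (elim x)
      show ?case
      proof (cases "x \<in> closure \<Omega>")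
        case True
        then obtain T where "T \<in> \<T>" "x \<in> T" using cover by blast
        then show ?thesis using elim[THEN conjunct2, THEN conjunct2, THEN spec, of "\<lambda>_. h x"] by auto
      qed (simp add: 0)
    qed
  qed (use h i in auto)
  also have "\<dots> = (\<Sum>T\<in>\<T>. (LINT x|lborel. indicator T x * h x))"
    using i by (rule Bochner_Integration.integral_sum)
  finally show ?thesis .
qed

lemma cell_measure_pos: "T \<in> \<T> \<Longrightarrow> 0 < measure lborel T"
proof -
  assume T: "T \<in> \<T>"
  have "\<not> negligible T" using negligible_convex_interior[OF cell_convex[OF T]] cell_interior[OF T] by simp
  then have "emeasure lborel T \<noteq> 0" using cell_closed[OF T]
    by (auto simp: negligible_iff_null_sets null_sets_completion_iff borel_closed)
  then show ?thesis using emeasure_bounded_finite[OF cell_bounded[OF T]]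
    by (simp add: measure_def enn2real_positive_iff zero_less_iff_neq_zero)
qed

lemma cell_affine_unique:
  assumes "T \<in> \<T>" "\<And>x. x \<in> T \<Longrightarrow> inner a x + b = inner a' x + b'"
  shows "a = a'"
proof -
  obtain z e where z: "0 < e" "cball z e \<subseteq> T"
    using cell_interior[OF assms(1)] by (metis all_not_in_conv mem_interior_cball)
  \<comment> \<open>A step along the difference of the slopes that stays in the ball; the summand 1
    avoids division by zero when the slopes agree.\<close>
  define w where "w = (e / (1 + norm (a - a'))) *\<^sub>R (a - a')"
  have "e / (1 + n) * n \<le> e" if "0 \<le> n" for n using z(1) that by (simp add: field_simps)
  from this[of "norm (a - a')"] have "norm w \<le> e" using z(1) unfolding w_def norm_scaleR by simp
  then have "z \<in> T" "z + w \<in> T" using z by (auto simp: subset_iff dist_norm)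
  then have "inner (a - a') w = 0" using assms(2)[of z] assms(2)[of "z + w"]
    by (simp add: inner_add_right inner_diff_left)
  then have "inner (a - a') (a - a') = 0" using z(1) norm_ge_zero[of "a - a'"]
    by (auto simp: w_def add_nonneg_eq_0_iff)
  then show ?thesis by simp
qed

lemma cell_grad_eqI:
  assumes "T \<in> \<T>" "\<And>x. x \<in> T \<Longrightarrow> f x = inner a x + b"
  shows "cell_grad f T = a"
proof -
  have "\<exists>b. \<forall>x\<in>T. f x = inner (cell_grad f T) x + b"
    unfolding cell_grad_def by (rule someI[of _ a]) (use assms in blast)
  then obtain b' where "\<forall>x\<in>T. f x = inner (cell_grad f T) x + b'" by blast
  then show ?thesis using cell_affine_unique[OF assms(1), of "cell_grad f T" b' a b] assms(2) by auto
qed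

abbreviation "V \<equiv> fe_space \<Omega> \<T>"

lemma fe_affine:
  assumes "v \<in> V" "T \<in> \<T>"
  obtains b where "\<And>x. x \<in> T \<Longrightarrow> v x = inner (cell_grad v T) x + b"
proof -
  obtain a b where "\<forall>x\<in>T. v x = inner a x + b" using assms unfolding fe_space_def by blast
  with cell_grad_eqI[OF assms(2), of v a b] that show ?thesis by blast
qed

lemma fe_diff:
  assumes "v \<in> V" "T \<in> \<T>" "x \<in> T" "y \<in> T"
  shows "v x - v y = inner (cell_grad v T) (x - y)"
  using fe_affine[OF assms(1,2)] assms(3,4) by (metis add_diff_cancel_right inner_diff_right)

lemma fe_zero: "v \<in> V \<Longrightarrow> x \<notin> \<Omega> \<Longrightarrow> v x = 0"
  unfolding fe_space_def frontier_dom by blast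

lemma fe_zero_ext: "v \<in> V \<Longrightarrow> zero_ext \<Omega> v = v"
  using fe_zero by (force simp: zero_ext_def)

text \<open>On the segment from \<open>x\<close> to \<open>y\<close> the preimages of the cells and
  of the complement of \<Omega>, where \<open>v\<close> vanishes, are finitely many closed pieces,
  and \<open>v\<close> is Lipschitz on each. The constant depends badly on the mesh, but it serves
  only qualitative purposes: continuity, a dominating function, and the vanishing of
  \<open>v\<close> when all slopes vanish.\<close>

lemma fe_lipschitz_sum:
  assumes v: "v \<in> V"
  shows "\<bar>v x - v y\<bar> \<le> (\<Sum>T\<in>\<T>. norm (cell_grad v T)) * norm (x - y)"
proof -
  define L where "L = (\<Sum>T\<in>\<T>. norm (cell_grad v T))"
  have L0: "0 \<le> L" unfolding L_def by (intro sum_nonneg) simp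
  have LT: "norm (cell_grad v T) \<le> L" if "T \<in> \<T>" for T
    unfolding L_def using that finite_mesh by (intro member_le_sum) auto
  define g where "g t = x + t *\<^sub>R (y - x)" for t :: real
  have gc: "continuous_on UNIV g" unfolding g_def by (intro continuous_intros)
  have "(L * norm (x - y))-lipschitz_on {0..1} (v \<circ> g)"
  proof (rule lipschitz_on_closed_Union[where I = "insert (- \<Omega>) \<T>" and U = "\<lambda>S. g -` S"])
    show "finite (insert (- \<Omega>) \<T>)" "0 \<le> L * norm (x - y)" using finite_mesh L0 by auto
    show "{0..1} \<subseteq> (\<Union>S\<in>insert (- \<Omega>) \<T>. g -` S)"
    proof
      fix t :: real
      have "g t \<in> - \<Omega> \<or> g t \<in> \<Union>\<T>" unfolding cover using closure_subset[of \<Omega>] by blast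
      then show "t \<in> (\<Union>S\<in>insert (- \<Omega>) \<T>. g -` S)" by blast
    qed
    fix S assume S: "S \<in> insert (- \<Omega>) \<T>"
    then have "closed S" using cell_closed open_dom by auto
    then show "closed (g -` S)" using gc by (rule closed_vimage)
    show "(L * norm (x - y))-lipschitz_on (g -` S) (v \<circ> g)"
    proof (rule lipschitz_onI)
      fix s t assume st: "s \<in> g -` S" "t \<in> g -` S"
      show "dist ((v \<circ> g) s) ((v \<circ> g) t) \<le> L * norm (x - y) * dist s t"
      proof (cases "S \<in> \<T>")
        case True
        have gd: "g s - g t = (s - t) *\<^sub>R (y - x)" by (simp add: g_def algebra_simps)
        have "\<bar>v (g s) - v (g t)\<bar> \<le> norm (cell_grad v S) * norm (g s - g t)"
          using fe_diff[OF v True, of "g s" "g t"] st Cauchy_Schwarz_ineq2 by auto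
        also have "\<dots> \<le> L * norm (g s - g t)" using LT[OF True] by (intro mult_right_mono) auto
        finally show ?thesis by (simp add: gd dist_real_def norm_minus_commute mult_ac)
      next
        case False
        then have "S = - \<Omega>" using S by simp
        then have "v (g s) = 0" "v (g t) = 0" using st fe_zero[OF v] by auto
        then show ?thesis using L0 by simp
      qed
    qed (use L0 in simp)
  qed
  from lipschitz_onD[OF this, of 0 1] show ?thesis
    by (simp add: g_def dist_real_def L_def)
qed

lemma fe_lipschitz: "v \<in> V \<Longrightarrow> \<exists>L\<ge>0. \<forall>x y. \<bar>v x - v y\<bar> \<le> L * norm (x - y)"
  using fe_lipschitz_sum by (intro exI[of _ "\<Sum>T\<in>\<T>. norm (cell_grad v T)"]) (simp add: sum_nonneg)

lemma fe_continuous: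
  assumes v: "v \<in> V"
  shows "continuous_on UNIV v"
proof -
  obtain L where "0 \<le> L" "\<And>x y. \<bar>v x - v y\<bar> \<le> L * norm (x - y)" using fe_lipschitz[OF v] by blast
  then have "L-lipschitz_on UNIV v" by (intro lipschitz_onI) (auto simp: dist_norm)
  then show ?thesis by (rule lipschitz_on_continuous_on)
qed

lemma fe_bbb:
  assumes v: "v \<in> V"
  shows "bbb v"
proof -
  obtain R where R: "\<And>x. x \<in> closure \<Omega> \<Longrightarrow> norm x < R"
    using bounded_closure[OF bounded_dom] unfolding bounded_pos_less by blast
  have "compact (v ` closure \<Omega>)"
    using bounded_dom by (intro compact_continuous_image continuous_on_subset[OF fe_continuous[OF v]]) auto
  then obtain M where M: "\<And>x. x \<in> closure \<Omega> \<Longrightarrow> \<bar>v x\<bar> \<le> M"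
    using compact_imp_bounded bounded_iff by (metis image_eqI real_norm_def)
  have "\<bar>v x\<bar> \<le> max M 0" for x
    using M[of x] fe_zero[OF v, of x] closure_subset[of \<Omega>] by (cases "x \<in> \<Omega>") auto
  moreover have "R \<le> norm x \<longrightarrow> v x = 0" for x
    using R[of x] fe_zero[OF v, of x] closure_subset[of \<Omega>] by force
  moreover have "v \<in> borel_measurable borel"
    using fe_continuous[OF v] by (rule borel_measurable_continuous_onI)
  ultimately show ?thesis unfolding bbb_def by blast
qed

lemma fe_grad:
  assumes v: "v \<in> V" and T: "T \<in> \<T>" and x: "x \<in> interior T"
  shows "GDERIV v x :> cell_grad v T" "grad v x = cell_grad v T"
proof -
  obtain b where b: "\<And>y. y \<in> T \<Longrightarrow> v y = inner (cell_grad v T) y + b" using fe_affine[OF v T] by blast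
  have "((\<lambda>y. inner (cell_grad v T) y + b) has_derivative (\<lambda>h. inner h (cell_grad v T))) (at x)"
    by (auto intro!: derivative_eq_intros simp: inner_commute)
  then have d: "(v has_derivative (\<lambda>h. inner h (cell_grad v T))) (at x)"
    by (rule has_derivative_transform_within_open[OF _ open_interior x]) (use b interior_subset in force)
  then show 1: "GDERIV v x :> cell_grad v T" by (simp add: gderiv_def)
  have "D = cell_grad v T" if "GDERIV v x :> D" for D
  proof -
    have "(\<lambda>h. inner h D) = (\<lambda>h. inner h (cell_grad v T))"
      using has_derivative_unique d that by (simp add: gderiv_def) blast
    then have "inner (D - cell_grad v T) D = inner (D - cell_grad v T) (cell_grad v T)" by meson
    then have "inner (D - cell_grad v T) (D - cell_grad v T) = 0" by (simp add: inner_diff_right)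
    then show ?thesis by simp
  qed
  with 1 show "grad v x = cell_grad v T" unfolding grad_def by blast
qed

lemma fe_stiffness:
  assumes u: "u \<in> V" and v: "v \<in> V"
  shows "(LINT x:\<Omega>|lebesgue. inner (grad u x) (grad v x))
    = (\<Sum>T\<in>\<T>. measure lborel T * inner (cell_grad u T) (cell_grad v T))"
proof -
  define c where "c T = inner (cell_grad u T) (cell_grad v T)" for T
  define h where "h x = (\<Sum>T\<in>\<T>. indicator T x * c T)" for x
  have hm: "h \<in> borel_measurable borel" unfolding h_def
    using cell_closed by (intro borel_measurable_sum borel_measurable_times borel_measurable_indicator) (auto intro: borel_closed)
  have ae: "AE x in lborel. h x = indicator \<Omega> x *\<^sub>R inner (grad u x) (grad v x)"
    using AE_cell_partition
  proof eventually_elim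
    case (elim x)
    show ?case
    proof (cases "x \<in> closure \<Omega>")
      case True
      then obtain T where T: "T \<in> \<T>" "x \<in> T" using cover by blast
      then have "h x = c T" "x \<in> interior T" "x \<in> \<Omega>" using elim True unfolding h_def by blast+
      then show ?thesis using fe_grad(2)[OF u T(1)] fe_grad(2)[OF v T(1)] by (simp add: c_def)
    next
      case False
      then have "x \<notin> T" if "T \<in> \<T>" for T using cell_subset[OF that] by blast
      then have "h x = 0" by (simp add: h_def)
      moreover have "x \<notin> \<Omega>" using False closure_subset by blast
      ultimately show ?thesis by simp
    qed
  qed
  have aeL: "AE x in lebesgue. h x = indicator \<Omega> x *\<^sub>R inner (grad u x) (grad v x)"
    using ae by (rule AE_completion)
  have hmL: "h \<in> borel_measurable lebesgue" using hm by (intro measurable_completion) simp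
  have "(LINT x:\<Omega>|lebesgue. inner (grad u x) (grad v x)) = (LINT x|lebesgue. h x)"
    unfolding set_lebesgue_integral_def
  proof (rule integral_cong_AE)
    show "(\<lambda>x. indicator \<Omega> x *\<^sub>R inner (grad u x) (grad v x)) \<in> borel_measurable lebesgue"
      by (rule borel_measurable_lebesgue_AE[OF hmL aeL])
    show "AE x in lebesgue. indicator \<Omega> x *\<^sub>R inner (grad u x) (grad v x) = h x"
      using aeL by eventually_elim simp
  qed (rule hmL)
  also have "\<dots> = (LINT x|lborel. h x)" using hm by (intro integral_completion) simp
  also have "\<dots> = (\<Sum>T\<in>\<T>. (LINT x|lborel. indicator T x * c T))"
    unfolding h_def using cell_bounded cell_closed
    by (intro Bochner_Integration.integral_sum integrable_mult_left integrable_real_indicator emeasure_bounded_finite)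
       (auto intro: borel_closed)
  also have "\<dots> = (\<Sum>T\<in>\<T>. measure lborel T * c T)" by simp
  finally show ?thesis by (simp add: c_def)
qed

end

lemma lborel_integral_homothety:
  fixes f :: "'a::euclidean_space \<Rightarrow> real"
  assumes f: "f \<in> borel_measurable borel" and c: "0 < c"
  shows "(LINT y|lborel. f y) = c ^ DIM('a) * (LINT s|lborel. f (a + c *\<^sub>R s))"
  using lborel_integral_translate[OF f, of a] lborel_integral_scale[OF _ c, of "\<lambda>y. f (a + y)"] f by simp

lemma indicator_bbb_mult: "bbb f \<Longrightarrow> closed T \<Longrightarrow> bbb (\<lambda>x. indicator T x * f x)"
  using bbb_mult_right[of f "indicator T" 1]
  by (simp add: mult.commute borel_closed borel_measurable_indicator indicator_def)

context fe_mesh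
begin

text \<open>The Dirichlet energy written cell by cell; \<open>local_quad\<close> identifies it with
  the quadratic form of the local stiffness matrix.\<close>

definition energy :: "('a \<Rightarrow> real) \<Rightarrow> real" where
  "energy v = (\<Sum>T\<in>\<T>. measure lborel T * (norm (cell_grad v T))\<^sup>2)"

lemma cell_indicator_integrable: "T \<in> \<T> \<Longrightarrow> integrable lborel (\<lambda>x. indicator T x * (c::real))"
  using cell_bounded cell_closed
  by (intro integrable_mult_left integrable_real_indicator emeasure_bounded_finite) (auto intro: borel_closed)

text \<open>By the triangle inequality the left side is at most \<open>n\<^sup>2\<close> times its value at \<open>s/n\<close>, and for \<open>n = 2\<^sup>k\<close> these bounds converge to
  \<open>\<integral> (\<nabla>v \<bullet> s)\<^sup>2\<close>.\<close>

lemma transl_le_energy: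
  assumes v: "v \<in> V"
  shows "transl v v s \<le> (norm s)\<^sup>2 * energy v"
proof -
  note bv = fe_bbb[OF v]
  define F where "F k x = (2 ^ k * (v (x + (1 / 2 ^ k) *\<^sub>R s) - v x))\<^sup>2" for k :: nat and x
  define G where "G x = (\<Sum>T\<in>\<T>. indicator T x * (inner (cell_grad v T) s)\<^sup>2)" for x
  obtain L where L: "0 \<le> L" "\<And>x y. \<bar>v x - v y\<bar> \<le> L * norm (x - y)" using fe_lipschitz[OF v] by blast
  obtain R where R: "\<And>x. R \<le> norm x \<Longrightarrow> v x = 0" using bv unfolding bbb_def by blast
  have Fm: "F k \<in> borel_measurable borel" for k
    unfolding F_def using bbb_measurable[OF bv] by measurable
  have Gm: "G \<in> borel_measurable borel" unfolding G_def
    using cell_closed by (intro borel_measurable_sum borel_measurable_times borel_measurable_indicator) (auto intro: borel_closed)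
  have Fe: "(LINT x|lborel. F k x) = 4 ^ k * transl v v ((1 / 2 ^ k) *\<^sub>R s)" for k
    by (simp add: F_def transl_def power_mult_distrib power2_eq_square[of "v _ - v _"] power_mult[symmetric] mult.commute[of k 2])
      (simp add: power_mult)
  have lim: "(\<lambda>k. LINT x|lborel. F k x) \<longlonglongrightarrow> (LINT x|lborel. G x)"
  \<comment> \<open>The scaled differences are bounded through the Lipschitz constant, and since no
    shift is longer than \<open>norm s\<close>, one ball contains all their supports.\<close>
  proof (rule integral_dominated_convergence[where w = "\<lambda>x. indicator (cball 0 (R + norm s)) x * (L * norm s)\<^sup>2"])
    show "integrable lborel (\<lambda>x. indicator (cball 0 (R + norm s)) x * (L * norm s)\<^sup>2)"
      by (intro integrable_mult_left integrable_real_indicator emeasure_bounded_finite) auto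
    show "AE x in lborel. (\<lambda>k. F k x) \<longlonglongrightarrow> G x"
      using AE_cell_partition
    proof eventually_elim
      case (elim x)
      have tend: "(\<lambda>k. x + (1 / 2 ^ k) *\<^sub>R s) \<longlonglongrightarrow> x"
      proof -
        have "(\<lambda>k. (1 / 2 ^ k) *\<^sub>R s) \<longlonglongrightarrow> 0 *\<^sub>R s"
          using LIMSEQ_realpow_zero[of "1/2"] by (intro tendsto_scaleR tendsto_const) (simp add: power_divide)
        from tendsto_add[OF tendsto_const this, of x] show ?thesis by simp
      qed
      \<comment> \<open>For almost every \<open>x\<close> the shifted point finally lies in the same
        open piece as \<open>x\<close>, where \<open>v\<close> is affine or zero; the scaled
        differences are then equal to the limit, so no differentiability argument is
        required.\<close>
      have "eventually (\<lambda>k. F k x = G x) sequentially"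
      proof (cases "x \<in> closure \<Omega>")
        case True
        then obtain T where T: "T \<in> \<T>" "x \<in> T" using cover by blast
        have GT: "G x = (inner (cell_grad v T) s)\<^sup>2"
          using elim[THEN conjunct2, THEN conjunct2, THEN spec, of "\<lambda>T. (inner (cell_grad v T) s)\<^sup>2"] T
          unfolding G_def by blast
        have xi: "x \<in> interior T" using elim T by blast
        have "eventually (\<lambda>k. x + (1 / 2 ^ k) *\<^sub>R s \<in> interior T) sequentially"
          using topological_tendstoD[OF tend open_interior xi] .
        then show ?thesis
        proof eventually_elim
          case (elim k)
          then have "x + (1 / 2 ^ k) *\<^sub>R s \<in> T" using interior_subset by blast
          from fe_diff[OF v T(1) this T(2)] show ?case by (simp add: F_def GT)
        qed
      next
        case False
        have "x \<notin> T" if "T \<in> \<T>" for T using cell_subset[OF that] False by blast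
        then have G0: "G x = 0" by (simp add: G_def)
        have "eventually (\<lambda>k. x + (1 / 2 ^ k) *\<^sub>R s \<in> - closure \<Omega>) sequentially"
          by (rule topological_tendstoD[OF tend]) (use False in auto)
        then show ?thesis
        proof eventually_elim
          case (elim k)
          then have "v (x + (1 / 2 ^ k) *\<^sub>R s) = 0" "v x = 0"
            using False closure_subset[of \<Omega>] fe_zero[OF v] by blast+
          then show ?case by (simp add: F_def G0)
        qed
      qed
      then show ?case by (rule tendsto_eventually)
    qed
    show "AE x in lborel. norm (F k x) \<le> indicator (cball 0 (R + norm s)) x * (L * norm s)\<^sup>2" for k
    proof (intro AE_I2)
      fix x
      have n: "norm ((1 / 2 ^ k) *\<^sub>R s) \<le> norm s"
        using mult_right_mono[of "1 / 2 ^ k" 1 "norm s"] by simp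
      show "norm (F k x) \<le> indicator (cball 0 (R + norm s)) x * (L * norm s)\<^sup>2"
      proof (cases "norm x \<le> R + norm s")
        case True
        have "2 ^ k * \<bar>v (x + (1 / 2 ^ k) *\<^sub>R s) - v x\<bar> \<le> L * norm s"
          using L(2)[of "x + (1 / 2 ^ k) *\<^sub>R s" x] by (simp add: field_simps)
        then have "\<bar>2 ^ k * (v (x + (1 / 2 ^ k) *\<^sub>R s) - v x)\<bar> \<le> L * norm s"
          by (simp only: abs_mult power_abs abs_numeral)
        then have "\<bar>2 ^ k * (v (x + (1 / 2 ^ k) *\<^sub>R s) - v x)\<bar>\<^sup>2 \<le> (L * norm s)\<^sup>2"
          by (rule power_mono) simp
        then show ?thesis using True by (simp add: F_def)
      next
        case False
        have "norm x \<le> norm (x + (1 / 2 ^ k) *\<^sub>R s) + norm ((1 / 2 ^ k) *\<^sub>R s)"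
          using norm_triangle_ineq4[of "x + (1 / 2 ^ k) *\<^sub>R s" "(1 / 2 ^ k) *\<^sub>R s"] by simp
        then have "R \<le> norm (x + (1 / 2 ^ k) *\<^sub>R s)" using n False by linarith
        moreover have "R \<le> norm x" using False norm_ge_zero[of s] by linarith
        ultimately show ?thesis using R by (simp add: F_def)
      qed
    qed
  qed (use Fm Gm in auto)
  have "transl v v s \<le> (LINT x|lborel. F k x)" for k
    unfolding Fe by (rule transl_divide[OF bv])
  then have "transl v v s \<le> (LINT x|lborel. G x)"
    by (intro LIMSEQ_le_const[OF lim]) auto
  also have "\<dots> = (\<Sum>T\<in>\<T>. (LINT x|lborel. indicator T x * (inner (cell_grad v T) s)\<^sup>2))"
    unfolding G_def by (intro Bochner_Integration.integral_sum cell_indicator_integrable)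
  also have "\<dots> \<le> (\<Sum>T\<in>\<T>. measure lborel T * ((norm (cell_grad v T))\<^sup>2 * (norm s)\<^sup>2))"
  proof (rule sum_mono)
    fix T
    have "\<bar>inner (cell_grad v T) s\<bar>\<^sup>2 \<le> (norm (cell_grad v T) * norm s)\<^sup>2"
      by (intro power_mono Cauchy_Schwarz_ineq2) simp
    then show "(LINT x|lborel. indicator T x * (inner (cell_grad v T) s)\<^sup>2)
        \<le> measure lborel T * ((norm (cell_grad v T))\<^sup>2 * (norm s)\<^sup>2)"
      by (simp add: power_mult_distrib mult_left_mono)
  qed
  also have "\<dots> = (norm s)\<^sup>2 * energy v"
    by (simp add: energy_def sum_distrib_left mult_ac)
  finally show ?thesis .
qed

text \<open>If all slopes vanish, \<open>fe_lipschitz_sum\<close> makes \<open>v\<close> constant on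
  the whole space, and it is zero outside the bounded set \<Omega>. This yields positive
  definiteness of the local stiffness matrix.\<close>

lemma energy_zero_imp_zero:
  assumes v: "v \<in> V" and 0: "energy v \<le> 0"
  shows "v x = 0"
proof -
  have "cell_grad v T = 0" if T: "T \<in> \<T>" for T
  proof -
    have "measure lborel T * (norm (cell_grad v T))\<^sup>2 \<le> energy v"
      unfolding energy_def using T finite_mesh by (intro member_le_sum) auto
    then have "measure lborel T * (norm (cell_grad v T))\<^sup>2 \<le> 0" using 0 by linarith
    then show ?thesis using cell_measure_pos[OF T] by (simp add: mult_le_0_iff)
  qed
  then have "\<bar>v x - v y\<bar> \<le> 0" for y using fe_lipschitz_sum[OF v, of x y] by simp
  moreover obtain y where "y \<notin> \<Omega>" using bounded_dom not_bounded_UNIV by (metis UNIV_I subsetI top.extremum_uniqueI)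
  ultimately show ?thesis using fe_zero[OF v, of y] by (metis abs_le_zero_iff diff_zero)
qed

text \<open>For affine \<open>v\<close> one has \<open>v p = 2 v((p + x)/2) - v x\<close>; the bound follows by integrating over \<open>x \<in> T\<close>.\<close>

lemma vertex_value_le:
  assumes v: "v \<in> V" and T: "T \<in> \<T>" and p: "p \<in> T"
  shows "measure lborel T * (v p)\<^sup>2 \<le> (8 * 2 ^ DIM('a) + 2) * (LINT x|lborel. indicator T x * (v x)\<^sup>2)"
proof -
  note bv = fe_bbb[OF v]
  define F where "F x = indicator T x * (v x)\<^sup>2" for x
  have bF: "bbb F" unfolding F_def power2_eq_square by (intro indicator_bbb_mult bbb_mult bv cell_closed T)
  have m: "(1 / 2) *\<^sub>R p + (1 / 2) *\<^sub>R x \<in> T" if "x \<in> T" for x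
    using convexD[OF cell_convex[OF T] p that, of "1/2" "1/2"] by simp
  have le: "indicator T x * (v p)\<^sup>2 \<le> 8 * F ((1 / 2) *\<^sub>R p + (1 / 2) *\<^sub>R x) + 2 * F x" for x
  proof (cases "x \<in> T")
    case True
    have "v p - v ((1 / 2) *\<^sub>R p + (1 / 2) *\<^sub>R x) = v ((1 / 2) *\<^sub>R p + (1 / 2) *\<^sub>R x) - v x"
    proof -
      have "p - ((1 / 2) *\<^sub>R p + (1 / 2) *\<^sub>R x) = ((1 / 2) *\<^sub>R p + (1 / 2) *\<^sub>R x) - x"
        by (rule euclidean_eqI) (simp add: inner_diff_left inner_add_left)
      then show ?thesis using fe_diff[OF v T p m[OF True]] fe_diff[OF v T m[OF True] True] by simp
    qed
    then have e: "v p = 2 * v ((1 / 2) *\<^sub>R p + (1 / 2) *\<^sub>R x) - v x" by simp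
    \<comment> \<open>Origin of the constant: the 8 gets multiplied by the Jacobian
      \<open>2 ^ DIM('a)\<close> of the homothety with centre \<open>p\<close> and ratio 1/2, while
      the 2 belongs to the value at \<open>x\<close> itself.\<close>
    have "(2 * a - b)\<^sup>2 \<le> 8 * a\<^sup>2 + 2 * b\<^sup>2" for a b :: real
      using zero_le_power2[of "2 * a + b"] by (simp add: power2_eq_square algebra_simps)
    then show ?thesis unfolding e using True m[OF True] by (simp add: F_def)
  next
    case False
    then show ?thesis by (simp add: F_def)
  qed
  have iF: "integrable lborel F" by (rule bbb_integrable[OF bF])
  have sc: "(LINT x|lborel. F x) = (1 / 2) ^ DIM('a) * (LINT x|lborel. F ((1 / 2) *\<^sub>R p + (1 / 2) *\<^sub>R x))"
    by (rule lborel_integral_homothety[OF bbb_measurable[OF bF]]) simp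
  have iF2: "integrable lborel (\<lambda>x. F ((1 / 2) *\<^sub>R p + (1 / 2) *\<^sub>R x))"
  proof -
    obtain M R where MR: "\<And>x. \<bar>F x\<bar> \<le> M" "\<And>x. R \<le> norm x \<Longrightarrow> F x = 0" using bF unfolding bbb_def by blast
    have "R \<le> norm ((1 / 2) *\<^sub>R p + (1 / 2) *\<^sub>R x)" if "2 * R + norm p \<le> norm x" for x
      using that norm_triangle_ineq4[of "(1 / 2) *\<^sub>R p + (1 / 2) *\<^sub>R x" "(1 / 2) *\<^sub>R p"] by simp
    then show ?thesis using MR bbb_measurable[OF bF]
      by (intro lborel_integrable_bounded[of _ M "2 * R + norm p"]) auto
  qed
  have "measure lborel T * (v p)\<^sup>2 = (LINT x|lborel. indicator T x * (v p)\<^sup>2)" by simp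
  also have "\<dots> \<le> (LINT x|lborel. 8 * F ((1 / 2) *\<^sub>R p + (1 / 2) *\<^sub>R x) + 2 * F x)"
    by (rule integral_mono[OF cell_indicator_integrable[OF T]]) (use iF iF2 le in auto)
  also have "\<dots> = 8 * (LINT x|lborel. F ((1 / 2) *\<^sub>R p + (1 / 2) *\<^sub>R x)) + 2 * (LINT x|lborel. F x)"
    using iF iF2 by simp
  also have "(LINT x|lborel. F ((1 / 2) *\<^sub>R p + (1 / 2) *\<^sub>R x)) = 2 ^ DIM('a) * (LINT x|lborel. F x)"
    unfolding sc by (simp add: power_one_over)
  finally show ?thesis by (simp add: F_def algebra_simps)
qed

end

section \<open>Nodal basis and mass lumping\<close>

locale fe_nodes = fe_mesh +
  fixes N :: nat and p :: "nat \<Rightarrow> 'a" and \<phi> :: "nat \<Rightarrow> 'a \<Rightarrow> real"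
  assumes nodal: "nodal_basis \<Omega> \<T> N p \<phi>"
begin

definition comb :: "(nat \<Rightarrow> real) \<Rightarrow> 'a \<Rightarrow> real" where
  "comb X x = (\<Sum>i<N. X i * \<phi> i x)"

lemma basis_fe: "i < N \<Longrightarrow> \<phi> i \<in> V"
  and basis_node: "i < N \<Longrightarrow> j < N \<Longrightarrow> \<phi> i (p j) = (if i = j then 1 else 0)"
  using nodal by (auto simp: nodal_basis_def)

lemma comb_cell:
  assumes T: "T \<in> \<T>"
  shows "\<exists>b. \<forall>x\<in>T. comb X x = inner (\<Sum>i<N. X i *\<^sub>R cell_grad (\<phi> i) T) x + b"
proof -
  have "\<forall>i<N. \<exists>b. \<forall>x\<in>T. \<phi> i x = inner (cell_grad (\<phi> i) T) x + b"
    using fe_affine[OF basis_fe T] by metis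
  then obtain b where b: "\<And>i x. i < N \<Longrightarrow> x \<in> T \<Longrightarrow> \<phi> i x = inner (cell_grad (\<phi> i) T) x + b i" by metis
  have "comb X x = inner (\<Sum>i<N. X i *\<^sub>R cell_grad (\<phi> i) T) x + (\<Sum>i<N. X i * b i)" if "x \<in> T" for x
    using b[OF _ that] by (simp add: comb_def inner_sum_left distrib_left sum.distrib)
  then show ?thesis by blast
qed

lemma comb_fe: "comb X \<in> V"
  unfolding fe_space_def
proof (intro CollectI conjI ballI allI impI)
  show "continuous_on (closure \<Omega>) (comb X)" unfolding comb_def
    by (intro continuous_intros continuous_on_subset[OF fe_continuous[OF basis_fe]]) auto
  show "\<exists>a b. \<forall>x\<in>T. comb X x = inner a x + b" if "T \<in> \<T>" for T using comb_cell[OF that] by blast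
  show "comb X x = 0" if "x \<in> frontier \<Omega>" for x
    using that fe_zero[OF basis_fe] by (simp add: comb_def frontier_dom)
  show "comb X x = 0" if "x \<notin> closure \<Omega>" for x
  proof -
    have "x \<notin> \<Omega>" using that closure_subset by blast
    then show ?thesis using fe_zero[OF basis_fe] by (simp add: comb_def)
  qed
qed

lemma comb_grad: "T \<in> \<T> \<Longrightarrow> cell_grad (comb X) T = (\<Sum>i<N. X i *\<^sub>R cell_grad (\<phi> i) T)"
  using comb_cell[of T X] cell_grad_eqI by blast

lemma comb_node: "j < N \<Longrightarrow> comb X (p j) = X j"
  by (simp add: comb_def basis_node if_distrib[of "\<lambda>y. X _ * y"] sum.delta cong: if_cong)

lemma node_vertex:
  assumes "i < N"
  shows "p i \<in> \<Omega>" "\<exists>T\<in>\<T>. p i \<in> verts T"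
proof -
  have "p i \<in> interior_nodes \<Omega> \<T>" using nodal assms by (auto simp: nodal_basis_def bij_betw_def)
  then show "p i \<in> \<Omega>" "\<exists>T\<in>\<T>. p i \<in> verts T" by (auto simp: interior_nodes_def verts_def)
qed

lemma vertex_node:
  assumes "T \<in> \<T>" "q \<in> verts T" "q \<in> \<Omega>"
  shows "\<exists>j<N. q = p j"
proof -
  have "q \<in> interior_nodes \<Omega> \<T>" using assms by (auto simp: interior_nodes_def verts_def)
  then show ?thesis using nodal by (auto simp: nodal_basis_def bij_betw_def)
qed

lemma fe_convex_combination:
  assumes v: "v \<in> V" and T: "T \<in> \<T>" and b: "sum b (verts T) = 1" "(\<Sum>q\<in>verts T. b q *\<^sub>R q) = x" and x: "x \<in> T"
  shows "v x = (\<Sum>q\<in>verts T. b q * v q)"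
proof -
  obtain c where c: "\<And>y. y \<in> T \<Longrightarrow> v y = inner (cell_grad v T) y + c" using fe_affine[OF v T] by blast
  have "inner (cell_grad v T) x = (\<Sum>q\<in>verts T. b q * inner (cell_grad v T) q)"
    by (simp add: b(2)[symmetric] inner_sum_right)
  then have "v x = (\<Sum>q\<in>verts T. b q * inner (cell_grad v T) q) + c" by (simp add: c[OF x])
  also have "c = (\<Sum>q\<in>verts T. b q * c)" by (simp add: sum_distrib_right[symmetric] b(1))
  also have "(\<Sum>q\<in>verts T. b q * inner (cell_grad v T) q) + (\<Sum>q\<in>verts T. b q * c) = (\<Sum>q\<in>verts T. b q * v q)"
    using c verts_subset[of T] by (auto simp: sum.distrib[symmetric] distrib_left[symmetric] intro!: sum.cong)
  finally show ?thesis .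
qed

text \<open>The nodal interpolant of the square of \<open>comb X\<close>; its integral is the lumped mass form.\<close>

definition lump :: "(nat \<Rightarrow> real) \<Rightarrow> 'a \<Rightarrow> real" where
  "lump X = comb (\<lambda>i. (X i)\<^sup>2)"

lemma lump_vertex:
  assumes "T \<in> \<T>" "q \<in> verts T"
  shows "lump X q = (comb X q)\<^sup>2"
proof (cases "q \<in> \<Omega>")
  case True
  then show ?thesis using vertex_node[OF assms True] by (auto simp: lump_def comb_node)
next
  case False
  then show ?thesis using fe_zero[OF comb_fe] by (simp add: lump_def)
qed

text \<open>Jensen's inequality for barycentric weights, in the form that a variance is
  nonnegative.\<close>

lemma comb_square_le_lump: "(comb X x)\<^sup>2 \<le> lump X x"
proof (cases "x \<in> closure \<Omega>")
  case True
  then obtain T where T: "T \<in> \<T>" "x \<in> T" using cover by blast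
  obtain b where b: "\<forall>q\<in>verts T. 0 \<le> b q" "sum b (verts T) = 1" "(\<Sum>q\<in>verts T. b q *\<^sub>R q) = x"
    using cell_convex_combination[OF T] by blast
  define w where "w = comb X x"
  have w: "w = (\<Sum>q\<in>verts T. b q * comb X q)"
    unfolding w_def by (rule fe_convex_combination[OF comb_fe T(1) b(2,3) T(2)])
  have "0 \<le> (\<Sum>q\<in>verts T. b q * (comb X q - w)\<^sup>2)" using b(1) by (intro sum_nonneg) auto
  also have "\<dots> = (\<Sum>q\<in>verts T. b q * (comb X q)\<^sup>2 - 2 * w * (b q * comb X q) + w\<^sup>2 * b q)"
    by (simp add: power2_diff algebra_simps)
  also have "\<dots> = (\<Sum>q\<in>verts T. b q * (comb X q)\<^sup>2) - 2 * w * (\<Sum>q\<in>verts T. b q * comb X q) + w\<^sup>2 * sum b (verts T)"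
    by (simp only: sum.distrib sum_subtractf sum_distrib_left)
  also have "\<dots> = (\<Sum>q\<in>verts T. b q * (comb X q)\<^sup>2) - w\<^sup>2"
    by (simp add: w[symmetric] b(2) power2_eq_square)
  also have "(\<Sum>q\<in>verts T. b q * (comb X q)\<^sup>2) = (\<Sum>q\<in>verts T. b q * lump X q)"
    by (intro sum.cong) (auto simp: lump_vertex[OF T(1)])
  also have "\<dots> = lump X x"
    unfolding lump_def by (rule fe_convex_combination[OF comb_fe T(1) b(2,3) T(2), symmetric])
  finally show ?thesis by (simp add: w_def)
next
  case False
  then have "x \<notin> \<Omega>" using closure_subset by blast
  then show ?thesis using fe_zero[OF comb_fe] by (simp add: lump_def)
qed

lemma lump_le_vertices:
  assumes T: "T \<in> \<T>" "x \<in> T"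
  shows "lump X x \<le> (\<Sum>q\<in>verts T. (comb X q)\<^sup>2)"
proof -
  obtain b where b: "\<forall>q\<in>verts T. 0 \<le> b q" "sum b (verts T) = 1" "(\<Sum>q\<in>verts T. b q *\<^sub>R q) = x"
    using cell_convex_combination[OF T] by blast
  have "b q \<le> 1" if "q \<in> verts T" for q
    using member_le_sum[OF that, of b] b cell_verts(1)[OF T(1)] by auto
  then have "(\<Sum>q\<in>verts T. b q * lump X q) \<le> (\<Sum>q\<in>verts T. (comb X q)\<^sup>2)"
    using lump_vertex[OF T(1)] by (intro sum_mono) (auto intro: mult_left_le_one_le simp: b(1))
  then show ?thesis
    unfolding lump_def using fe_convex_combination[OF comb_fe T(1) b(2,3) T(2)] by simp
qed

text \<open>Cell by cell, the lumped function is at most the sum of \<open>d + 1\<close> squared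
  vertex values, each controlled by \<open>vertex_value_le\<close>. That bound uses only that the
  cell is convex and the function affine, so the constant depends on the dimension alone.\<close>

lemma integral_lump_upper:
  "(LINT x|lborel. lump X x)
    \<le> (real DIM('a) + 1) * (8 * 2 ^ DIM('a) + 2) * (LINT x|lborel. (comb X x)\<^sup>2)"
proof -
  define C where "C = (8 * 2 ^ DIM('a) + 2 :: real)"
  note bl = fe_bbb[OF comb_fe, of "\<lambda>i. (X i)\<^sup>2", folded lump_def]
  have bw: "bbb (\<lambda>x. (comb X x)\<^sup>2)" unfolding power2_eq_square by (intro bbb_mult fe_bbb comb_fe)
  have "(LINT x|lborel. lump X x) = (\<Sum>T\<in>\<T>. (LINT x|lborel. indicator T x * lump X x))"
    using fe_zero[OF comb_fe] closure_subset[of \<Omega>]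
    by (intro integral_cells bbb_integrable bl) (auto simp: lump_def)
  also have "\<dots> \<le> (\<Sum>T\<in>\<T>. (real DIM('a) + 1) * (C * (LINT x|lborel. indicator T x * (comb X x)\<^sup>2)))"
  proof (rule sum_mono)
    fix T assume T: "T \<in> \<T>"
    have "(LINT x|lborel. indicator T x * lump X x) \<le> (LINT x|lborel. indicator T x * (\<Sum>q\<in>verts T. (comb X q)\<^sup>2))"
      using lump_le_vertices[OF T, of _ X]
      by (intro integral_mono bbb_integrable indicator_bbb_mult bl cell_closed[OF T] cell_indicator_integrable[OF T])
        (auto simp: indicator_def)
    also have "\<dots> = measure lborel T * (\<Sum>q\<in>verts T. (comb X q)\<^sup>2)" by simp
    also have "\<dots> = (\<Sum>q\<in>verts T. measure lborel T * (comb X q)\<^sup>2)" by (simp only: sum_distrib_left)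
    also have "\<dots> \<le> (\<Sum>q\<in>verts T. C * (LINT x|lborel. indicator T x * (comb X x)\<^sup>2))"
      unfolding C_def using verts_subset[of T] by (intro sum_mono vertex_value_le comb_fe T) auto
    also have "\<dots> = (real DIM('a) + 1) * (C * (LINT x|lborel. indicator T x * (comb X x)\<^sup>2))"
      by (simp add: cell_verts(2)[OF T] algebra_simps)
    finally show "(LINT x|lborel. indicator T x * lump X x) \<le> (real DIM('a) + 1) * (C * (LINT x|lborel. indicator T x * (comb X x)\<^sup>2))" .
  qed
  also have "\<dots> = (real DIM('a) + 1) * C * (\<Sum>T\<in>\<T>. (LINT x|lborel. indicator T x * (comb X x)\<^sup>2))"
    by (simp add: sum_distrib_left mult.assoc)
  also have "(\<Sum>T\<in>\<T>. (LINT x|lborel. indicator T x * (comb X x)\<^sup>2)) = (LINT x|lborel. (comb X x)\<^sup>2)"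
    using fe_zero[OF comb_fe, of _ X] closure_subset[of \<Omega>]
    by (intro integral_cells[symmetric] bbb_integrable bw) auto
  finally show ?thesis by (simp add: C_def)
qed

text \<open>For a unit coefficient vector both \<open>comb\<close> and \<open>lump\<close> give
  \<open>\<phi> i\<close>, so \<open>\<phi> i\<close> dominates its own square, and the integral of
  the square is positive because the value at the vertex \<open>p i\<close> is 1. This makes the
  lumped mass matrix positive definite.\<close>

lemma integral_basis_pos:
  assumes i: "i < N"
  shows "0 < (LINT x|lborel. \<phi> i x)"
proof -
  define X where "X j = (if j = i then 1 else 0 :: real)" for j
  have c: "comb X = \<phi> i" by (rule ext) (simp add: comb_def X_def if_distrib[of "\<lambda>y. y * _"] i sum.delta cong: if_cong)
  have l: "lump X = \<phi> i" unfolding lump_def c[symmetric] by (rule arg_cong[of _ _ comb]) (auto simp: X_def)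
  obtain T where T: "T \<in> \<T>" "p i \<in> verts T" using node_vertex[OF i] by blast
  have bw: "bbb (\<lambda>x. (\<phi> i x)\<^sup>2)" unfolding power2_eq_square by (intro bbb_mult fe_bbb basis_fe i)
  have "0 < measure lborel T * (\<phi> i (p i))\<^sup>2" using cell_measure_pos[OF T(1)] basis_node[OF i i] by simp
  also have "\<dots> \<le> (8 * 2 ^ DIM('a) + 2) * (LINT x|lborel. indicator T x * (\<phi> i x)\<^sup>2)"
    using T verts_subset by (intro vertex_value_le basis_fe i) auto
  finally have "0 < (LINT x|lborel. indicator T x * (\<phi> i x)\<^sup>2)"
    by (rule zero_less_mult_pos) (intro add_pos_pos mult_pos_pos zero_less_power; simp)
  also have "\<dots> \<le> (LINT x|lborel. (\<phi> i x)\<^sup>2)"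
    using bw cell_closed[OF T(1)] by (intro integral_mono bbb_integrable indicator_bbb_mult) (auto simp: indicator_def)
  also have "\<dots> \<le> (LINT x|lborel. \<phi> i x)"
    using comb_square_le_lump[of X] unfolding c l by (intro integral_mono bbb_integrable bw fe_bbb basis_fe i)
  finally show ?thesis .
qed

end

section \<open>The averaged kernel\<close>

lemma bbb_dilate:
  assumes k: "bbb k" and c: "0 < c"
  shows "bbb (\<lambda>s. k (s /\<^sub>R c))"
proof -
  obtain M R where MR: "\<And>x. \<bar>k x\<bar> \<le> M" "\<And>x. R \<le> norm x \<Longrightarrow> k x = 0" using k unfolding bbb_def by blast
  have "c * R \<le> norm x \<longrightarrow> k (x /\<^sub>R c) = 0" for x
    using MR(2)[of "x /\<^sub>R c"] c by (simp add: field_simps)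
  moreover have "(\<lambda>s. k (s /\<^sub>R c)) \<in> borel_measurable borel" using bbb_measurable[OF k] by measurable
  ultimately show ?thesis using MR(1) unfolding bbb_def by blast
qed

locale averaged_kernel_setup =
  fixes M\<^sub>\<rho> \<rho>\<^sub>0 r\<^sub>0 :: real and \<rho> :: "'a::euclidean_space \<Rightarrow> real" and P :: "'a set" and \<Z> :: "'a set set"
  assumes \<rho>0: "0 < \<rho>\<^sub>0" and r0: "0 < r\<^sub>0" "r\<^sub>0 \<le> 1"
    and kernel: "admissible_kernel M\<^sub>\<rho> \<rho>\<^sub>0 r\<^sub>0 \<rho>"
    and poly: "admissible_polytope P" and part: "admissible_partition r\<^sub>0 P \<Z>"
begin

definition cell_avg :: "'a set \<Rightarrow> real" where
  "cell_avg Z = 1 / measure lebesgue Z * (LINT w:Z \<inter> ball 0 1|lebesgue. \<rho> w)"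

lemma averaged_eq: "averaged_kernel \<Z> \<rho> z = (\<Sum>Z\<in>\<Z>. indicator (interior Z) z * cell_avg Z)"
  by (simp add: averaged_kernel_def cell_avg_def)

lemma finite_cells: "finite \<Z>" and cell_polytope: "Z \<in> \<Z> \<Longrightarrow> polytope Z" and cell_measure: "Z \<in> \<Z> \<Longrightarrow> 0 < measure lebesgue Z"
  and cells_cover: "\<Union>\<Z> = P" and cells_overlap: "Z \<in> \<Z> \<Longrightarrow> Z' \<in> \<Z> \<Longrightarrow> Z \<noteq> Z' \<Longrightarrow> negligible (Z \<inter> Z')"
  and mesh_size_le: "mesh_size \<Z> \<le> r\<^sub>0 / 2"
  using part by (simp_all add: admissible_partition_def)

lemma cell_is_closed: "Z \<in> \<Z> \<Longrightarrow> closed Z" and cell_is_bounded: "Z \<in> \<Z> \<Longrightarrow> bounded Z" and cell_is_convex: "Z \<in> \<Z> \<Longrightarrow> convex Z"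
  using cell_polytope polytope_imp_closed polytope_imp_bounded polytope_imp_convex by blast+

lemma \<rho>_int: "integrable lebesgue (\<lambda>w. indicator (ball 0 1) w * \<rho> w)"
  using kernel by (simp add: admissible_kernel_def set_integrable_def)

lemma \<rho>_int_cell:
  assumes "Z \<in> \<Z>"
  shows "integrable lebesgue (\<lambda>w. indicator (Z \<inter> ball 0 1) w * \<rho> w)"
proof -
  have "integrable lebesgue (\<lambda>w. indicator Z w *\<^sub>R (indicator (ball 0 1) w * \<rho> w))"
    by (rule integrable_mult_indicator[OF _ \<rho>_int]) (use cell_is_closed[OF assms] in auto)
  then show ?thesis by (simp add: indicator_inter_arith mult.assoc)
qed

lemma \<rho>_nonneg: "AE w in lebesgue. 0 \<le> indicator (ball 0 1) w * \<rho> w"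
proof -
  have "AE z in lebesgue. z \<in> ball 0 1 \<longrightarrow> \<rho> z = \<rho> (- z) \<and> 0 \<le> \<rho> z" using kernel by (simp add: admissible_kernel_def)
  then show ?thesis by eventually_elim (auto simp: indicator_def)
qed

lemma cell_avg_mult: "Z \<in> \<Z> \<Longrightarrow> measure lebesgue Z * cell_avg Z = (LINT w|lebesgue. indicator (Z \<inter> ball 0 1) w * \<rho> w)"
  using cell_measure[of Z] by (simp add: cell_avg_def set_lebesgue_integral_def)

lemma cell_avg_nonneg: "0 \<le> cell_avg Z"
proof -
  have "0 \<le> (LINT w|lebesgue. indicator (Z \<inter> ball 0 1) w * \<rho> w)"
  proof (rule integral_nonneg_AE)
    show "AE w in lebesgue. 0 \<le> indicator (Z \<inter> ball 0 1) w * \<rho> w"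
      using \<rho>_nonneg by eventually_elim (auto simp: indicator_def split: if_splits)
  qed
  then show ?thesis by (simp add: cell_avg_def set_lebesgue_integral_def)
qed

lemma averaged_nonneg: "0 \<le> averaged_kernel \<Z> \<rho> z"
  unfolding averaged_eq by (intro sum_nonneg mult_nonneg_nonneg cell_avg_nonneg) auto

lemma interior_bbb: "Z \<in> \<Z> \<Longrightarrow> bbb (\<lambda>z. indicator (interior Z) z * cell_avg Z)"
  using bbb_scale[OF bbb_indicator[of "interior Z"], of "cell_avg Z"] bounded_subset[OF cell_is_bounded interior_subset]
  by (simp add: mult.commute borel_open)

lemma averaged_bbb: "bbb (averaged_kernel \<Z> \<rho>)"
  unfolding averaged_eq[abs_def] by (intro bbb_sum interior_bbb)

lemma averaged_zero:
  assumes "1 < norm z"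
  shows "averaged_kernel \<Z> \<rho> z = 0"
proof -
  have "z \<notin> interior Z" if "Z \<in> \<Z>" for Z
  proof
    assume "z \<in> interior Z"
    then have "z \<in> P" using cells_cover that interior_subset by blast
    then have "z \<in> cball 0 1" using poly by (auto simp: admissible_polytope_def)
    then show False using assms by simp
  qed
  then show ?thesis by (simp add: averaged_eq)
qed

text \<open>Averaging preserves the mass of \<rho> in each cell, and the cells overlap in null sets
  only. Equality may fail since \<open>P\<close> can be smaller than the unit ball.\<close>

lemma averaged_integral_le: "(LINT z|lborel. averaged_kernel \<Z> \<rho> z) \<le> kernel_mass \<rho>"
proof -
  have "(LINT z|lborel. averaged_kernel \<Z> \<rho> z) = (\<Sum>Z\<in>\<Z>. (LINT z|lborel. indicator (interior Z) z * cell_avg Z))"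
    unfolding averaged_eq by (intro Bochner_Integration.integral_sum bbb_integrable interior_bbb)
  also have "\<dots> \<le> (\<Sum>Z\<in>\<Z>. (LINT w|lebesgue. indicator (Z \<inter> ball 0 1) w * \<rho> w))"
  proof (rule sum_mono)
    fix Z assume Z: "Z \<in> \<Z>"
    have "measure lborel (interior Z) = measure lebesgue (interior Z)" by simp
    also have "\<dots> \<le> measure lebesgue Z"
      using cell_is_closed[OF Z] cell_is_bounded[OF Z] interior_subset
      by (intro measure_mono_fmeasurable lmeasurable_compact) (auto simp: compact_eq_bounded_closed)
    finally have "measure lborel (interior Z) * cell_avg Z \<le> measure lebesgue Z * cell_avg Z"
      by (intro mult_right_mono cell_avg_nonneg)
    then show "(LINT z|lborel. indicator (interior Z) z * cell_avg Z) \<le> (LINT w|lebesgue. indicator (Z \<inter> ball 0 1) w * \<rho> w)"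
      by (simp add: cell_avg_mult[OF Z])
  qed
  also have "\<dots> = (LINT w|lebesgue. (\<Sum>Z\<in>\<Z>. indicator (Z \<inter> ball 0 1) w * \<rho> w))"
    by (intro Bochner_Integration.integral_sum[symmetric] \<rho>_int_cell)
  also have "\<dots> \<le> (LINT w|lebesgue. indicator (ball 0 1) w * \<rho> w)"
  proof (rule integral_mono_AE)
    show "integrable lebesgue (\<lambda>w. \<Sum>Z\<in>\<Z>. indicator (Z \<inter> ball 0 1) w * \<rho> w)"
      by (intro Bochner_Integration.integrable_sum \<rho>_int_cell)
    define N where "N = (\<Union>Z\<in>\<Z>. \<Union>Z'\<in>\<Z> - {Z}. Z \<inter> Z')"
    have "negligible (\<Union>Z'\<in>\<Z> - {Z}. Z \<inter> Z')" if "Z \<in> \<Z>" for Z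
      by (rule negligible_Union) (use that finite_cells cells_overlap in blast)+
    then have "negligible N" unfolding N_def by (intro negligible_Union) (use finite_cells in blast)+
    then have "N \<in> null_sets lebesgue" by (simp add: negligible_iff_null_sets)
    then have "AE w in lebesgue. w \<notin> N" by (rule AE_not_in)
    then show "AE w in lebesgue. (\<Sum>Z\<in>\<Z>. indicator (Z \<inter> ball 0 1) w * \<rho> w) \<le> indicator (ball 0 1) w * \<rho> w"
      using \<rho>_nonneg
    proof eventually_elim
      case (elim w)
      show ?case
      proof (cases "\<exists>Z\<in>\<Z>. w \<in> Z")
        case True
        then obtain Z where Z: "Z \<in> \<Z>" "w \<in> Z" by blast
        have "w \<notin> Z'" if "Z' \<in> \<Z>" "Z' \<noteq> Z" for Z' using elim(1) Z that unfolding N_def by blast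
        then have "(\<Sum>Z'\<in>\<Z>. indicator (Z' \<inter> ball 0 1) w * \<rho> w)
            = (\<Sum>Z'\<in>\<Z>. if Z' = Z then indicator (ball 0 1) w * \<rho> w else 0)"
          using Z by (intro sum.cong) (auto simp: indicator_def)
        also have "\<dots> = indicator (ball 0 1) w * \<rho> w" using Z finite_cells by simp
        finally show ?thesis by (rule eq_refl)
      next
        case False
        then have "(\<Sum>Z'\<in>\<Z>. indicator (Z' \<inter> ball 0 1) w * \<rho> w) = 0"
          by (intro sum.neutral) auto
        then show ?thesis using elim(2) by simp
      qed
    qed
  qed (rule \<rho>_int)
  also have "\<dots> = kernel_mass \<rho>" by (simp add: kernel_mass_def set_lebesgue_integral_def)
  finally show ?thesis .
qed

text \<open>A cell that meets the ball of radius \<open>r\<^sub>0 / 2\<close> has diameter at most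
  \<open>r\<^sub>0 / 2\<close>, so it stays within the ball of radius \<open>r\<^sub>0\<close>,
  where \<rho> is bounded below; its average inherits the bound. Such a cell exists because
  \<open>P\<close> contains the ball of radius 1/2. The bound is asserted off the cell frontiers,
  where the averaged kernel was set to 0.\<close>

lemma averaged_lower: "AE z in lborel. z \<in> ball 0 (r\<^sub>0 / 2) \<longrightarrow> \<rho>\<^sub>0 \<le> averaged_kernel \<Z> \<rho> z"
proof -
  have "negligible (\<Union>Z\<in>\<Z>. frontier Z)"
    using finite_cells negligible_convex_frontier cell_is_convex by (intro negligible_Union) auto
  moreover have "closed (\<Union>Z\<in>\<Z>. frontier Z)"
    using finite_cells by (intro closed_UN) auto
  ultimately have "(\<Union>Z\<in>\<Z>. frontier Z) \<in> null_sets lborel"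
    by (simp add: negligible_iff_null_sets null_sets_completion_iff borel_closed)
  then have "AE z in lborel. z \<notin> (\<Union>Z\<in>\<Z>. frontier Z)" by (rule AE_not_in)
  then show ?thesis
  proof eventually_elim
    case (elim z)
    show ?case
    proof
      assume z: "z \<in> ball 0 (r\<^sub>0 / 2)"
      then have "z \<in> ball 0 (1/2)" using r0 by simp
      then have "z \<in> P" using poly unfolding admissible_polytope_def by blast
      then obtain Z where Z: "Z \<in> \<Z>" "z \<in> Z" using cells_cover by blast
      have zi: "z \<in> interior Z"
        using elim Z cell_is_closed[OF Z(1)] by (auto simp: frontier_def)
      have sub: "Z \<subseteq> ball 0 r\<^sub>0"
      proof
        fix w assume "w \<in> Z"
        then have "dist w z \<le> diameter Z" using diameter_bounded_bound[OF cell_is_bounded[OF Z(1)]] Z(2) by blast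
        also have "\<dots> \<le> mesh_size \<Z>" unfolding mesh_size_def using finite_cells Z(1) by (intro Max_ge) auto
        also have "\<dots> \<le> r\<^sub>0 / 2" by (rule mesh_size_le)
        finally have "dist w z \<le> r\<^sub>0 / 2" .
        then show "w \<in> ball 0 r\<^sub>0" using z dist_triangle[of 0 w z] by (simp add: dist_commute)
      qed
      have "(LINT w|lebesgue. indicator Z w * \<rho>\<^sub>0) \<le> (LINT w|lebesgue. indicator (Z \<inter> ball 0 1) w * \<rho> w)"
      proof (rule integral_mono_AE[OF _ \<rho>_int_cell[OF Z(1)]])
        show "integrable lebesgue (\<lambda>w. indicator Z w * \<rho>\<^sub>0)"
          using cell_is_closed[OF Z(1)] emeasure_bounded_finite[OF cell_is_bounded[OF Z(1)]]
          by (intro integrable_mult_left integrable_real_indicator) auto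
        have "AE w in lebesgue. w \<in> ball 0 r\<^sub>0 \<longrightarrow> \<rho>\<^sub>0 \<le> \<rho> w" using kernel by (simp add: admissible_kernel_def)
        then show "AE w in lebesgue. indicator Z w * \<rho>\<^sub>0 \<le> indicator (Z \<inter> ball 0 1) w * \<rho> w"
        proof eventually_elim
          case (elim w)
          then show ?case using sub r0(2) by (auto simp: indicator_def subset_iff)
        qed
      qed
      then have "measure lebesgue Z * \<rho>\<^sub>0 \<le> measure lebesgue Z * cell_avg Z" by (simp add: cell_avg_mult[OF Z(1)])
      then have "\<rho>\<^sub>0 \<le> cell_avg Z" using cell_measure[OF Z(1)] by simp
      also have "\<dots> = indicator (interior Z) z * cell_avg Z" using zi by simp
      also have "\<dots> \<le> averaged_kernel \<Z> \<rho> z"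
        unfolding averaged_eq using finite_cells Z(1) cell_avg_nonneg by (intro member_le_sum) auto
      finally show "\<rho>\<^sub>0 \<le> averaged_kernel \<Z> \<rho> z" .
    qed
  qed
qed

text \<open>The lower bound makes \<open>beta_const\<close> meaningful; the upper one lets
  \<open>M\<^sub>\<rho>\<close> replace the kernel mass in all constants.\<close>

lemma kernel_mass_bounds: "\<rho>\<^sub>0 * measure lborel (ball (0::'a) r\<^sub>0) \<le> kernel_mass \<rho>" "kernel_mass \<rho> \<le> M\<^sub>\<rho>"
proof -
  have e: "kernel_mass \<rho> = (LINT w|lebesgue. indicator (ball 0 1) w * \<rho> w)"
    by (simp add: kernel_mass_def set_lebesgue_integral_def)
  have "\<rho>\<^sub>0 * measure lborel (ball (0::'a) r\<^sub>0) = (LINT w|lebesgue. indicator (ball (0::'a) r\<^sub>0) w * \<rho>\<^sub>0)"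
    by simp
  also have "\<dots> \<le> kernel_mass \<rho>" unfolding e
  proof (rule integral_mono_AE[OF _ \<rho>_int])
    show "integrable lebesgue (\<lambda>w. indicator (ball (0::'a) r\<^sub>0) w * \<rho>\<^sub>0)"
      using emeasure_bounded_finite[OF bounded_ball[of "0::'a" r\<^sub>0]]
      by (intro integrable_mult_left integrable_real_indicator) auto
    have "AE w in lebesgue. w \<in> ball 0 r\<^sub>0 \<longrightarrow> \<rho>\<^sub>0 \<le> \<rho> w" using kernel by (simp add: admissible_kernel_def)
    then show "AE w in lebesgue. indicator (ball 0 r\<^sub>0) w * \<rho>\<^sub>0 \<le> indicator (ball 0 1) w * \<rho> w"
      using \<rho>_nonneg
    proof eventually_elim
      case (elim w)
      then show ?case using r0(2) by (auto simp: indicator_def split: if_splits)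
    qed
  qed
  finally show "\<rho>\<^sub>0 * measure lborel (ball (0::'a) r\<^sub>0) \<le> kernel_mass \<rho>" .
  have "kernel_mass \<rho> \<le> (LINT w|lebesgue. \<bar>indicator (ball 0 1) w * \<rho> w\<bar>)"
    unfolding e by (rule integral_mono[OF \<rho>_int]) (use \<rho>_int in auto)
  also have "\<dots> \<le> M\<^sub>\<rho>" using kernel by (simp add: admissible_kernel_def set_lebesgue_integral_def abs_mult)
  finally show "kernel_mass \<rho> \<le> M\<^sub>\<rho>" .
qed

lemma kernel_mass_pos: "0 < kernel_mass \<rho>"
proof -
  have "0 < measure lborel (ball (0::'a) r\<^sub>0)" using content_ball_pos[OF r0(1), of "0::'a"] by simp
  then have "0 < \<rho>\<^sub>0 * measure lborel (ball (0::'a) r\<^sub>0)" using \<rho>0 by simp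
  then show ?thesis using kernel_mass_bounds(1) by linarith
qed

definition nform :: "real \<Rightarrow> ('a \<Rightarrow> real) \<Rightarrow> ('a \<Rightarrow> real) \<Rightarrow> real" where
  "nform \<delta> u v = 1 / \<delta> ^ (DIM('a) + 2) * (LINT s|lborel. averaged_kernel \<Z> \<rho> (s /\<^sub>R \<delta>) * transl u v s)"

lemma nonlocal_form_eq:
  assumes "0 < \<delta>" "bbb u" "bbb v" "zero_ext \<Omega> u = u" "zero_ext \<Omega> v = v"
  shows "nonlocal_form \<Omega> \<delta> (averaged_kernel \<Z> \<rho>) u v = nform \<delta> u v"
  using kernel_form(1)[OF bbb_dilate[OF averaged_bbb assms(1)] assms(2,3)] assms(4,5)
  by (simp add: nonlocal_form_def nform_def)

text \<open>The rescaled kernel sees only shifts of length at most \<delta>, and its integral scales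
  like \<open>\<delta> ^ DIM('a)\<close>; of the normalisation only two powers of \<delta> survive.
  \<open>B\<close> will come once from the Dirichlet energy and once from the L2 norm.\<close>

lemma nform_upper:
  assumes \<delta>: "0 < \<delta>" and u: "bbb u" and B: "0 \<le> B" "\<And>s. norm s \<le> \<delta> \<Longrightarrow> transl u u s \<le> B"
  shows "nform \<delta> u u \<le> B / \<delta>\<^sup>2 * kernel_mass \<rho>"
proof -
  let ?k = "\<lambda>s. averaged_kernel \<Z> \<rho> (s /\<^sub>R \<delta>)"
  have k: "bbb ?k" by (rule bbb_dilate[OF averaged_bbb \<delta>])
  have "(LINT s|lborel. ?k s * transl u u s) \<le> (LINT s|lborel. ?k s * B)"
  proof (rule integral_mono[OF kernel_form(4)[OF k u u]])
    show "integrable lborel (\<lambda>s. ?k s * B)" using bbb_integrable[OF k] by simp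
    show "?k s * transl u u s \<le> ?k s * B" for s
    proof (cases "norm s \<le> \<delta>")
      case True
      then show ?thesis by (intro mult_left_mono B averaged_nonneg)
    next
      case False
      then have "1 < norm (s /\<^sub>R \<delta>)" using \<delta> by (simp add: field_simps)
      then show ?thesis by (simp add: averaged_zero)
    qed
  qed
  also have "\<dots> = (LINT s|lborel. ?k s) * B" by simp
  also have "(LINT s|lborel. ?k s) = \<delta> ^ DIM('a) * (LINT z|lborel. averaged_kernel \<Z> \<rho> z)"
    using lborel_integral_scale[OF bbb_measurable[OF k] \<delta>] \<delta> by simp
  also have "\<dots> * B \<le> \<delta> ^ DIM('a) * kernel_mass \<rho> * B"
    using \<delta> B by (intro mult_right_mono mult_left_mono averaged_integral_le) auto
  finally have "nform \<delta> u u \<le> 1 / \<delta> ^ (DIM('a) + 2) * (\<delta> ^ DIM('a) * kernel_mass \<rho> * B)"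
    unfolding nform_def using \<delta> by (intro mult_left_mono) auto
  also have "\<dots> = B / \<delta>\<^sup>2 * kernel_mass \<rho>" using \<delta> by (simp add: power_add power2_eq_square)
  finally show ?thesis .
qed

lemma nform_lower:
  assumes \<delta>: "0 < \<delta>" and u: "bbb u"
  shows "\<rho>\<^sub>0 / \<delta> ^ (DIM('a) + 2) * (LINT z|lborel. osc (r\<^sub>0 / 2 * \<delta>) u z) \<le> nform \<delta> u u"
proof -
  let ?k = "\<lambda>s. averaged_kernel \<Z> \<rho> (s /\<^sub>R \<delta>)"
  have k: "bbb ?k" by (rule bbb_dilate[OF averaged_bbb \<delta>])
  have "\<rho>\<^sub>0 * (LINT z|lborel. osc (r\<^sub>0 / 2 * \<delta>) u z)
      = (LINT s|lborel. \<rho>\<^sub>0 * (indicator (ball 0 (r\<^sub>0 / 2 * \<delta>)) s * transl u u s))"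
    by (simp add: osc_energy(1)[OF u])
  also have "\<dots> \<le> (LINT s|lborel. ?k s * transl u u s)"
  proof (rule integral_mono_AE[OF _ kernel_form(4)[OF k u u]])
    show "integrable lborel (\<lambda>s. \<rho>\<^sub>0 * (indicator (ball 0 (r\<^sub>0 / 2 * \<delta>)) s * transl u u s))"
      using osc_energy(3)[OF u] by simp
    \<comment> \<open>\<open>averaged_lower\<close> holds off a null set, and the dilation by
      \<delta> maps null sets to null sets.\<close>
    have "AE s in lborel. s /\<^sub>R \<delta> \<in> ball 0 (r\<^sub>0 / 2) \<longrightarrow> \<rho>\<^sub>0 \<le> ?k s"
    proof -
      obtain A where A: "A \<in> null_sets lborel" "{z. \<not> (z \<in> ball 0 (r\<^sub>0 / 2) \<longrightarrow> \<rho>\<^sub>0 \<le> averaged_kernel \<Z> \<rho> z)} \<subseteq> A"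
        using averaged_lower by (auto simp: eventually_ae_filter)
      have "(\<lambda>z. \<delta> *\<^sub>R z) ` A \<in> null_sets lebesgue"
      proof -
        have "negligible A" using A(1) by (simp add: negligible_iff_null_sets null_sets_completionI)
        then have "negligible ((\<lambda>z. \<delta> *\<^sub>R z) ` A)"
          by (rule negligible_differentiable_image_negligible[OF order_refl])
            (simp add: bounded_linear_imp_differentiable_on bounded_linear_scaleR_right)
        then show ?thesis by (simp add: negligible_iff_null_sets)
      qed
      then have "AE s in lebesgue. s \<notin> (\<lambda>z. \<delta> *\<^sub>R z) ` A" by (rule AE_not_in)
      then have "AE s in lborel. s \<notin> (\<lambda>z. \<delta> *\<^sub>R z) ` A" by (simp add: AE_completion_iff)
      then show ?thesis
      proof eventually_elim
        case (elim s)
        have "s = \<delta> *\<^sub>R (s /\<^sub>R \<delta>)" using \<delta> by simp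
        then have "s /\<^sub>R \<delta> \<notin> A" using elim by blast
        then show ?case using A(2) by blast
      qed
    qed
    then show "AE s in lborel. \<rho>\<^sub>0 * (indicator (ball 0 (r\<^sub>0 / 2 * \<delta>)) s * transl u u s) \<le> ?k s * transl u u s"
    proof eventually_elim
      case (elim s)
      show ?case
      proof (cases "s \<in> ball 0 (r\<^sub>0 / 2 * \<delta>)")
        case True
        then have "norm s < r\<^sub>0 / 2 * \<delta>" by simp
        then have "s /\<^sub>R \<delta> \<in> ball 0 (r\<^sub>0 / 2)" using \<delta> by (simp add: field_simps)
        then have "\<rho>\<^sub>0 * transl u u s \<le> ?k s * transl u u s"
          using elim by (intro mult_right_mono transl_nonneg) simp
        then show ?thesis using True by simp
      next
        case False
        then show ?thesis using transl_nonneg[of u s] averaged_nonneg by simp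
      qed
    qed
  qed
  finally show ?thesis
    unfolding nform_def using \<delta> by (simp add: divide_right_mono)
qed

end

section \<open>Averages at scale \<open>\<delta>\<close>\<close>

text \<open>Cauchy-Schwarz against the constant 1, from the nonnegative variance of the absolute
  value of \<open>f\<close> around its mean \<open>I / m\<close>.\<close>

lemma integral_square_le:
  fixes f :: "'a::euclidean_space \<Rightarrow> real"
  assumes i: "integrable lborel (\<lambda>y. indicator B y * \<bar>f y\<bar>)" "integrable lborel (\<lambda>y. indicator B y * (f y)\<^sup>2)"
    and B: "B \<in> sets borel" "emeasure lborel B < \<infinity>" "0 < measure lborel B"
  shows "(LINT y|lborel. indicator B y * \<bar>f y\<bar>)\<^sup>2 \<le> measure lborel B * (LINT y|lborel. indicator B y * (f y)\<^sup>2)"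
proof -
  define m I where "m = measure lborel B" and "I = (LINT y|lborel. indicator B y * \<bar>f y\<bar>)"
  have ib: "integrable lborel (\<lambda>y. indicator B y * (I / m)\<^sup>2)"
    by (intro integrable_mult_left integrable_real_indicator) (use B in auto)
  have "0 \<le> (LINT y|lborel. indicator B y * (\<bar>f y\<bar> - I / m)\<^sup>2)" by (intro integral_nonneg_AE) auto
  also have "\<dots> = (LINT y|lborel. indicator B y * (f y)\<^sup>2 - 2 * (I / m) * (indicator B y * \<bar>f y\<bar>) + indicator B y * (I / m)\<^sup>2)"
    by (intro Bochner_Integration.integral_cong) (auto simp: indicator_def power2_diff)
  also have "\<dots> = (LINT y|lborel. indicator B y * (f y)\<^sup>2) - 2 * (I / m) * I + m * (I / m)\<^sup>2"
    using i ib by (simp add: I_def m_def)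
  also have "\<dots> = (LINT y|lborel. indicator B y * (f y)\<^sup>2) - I\<^sup>2 / m"
    using B(3) by (simp add: m_def[symmetric] power2_eq_square field_simps)
  finally have "I\<^sup>2 / m \<le> (LINT y|lborel. indicator B y * (f y)\<^sup>2)" by simp
  then show ?thesis using B(3) by (simp add: I_def m_def field_simps)
qed

definition uball :: "'a::euclidean_space itself \<Rightarrow> real" where
  "uball _ = unit_ball_vol (real DIM('a))"

lemma measure_ball: "0 \<le> r \<Longrightarrow> measure lborel (ball (c::'a::euclidean_space) r) = uball TYPE('a) * r ^ DIM('a)"
  by (simp add: content_ball uball_def)

lemma uball_pos: "0 < uball TYPE('a::euclidean_space)"
  by (simp add: uball_def)

text \<open>The common source of the two properties of averages: with a hat as weight
  \<open>a\<close> it gives the approximation error, with a difference of two hats the modulus of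
  continuity.\<close>

lemma weighted_osc:
  fixes u :: "'a::euclidean_space \<Rightarrow> real"
  assumes u: "bbb u" and a: "a \<in> borel_measurable borel" and K: "0 < K" and A: "0 \<le> A"
    and le: "\<And>y. \<bar>a y\<bar> \<le> A * indicator (ball z K) y"
  shows "(LINT y|lborel. a y * (u y - u z))\<^sup>2 \<le> A\<^sup>2 * (uball TYPE('a) * K ^ DIM('a)) * osc K u z"
proof -
  define I where "I = (LINT y|lborel. indicator (ball z K) y * \<bar>u y - u z\<bar>)"
  have "\<bar>LINT y|lborel. a y * (u y - u z)\<bar> \<le> (LINT y|lborel. A * (indicator (ball z K) y * \<bar>u y - u z\<bar>))"
  proof (rule integral_abs_bound_integral)
    have "\<bar>a y * (u y - u z)\<bar> \<le> A * (indicator (ball z K) y * \<bar>u y - u z\<bar>)" for y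
      using mult_right_mono[OF le[of y], of "\<bar>u y - u z\<bar>"] by (simp add: abs_mult mult_ac)
    then show "\<bar>a y * (u y - u z)\<bar> \<le> A * (indicator (ball z K) y * \<bar>u y - u z\<bar>)" for y .
    show i: "integrable lborel (\<lambda>y. A * (indicator (ball z K) y * \<bar>u y - u z\<bar>))"
      using osc_integrable(2)[OF u] by simp
    show "integrable lborel (\<lambda>y. a y * (u y - u z))"
      by (rule Bochner_Integration.integrable_bound[OF i])
        (use a bbb_measurable[OF u] in \<open>auto intro!: AE_I2 order_trans[OF \<open>\<And>y. \<bar>a y * (u y - u z)\<bar> \<le> _ y\<close>]\<close>)
  qed
  then have "\<bar>LINT y|lborel. a y * (u y - u z)\<bar> \<le> A * I" by (simp add: I_def)
  then have 1: "\<bar>LINT y|lborel. a y * (u y - u z)\<bar>\<^sup>2 \<le> (A * I)\<^sup>2" by (rule power_mono) simp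
  have "I\<^sup>2 \<le> measure lborel (ball z K) * osc K u z"
    unfolding I_def osc_def
  proof (intro integral_square_le osc_integrable u)
    show "emeasure lborel (ball z K) < \<infinity>" by (rule emeasure_bounded_finite) simp
  qed (use K in \<open>auto simp: measure_ball uball_pos\<close>)
  then have "A\<^sup>2 * I\<^sup>2 \<le> A\<^sup>2 * (measure lborel (ball z K) * osc K u z)" by (rule mult_left_mono) simp
  with 1 K show ?thesis by (simp add: power_mult_distrib measure_ball mult.assoc)
qed

section \<open>Smoothing with a hat kernel\<close>

definition hat :: "real \<Rightarrow> 'a::euclidean_space \<Rightarrow> real" where
  "hat \<delta> y = max 0 (1 - norm y / \<delta>)"

definition hat_mass :: "real \<Rightarrow> 'a::euclidean_space itself \<Rightarrow> real" where
  "hat_mass \<delta> _ = (LINT y|lborel. hat \<delta> (y::'a))"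

text \<open>Division by the mass reproduces constants, which is what allows
  \<open>smooth_minus\<close> to subtract a reference value such as \<open>u z\<close>. The
  Lipschitz constant \<open>1 / \<delta>\<close> of the hat becomes the gradient bound of the
  interpolant.\<close>

definition smooth :: "real \<Rightarrow> ('a::euclidean_space \<Rightarrow> real) \<Rightarrow> 'a \<Rightarrow> real" where
  "smooth \<delta> u x = (LINT y|lborel. hat \<delta> (y - x) * u y) / hat_mass \<delta> TYPE('a)"

lemma hat_bounds: "0 < \<delta> \<Longrightarrow> 0 \<le> hat \<delta> y" "0 < \<delta> \<Longrightarrow> hat \<delta> y \<le> 1"
  by (auto simp: hat_def)

lemma hat_zero: "0 < \<delta> \<Longrightarrow> \<delta> \<le> norm y \<Longrightarrow> hat \<delta> y = 0"
  by (auto simp: hat_def field_simps)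

lemma hat_lipschitz: "0 < \<delta> \<Longrightarrow> \<bar>hat \<delta> x - hat \<delta> y\<bar> \<le> norm (x - y) / \<delta>"
proof -
  assume \<delta>: "0 < \<delta>"
  have "\<bar>max 0 a - max 0 b\<bar> \<le> \<bar>a - b\<bar>" for a b :: real by (auto simp: max_def)
  then have "\<bar>hat \<delta> x - hat \<delta> y\<bar> \<le> \<bar>(1 - norm x / \<delta>) - (1 - norm y / \<delta>)\<bar>" unfolding hat_def .
  also have "\<dots> = \<bar>norm x - norm y\<bar> / \<delta>" using \<delta> by (simp add: abs_minus_commute diff_divide_distrib[symmetric])
  also have "\<dots> \<le> norm (x - y) / \<delta>" using \<delta> norm_triangle_ineq3 by (intro divide_right_mono) auto
  finally show ?thesis .
qed

lemma hat_measurable[measurable]: "hat \<delta> \<in> borel_measurable borel"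
  unfolding hat_def[abs_def] by measurable

lemma hat_bbb:
  assumes "0 < \<delta>"
  shows "bbb (hat \<delta>)"
proof -
  have "\<bar>hat \<delta> x\<bar> \<le> 1" for x using hat_bounds[OF assms, of x] by simp
  then show ?thesis unfolding bbb_def using hat_zero[OF assms] hat_measurable by blast
qed

lemma hat_translate_bbb: "0 < \<delta> \<Longrightarrow> bbb (\<lambda>y. hat \<delta> (y - x))"
  using bbb_translate[OF hat_bbb, of \<delta> "- x"] by simp

text \<open>The hat is at least 1/2 on the ball of half the radius.\<close>

lemma hat_mass_lower:
  assumes \<delta>: "0 < \<delta>"
  shows "uball TYPE('a) * (\<delta> / 2) ^ DIM('a) / 2 \<le> hat_mass \<delta> TYPE('a::euclidean_space)"
proof -
  have "uball TYPE('a) * (\<delta> / 2) ^ DIM('a) / 2 = (LINT y|lborel. indicator (ball (0::'a) (\<delta> / 2)) y * (1 / 2))"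
    using \<delta> by (simp add: measure_ball)
  also have "\<dots> \<le> hat_mass \<delta> TYPE('a)" unfolding hat_mass_def
  proof (rule integral_mono)
    show "integrable lborel (\<lambda>y. indicator (ball (0::'a) (\<delta> / 2)) y * (1 / 2 :: real))"
      by (intro bbb_integrable bbb_mult_right[where M = 1] bbb_indicator) auto
    show "integrable lborel (hat \<delta> :: 'a \<Rightarrow> real)" by (intro bbb_integrable hat_bbb \<delta>)
    show "indicator (ball 0 (\<delta> / 2)) y * (1 / 2) \<le> hat \<delta> y" for y :: 'a
      using \<delta> by (auto simp: indicator_def hat_def field_simps)
  qed
  finally show ?thesis .
qed

lemma hat_mass_pos: "0 < \<delta> \<Longrightarrow> 0 < hat_mass \<delta> TYPE('a::euclidean_space)"
  using hat_mass_lower[of \<delta>, where 'a = 'a] uball_pos[where 'a = 'a]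
  by (smt (verit) divide_pos_pos mult_pos_pos zero_less_power)

lemma hat_integral_translate: "(LINT y|lborel. hat \<delta> (y - x)) = hat_mass \<delta> TYPE('a)" for x :: "'a::euclidean_space"
  unfolding hat_mass_def by (subst lborel_integral_translate[of "\<lambda>y. hat \<delta> (y - x)" x]) auto

lemma smooth_minus:
  fixes u :: "'a::euclidean_space \<Rightarrow> real"
  assumes \<delta>: "0 < \<delta>" and u: "bbb u"
  shows "smooth \<delta> u x - c = (LINT y|lborel. hat \<delta> (y - x) * (u y - c)) / hat_mass \<delta> TYPE('a)"
proof -
  have "(LINT y|lborel. hat \<delta> (y - x) * (u y - c)) = (LINT y|lborel. hat \<delta> (y - x) * u y - hat \<delta> (y - x) * c)"
    by (simp add: algebra_simps)
  also have "\<dots> = (LINT y|lborel. hat \<delta> (y - x) * u y) - hat_mass \<delta> TYPE('a) * c"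
    using bbb_integrable[OF hat_translate_bbb[OF \<delta>], of x] bbb_integrable[OF bbb_mult[OF hat_translate_bbb[OF \<delta>] u], of x]
    by (simp add: hat_integral_translate)
  finally show ?thesis using hat_mass_pos[OF \<delta>, where 'a = 'a] by (simp add: smooth_def diff_divide_distrib)
qed

text \<open>The volume of the ball of radius \<open>\<kappa> * \<delta>\<close> divided by the
  square of the bound in \<open>hat_mass_lower\<close>, with the power of \<delta> removed: the two
  factors 1/2 give 4, and the square of \<open>(1 / 2) ^ DIM('a)\<close> gives
  \<open>4 ^ DIM('a)\<close>.\<close>

definition smooth_const :: "'a::euclidean_space itself \<Rightarrow> real \<Rightarrow> real" where
  "smooth_const _ \<kappa> = 4 * (4 * \<kappa>) ^ DIM('a) / uball TYPE('a)"

lemma smooth_const_bound: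
  assumes \<delta>: "0 < \<delta>" and \<kappa>: "0 < \<kappa>"
  shows "uball TYPE('a) * (\<kappa> * \<delta>) ^ DIM('a) / (hat_mass \<delta> TYPE('a::euclidean_space))\<^sup>2 \<le> smooth_const TYPE('a) \<kappa> / \<delta> ^ DIM('a)"
proof -
  define b where "b = uball TYPE('a)"
  define L where "L = b * (\<delta> / 2) ^ DIM('a) / 2"
  have b: "0 < b" using uball_pos by (simp add: b_def)
  have L: "0 < L" using b \<delta> by (simp add: L_def)
  have "L\<^sup>2 \<le> (hat_mass \<delta> TYPE('a))\<^sup>2"
    using hat_mass_lower[OF \<delta>, where 'a = 'a] L by (intro power_mono) (auto simp: L_def b_def)
  then have "b * (\<kappa> * \<delta>) ^ DIM('a) / (hat_mass \<delta> TYPE('a))\<^sup>2 \<le> b * (\<kappa> * \<delta>) ^ DIM('a) / L\<^sup>2"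
    using b \<kappa> \<delta> L by (intro divide_left_mono mult_pos_pos zero_less_power hat_mass_pos) auto
  also have "\<dots> = smooth_const TYPE('a) \<kappa> / \<delta> ^ DIM('a)"
  proof -
    have "(4::real) ^ DIM('a) = 2 ^ DIM('a) * 2 ^ DIM('a)" by (simp add: power_mult_distrib[symmetric])
    then show ?thesis
      using b \<delta> by (simp add: smooth_const_def b_def[symmetric] L_def power_mult_distrib power_divide power2_eq_square field_simps)
  qed
  finally show ?thesis by (simp add: b_def)
qed

lemma smooth_const_nonneg: "0 < \<kappa> \<Longrightarrow> 0 \<le> smooth_const TYPE('a::euclidean_space) \<kappa>"
  using uball_pos[where 'a = 'a] by (simp add: smooth_const_def)

text \<open>The error is measured at a point \<open>z\<close> other than the centre
  \<open>x\<close>: later \<open>x\<close> is a vertex and \<open>z\<close> runs through the cell.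
  The condition on \<kappa> keeps the support of the hat around \<open>x\<close> inside the ball
  around \<open>z\<close>.\<close>

lemma smooth_approx:
  fixes u :: "'a::euclidean_space \<Rightarrow> real"
  assumes \<delta>: "0 < \<delta>" and u: "bbb u" and \<kappa>: "0 < \<kappa>" "norm (x - z) + \<delta> \<le> \<kappa> * \<delta>"
  shows "(smooth \<delta> u x - u z)\<^sup>2 \<le> smooth_const TYPE('a) \<kappa> / \<delta> ^ DIM('a) * osc (\<kappa> * \<delta>) u z"
proof -
  have "(LINT y|lborel. hat \<delta> (y - x) * (u y - u z))\<^sup>2 \<le> 1\<^sup>2 * (uball TYPE('a) * (\<kappa> * \<delta>) ^ DIM('a)) * osc (\<kappa> * \<delta>) u z"
  proof (rule weighted_osc[OF u])
    show "\<bar>hat \<delta> (y - x)\<bar> \<le> 1 * indicator (ball z (\<kappa> * \<delta>)) y" for y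
    proof (cases "norm (y - x) < \<delta>")
      case True
      then have "dist z y < \<kappa> * \<delta>" using \<kappa>(2) norm_triangle_ineq[of "y - x" "x - z"] by (simp add: dist_norm norm_minus_commute)
      then show ?thesis using hat_bounds[OF \<delta>, of "y - x"] by simp
    next
      case False
      then show ?thesis using hat_zero[OF \<delta>, of "y - x"] by simp
    qed
  qed (use \<delta> \<kappa> in auto)
  then have "(smooth \<delta> u x - u z)\<^sup>2 \<le> uball TYPE('a) * (\<kappa> * \<delta>) ^ DIM('a) * osc (\<kappa> * \<delta>) u z / (hat_mass \<delta> TYPE('a))\<^sup>2"
    by (simp add: smooth_minus[OF \<delta> u] power_divide divide_right_mono)
  also have "\<dots> = uball TYPE('a) * (\<kappa> * \<delta>) ^ DIM('a) / (hat_mass \<delta> TYPE('a))\<^sup>2 * osc (\<kappa> * \<delta>) u z" by simp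
  also have "\<dots> \<le> smooth_const TYPE('a) \<kappa> / \<delta> ^ DIM('a) * osc (\<kappa> * \<delta>) u z"
    by (intro mult_right_mono smooth_const_bound \<delta> \<kappa> osc_nonneg)
  finally show ?thesis .
qed

text \<open>Subtracting the same constant \<open>u z\<close> from both averages leaves an integral
  of \<open>u y - u z\<close> against the difference of two hats, whose size is at most
  \<open>norm (x - x') / \<delta>\<close>.\<close>

lemma smooth_lipschitz:
  fixes u :: "'a::euclidean_space \<Rightarrow> real"
  assumes \<delta>: "0 < \<delta>" and u: "bbb u"
    and \<kappa>: "0 < \<kappa>" "norm (x - z) + \<delta> \<le> \<kappa> * \<delta>" "norm (x' - z) + \<delta> \<le> \<kappa> * \<delta>"
  shows "(smooth \<delta> u x - smooth \<delta> u x')\<^sup>2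
    \<le> (norm (x - x') / \<delta>)\<^sup>2 * (smooth_const TYPE('a) \<kappa> / \<delta> ^ DIM('a) * osc (\<kappa> * \<delta>) u z)"
proof -
  define A where "A = norm (x - x') / \<delta>"
  have i: "integrable lborel (\<lambda>y. hat \<delta> (y - x) * (u y - u z))" for x
  proof -
    have "integrable lborel (\<lambda>y. hat \<delta> (y - x) * u y - u z * hat \<delta> (y - x))"
      using bbb_integrable[OF hat_translate_bbb[OF \<delta>], of x] bbb_integrable[OF bbb_mult[OF hat_translate_bbb[OF \<delta>] u], of x] by simp
    then show ?thesis by (simp add: algebra_simps)
  qed
  have "smooth \<delta> u x - smooth \<delta> u x' = (smooth \<delta> u x - u z) - (smooth \<delta> u x' - u z)" by simp
  also have "\<dots> = (LINT y|lborel. (hat \<delta> (y - x) - hat \<delta> (y - x')) * (u y - u z)) / hat_mass \<delta> TYPE('a)"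
    unfolding smooth_minus[OF \<delta> u] using i[of x] i[of x'] by (simp add: left_diff_distrib diff_divide_distrib)
  finally have e: "smooth \<delta> u x - smooth \<delta> u x' = (LINT y|lborel. (hat \<delta> (y - x) - hat \<delta> (y - x')) * (u y - u z)) / hat_mass \<delta> TYPE('a)" .
  have "(LINT y|lborel. (hat \<delta> (y - x) - hat \<delta> (y - x')) * (u y - u z))\<^sup>2 \<le> A\<^sup>2 * (uball TYPE('a) * (\<kappa> * \<delta>) ^ DIM('a)) * osc (\<kappa> * \<delta>) u z"
  proof (rule weighted_osc[OF u])
    show "\<bar>hat \<delta> (y - x) - hat \<delta> (y - x')\<bar> \<le> A * indicator (ball z (\<kappa> * \<delta>)) y" for y
    proof (cases "norm (y - z) < \<kappa> * \<delta>")
      case True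
      then have "y \<in> ball z (\<kappa> * \<delta>)" by (simp add: dist_norm norm_minus_commute)
      moreover have "\<bar>hat \<delta> (y - x) - hat \<delta> (y - x')\<bar> \<le> A"
        using hat_lipschitz[OF \<delta>, of "y - x" "y - x'"] by (simp add: A_def norm_minus_commute)
      ultimately show ?thesis by simp
    next
      case False
      have "norm (y - z) \<le> norm (y - x) + norm (x - z)" "norm (y - z) \<le> norm (y - x') + norm (x' - z)"
        using norm_triangle_ineq[of "y - x" "x - z"] norm_triangle_ineq[of "y - x'" "x' - z"] by simp_all
      then have "\<delta> \<le> norm (y - x)" "\<delta> \<le> norm (y - x')" using False \<kappa> by linarith+
      then have "hat \<delta> (y - x) = 0" "hat \<delta> (y - x') = 0" by (auto intro: hat_zero[OF \<delta>])
      moreover have "0 \<le> A" using \<delta> by (simp add: A_def)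
      ultimately show ?thesis by simp
    qed
  qed (use \<delta> \<kappa> in \<open>auto simp: A_def\<close>)
  then have "(smooth \<delta> u x - smooth \<delta> u x')\<^sup>2 \<le> A\<^sup>2 * (uball TYPE('a) * (\<kappa> * \<delta>) ^ DIM('a)) * osc (\<kappa> * \<delta>) u z / (hat_mass \<delta> TYPE('a))\<^sup>2"
    by (simp add: e power_divide divide_right_mono)
  also have "\<dots> = A\<^sup>2 * (uball TYPE('a) * (\<kappa> * \<delta>) ^ DIM('a) / (hat_mass \<delta> TYPE('a))\<^sup>2 * osc (\<kappa> * \<delta>) u z)" by simp
  also have "\<dots> \<le> A\<^sup>2 * (smooth_const TYPE('a) \<kappa> / \<delta> ^ DIM('a) * osc (\<kappa> * \<delta>) u z)"
    by (intro mult_left_mono mult_right_mono smooth_const_bound \<delta> \<kappa> osc_nonneg) auto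
  finally show ?thesis by (simp add: A_def)
qed

text \<open>A pointwise Poincare inequality: on the ball where \<open>u\<close> vanishes the
  integrand of the oscillation is exactly the square of \<open>u z\<close>.\<close>

lemma osc_zero_ball:
  fixes u :: "'a::euclidean_space \<Rightarrow> real"
  assumes u: "bbb u" and r: "0 < r" and sub: "ball y\<^sub>0 r \<subseteq> ball z K" and 0: "\<And>y. y \<in> ball y\<^sub>0 r \<Longrightarrow> u y = 0"
  shows "uball TYPE('a) * r ^ DIM('a) * (u z)\<^sup>2 \<le> osc K u z"
proof -
  have "uball TYPE('a) * r ^ DIM('a) * (u z)\<^sup>2 = (LINT y|lborel. indicator (ball y\<^sub>0 r) y * (u z)\<^sup>2)"
    using r by (simp add: measure_ball)
  also have "\<dots> \<le> osc K u z" unfolding osc_def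
  proof (rule integral_mono[OF _ osc_integrable(1)[OF u]])
    show "integrable lborel (\<lambda>y. indicator (ball y\<^sub>0 r) y * (u z)\<^sup>2)"
      by (intro bbb_integrable bbb_mult_right[where M = "(u z)\<^sup>2"] bbb_indicator) auto
    show "indicator (ball y\<^sub>0 r) y * (u z)\<^sup>2 \<le> indicator (ball z K) y * (u y - u z)\<^sup>2" for y
      using sub 0[of y] by (auto simp: indicator_def)
  qed
  finally show ?thesis .
qed

text \<open>The segment from \<open>p\<close> to a nearest point outside \<Omega> crosses the
  frontier. Exterior balls are available at frontier points only, hence this detour.\<close>

lemma near_frontier:
  fixes \<Omega> :: "'a::euclidean_space set"
  assumes "p \<in> closure \<Omega>" "infdist p (- \<Omega>) < \<delta>" "- \<Omega> \<noteq> {}" "open \<Omega>"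
  shows "\<exists>x\<in>frontier \<Omega>. dist p x < \<delta>"
proof -
  obtain y where y: "y \<in> - \<Omega>" "dist p y < \<delta>" using assms(2-4) infdist_attains_inf[of "- \<Omega>" p] by (metis closed_Compl)
  show ?thesis
  proof (cases "p \<in> \<Omega>")
    case True
    have "closed_segment p y \<inter> frontier \<Omega> \<noteq> {}"
      using True y by (intro connected_Int_frontier) auto
    then obtain x where x: "x \<in> closed_segment p y" "x \<in> frontier \<Omega>" by blast
    then have "dist p x \<le> dist p y" using dist_in_closed_segment by (metis dist_commute)
    then have "dist p x < \<delta>" using y by linarith
    with x show ?thesis by blast
  next
    case False
    then have "p \<in> frontier \<Omega>" using assms(1,4) by (simp add: frontier_def interior_open)
    moreover have "0 < \<delta>" using y zero_le_dist[of p y] by linarith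
    ultimately show ?thesis by (intro bexI[of _ p]) auto
  qed
qed

section \<open>Quasi-interpolation\<close>

context fe_mesh
begin

lemma dom_nonUNIV: "- \<Omega> \<noteq> {}"
  using bounded_dom not_bounded_UNIV by (metis compl_top_eq double_compl)

lemma cell_diameter_pos: "T \<in> \<T> \<Longrightarrow> 0 < diameter T"
proof -
  assume T: "T \<in> \<T>"
  obtain z e where z: "0 < e" "cball z e \<subseteq> T"
    using cell_interior[OF T] by (metis all_not_in_conv mem_interior_cball)
  obtain w :: 'a where w: "norm w = e" using vector_choose_size[of e] z(1) by auto
  have "z \<in> T" "z + w \<in> T" using z w by (auto simp: subset_iff dist_norm)
  then have "dist z (z + w) \<le> diameter T" by (intro diameter_bounded_bound[OF cell_bounded[OF T]])
  then show ?thesis using w z(1) by (simp add: dist_norm)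
qed

text \<open>Some inscribed ball has radius above half of the supremum, which turns the factor 2 of
  \<open>inball_diameter\<close> into 4 and avoids showing that the supremum is attained.
  \<open>C\<close> is a positive majorant of \<open>C\<^sub>s\<close>, whose sign is not
  prescribed.\<close>

lemma cell_inball:
  assumes T: "T \<in> \<T>" and sr: "shape_regular C\<^sub>s \<T>" and C: "C\<^sub>s \<le> C" "0 < C"
  obtains z r where "0 < r" "cball z r \<subseteq> T" "diameter T \<le> 4 * C * r"
proof -
  define S where "S = {r. 0 \<le> r \<and> (\<exists>z. cball z r \<subseteq> T)}"
  obtain x where x: "x \<in> T" using cell_interior[OF T] interior_subset by blast
  have ne: "S \<noteq> {}" using x by (auto simp: S_def intro!: exI[of _ 0] exI[of _ x])
  have bd: "bdd_above S"
  proof (rule bdd_aboveI)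
    fix r assume "r \<in> S"
    then obtain z where z: "0 \<le> r" "cball z r \<subseteq> T" by (auto simp: S_def)
    obtain w :: 'a where w: "norm w = r" using vector_choose_size[OF z(1)] by auto
    have "z \<in> T" "z + w \<in> T" using z w by (auto simp: subset_iff dist_norm)
    then have "dist z (z + w) \<le> diameter T" by (intro diameter_bounded_bound[OF cell_bounded[OF T]])
    then show "r \<le> diameter T" using w by (simp add: dist_norm)
  qed
  have "0 \<in> S" using x by (auto simp: S_def intro!: exI[of _ x])
  then have S0: "0 \<le> Sup S" by (intro cSup_upper bd)
  have "diameter T \<le> C\<^sub>s * (2 * Sup S)"
    using sr T by (simp add: shape_regular_def inball_diameter_def S_def)
  also have "\<dots> \<le> C * (2 * Sup S)" using C S0 by (intro mult_right_mono) auto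
  finally have d: "diameter T \<le> C * (2 * Sup S)" .
  then have "0 < Sup S" using cell_diameter_pos[OF T] C S0 by (cases "Sup S = 0") auto
  then have "Sup S / 2 < Sup S" by simp
  then obtain r where r: "r \<in> S" "Sup S / 2 < r" using ne bd less_cSup_iff by metis
  then obtain z where "cball z r \<subseteq> T" by (auto simp: S_def)
  moreover have "0 < r" using r S0 by linarith
  moreover have "diameter T \<le> 4 * C * r"
  proof -
    have "C * (2 * Sup S) \<le> C * (4 * r)" using r C by (intro mult_left_mono) auto
    with d show ?thesis by simp
  qed
  ultimately show ?thesis using that by blast
qed

lemma gradient_direction:
  fixes g :: 'a
  obtains e where "norm e = 1" "inner g e = norm g"
proof (cases "g = 0")
  case True
  obtain e :: 'a where "norm e = 1" using vector_choose_size[of 1] by auto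
  then show ?thesis using True that by simp
next
  case False
  have "inner g (g /\<^sub>R norm g) = norm g"
    using False by (simp add: power2_norm_eq_inner[symmetric] power2_eq_square)
  then show ?thesis using False that[of "g /\<^sub>R norm g"] by simp
qed

section \<open>Coarse meshes: oscillation of affine functions\<close>

lemma osc_affine:
  assumes u: "u \<in> V" and T: "T \<in> \<T>" and R: "0 < R" and sub: "ball y R \<subseteq> T"
  shows "uball TYPE('a) / 4 ^ (DIM('a) + 2) * R ^ (DIM('a) + 2) * (norm (cell_grad u T))\<^sup>2 \<le> osc R u y"
proof -
  note bu = fe_bbb[OF u]
  define g where "g = cell_grad u T"
  obtain e where e: "norm e = 1" "inner g e = norm g" using gradient_direction[of g] by blast
  \<comment> \<open>Half a radius along the gradient direction raises \<open>u\<close> by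
    \<open>norm g * R / 2\<close>; within distance \<open>R / 4\<close> of that point at most half
    of the increase is lost.\<close>
  define B where "B = ball (y + (R / 2) *\<^sub>R e) (R / 4)"
  have "indicator B y' * (norm g * R / 4)\<^sup>2 \<le> indicator (ball y R) y' * (u y' - u y)\<^sup>2" for y'
  proof (cases "y' \<in> B")
    case True
    define w where "w = y' - (y + (R / 2) *\<^sub>R e)"
    have w: "norm w < R / 4" using True by (simp add: B_def w_def dist_norm norm_minus_commute)
    have y': "y' = y + ((R / 2) *\<^sub>R e + w)" by (simp add: w_def)
    have "norm ((R / 2) *\<^sub>R e + w) \<le> R / 2 + norm w"
      using norm_triangle_ineq[of "(R / 2) *\<^sub>R e" w] e R by simp
    then have yB: "y' \<in> ball y R" using w R unfolding y' mem_ball dist_norm norm_minus_commute[of y] by simp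
    have "y \<in> T" "y' \<in> T" using sub yB R by auto
    then have "u y' - u y = inner g ((R / 2) *\<^sub>R e + w)"
      using fe_diff[OF u T] by (simp add: g_def y')
    also have "\<dots> = norm g * R / 2 + inner g w" using e by (simp add: inner_add_right)
    finally have "norm g * R / 2 - \<bar>inner g w\<bar> \<le> u y' - u y" by simp
    moreover have "\<bar>inner g w\<bar> \<le> norm g * (R / 4)"
      using Cauchy_Schwarz_ineq2[of g w] w by (meson less_imp_le mult_left_mono norm_ge_zero order_trans)
    ultimately have "norm g * R / 4 \<le> u y' - u y" by simp
    then have "(norm g * R / 4)\<^sup>2 \<le> (u y' - u y)\<^sup>2" using R by (intro power_mono) auto
    then show ?thesis using True yB by simp
  next
    case False
    then show ?thesis by simp
  qed
  then have "(LINT y'|lborel. indicator B y' * (norm g * R / 4)\<^sup>2) \<le> osc R u y"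
    unfolding osc_def B_def
    by (intro integral_mono osc_integrable(1)[OF bu] bbb_integrable bbb_mult_right[where M = "(norm g * R / 4)\<^sup>2"] bbb_indicator)
      auto
  moreover have "(LINT y'|lborel. indicator B y' * (norm g * R / 4)\<^sup>2) = uball TYPE('a) * (R / 4) ^ DIM('a) * (norm g * R / 4)\<^sup>2"
    using R by (simp add: B_def measure_ball)
  moreover have "uball TYPE('a) * (R / 4) ^ DIM('a) * (norm g * R / 4)\<^sup>2
      = uball TYPE('a) / 4 ^ (DIM('a) + 2) * R ^ (DIM('a) + 2) * (norm g)\<^sup>2"
    by (simp add: power_mult_distrib power_divide power_add power2_eq_square mult_ac)
  ultimately show ?thesis unfolding g_def[symmetric] by linarith
qed

text \<open>Contracting the simplex by 1/2 towards the centre of an inscribed ball keeps the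
  fraction \<open>1 / 2 ^ DIM('a)\<close> of its volume, and by convexity every point of the
  contracted copy is the centre of a ball of radius \<open>R\<close> inside \<open>T\<close>. There
  \<open>osc_affine\<close> applies.\<close>

lemma osc_cell_lower:
  assumes u: "u \<in> V" and T: "T \<in> \<T>" and z: "cball z r \<subseteq> T" and R: "0 < R" "R \<le> r / 2"
  shows "uball TYPE('a) / 4 ^ (DIM('a) + 2) / 2 ^ DIM('a) * R ^ (DIM('a) + 2) * (measure lborel T * (norm (cell_grad u T))\<^sup>2)
    \<le> (LINT x|lborel. indicator T x * osc R u x)"
proof -
  note bu = fe_bbb[OF u]
  define c where "c = uball TYPE('a) / 4 ^ (DIM('a) + 2) * R ^ (DIM('a) + 2) * (norm (cell_grad u T))\<^sup>2"
  define h where "h x = (1 / 2) *\<^sub>R z + (1 / 2) *\<^sub>R x" for x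
  define T' where "T' = h ` T"
  have cT': "compact T'" unfolding T'_def h_def[abs_def]
    by (intro compact_continuous_image continuous_intros cell_compact T)
  then have mT': "T' \<in> sets borel" using compact_imp_closed borel_closed by blast
  have sub: "ball (h x) R \<subseteq> T" if x: "x \<in> T" for x
  proof
    fix y assume "y \<in> ball (h x) R"
    then have n: "norm (y - h x) < R" by (simp add: dist_norm norm_minus_commute)
    have "z + 2 *\<^sub>R (y - h x) \<in> T" using n R z by (auto simp: subset_iff dist_norm)
    from convexD[OF cell_convex[OF T] this x, of "1/2" "1/2"]
    have "(1 / 2) *\<^sub>R (z + 2 *\<^sub>R (y - h x)) + (1 / 2) *\<^sub>R x \<in> T" by simp
    moreover have "(1 / 2) *\<^sub>R (z + 2 *\<^sub>R (y - h x)) + (1 / 2) *\<^sub>R x = y"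
      by (rule euclidean_eqI) (simp add: h_def inner_diff_left inner_add_left algebra_simps)
    ultimately show "y \<in> T" by simp
  qed
  have T'T: "T' \<subseteq> T" using sub R unfolding T'_def by (meson centre_in_ball image_subsetI subsetD)
  have inj: "h x \<in> T' \<longleftrightarrow> x \<in> T" for x
    unfolding T'_def h_def[abs_def] by (auto simp: image_iff)
  have "measure lborel T' = (LINT x|lborel. indicator T' x)" by simp
  also have "\<dots> = (1 / 2) ^ DIM('a) * (LINT x|lborel. indicator T' ((1 / 2) *\<^sub>R z + (1 / 2) *\<^sub>R x))"
    using mT' by (intro lborel_integral_homothety) auto
  also have "(LINT x|lborel. indicator T' ((1 / 2) *\<^sub>R z + (1 / 2) *\<^sub>R x)) = (LINT x|lborel. indicator T x)"
    using inj by (intro Bochner_Integration.integral_cong) (auto simp: h_def indicator_def)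
  finally have mT: "measure lborel T' = measure lborel T / 2 ^ DIM('a)" by (simp add: power_one_over)
  have "measure lborel T' * c = (LINT x|lborel. indicator T' x * c)" by simp
  also have "\<dots> \<le> (LINT x|lborel. indicator T x * osc R u x)"
  proof (rule integral_mono)
    show "integrable lborel (\<lambda>x. indicator T' x * c)"
      using emeasure_bounded_finite[OF compact_imp_bounded[OF cT']] mT'
      by (intro integrable_mult_left integrable_real_indicator) auto
    show "integrable lborel (\<lambda>x. indicator T x * osc R u x)"
      using integrable_mult_indicator[OF _ osc_energy(2)[OF bu], of T R] cell_closed[OF T] by (simp add: borel_closed)
    show "indicator T' x * c \<le> indicator T x * osc R u x" for x
    proof (cases "x \<in> T'")
      case True
      then obtain y where "y \<in> T" "x = h y" by (auto simp: T'_def)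
      then show ?thesis using osc_affine[OF u T R(1) sub] T'T True by (auto simp: c_def)
    next
      case False
      then show ?thesis using osc_nonneg[of R u x] by simp
    qed
  qed
  finally show ?thesis by (simp add: mT c_def mult_ac)
qed

lemma osc_sum_cells:
  assumes u: "bbb u"
  shows "(\<Sum>T\<in>\<T>. (LINT x|lborel. indicator T x * osc R u x)) \<le> (LINT x|lborel. osc R u x)"
proof -
  define h where "h x = indicator (closure \<Omega>) x * osc R u x" for x
  have h: "integrable lborel h" unfolding h_def[abs_def]
    using integrable_mult_indicator[OF _ osc_energy(2)[OF u], of "closure \<Omega>" R] by (simp add: borel_closed)
  have "(\<Sum>T\<in>\<T>. (LINT x|lborel. indicator T x * osc R u x)) = (\<Sum>T\<in>\<T>. (LINT x|lborel. indicator T x * h x))"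
    using cell_subset by (intro sum.cong refl Bochner_Integration.integral_cong) (auto simp: h_def indicator_def)
  also have "\<dots> = (LINT x|lborel. h x)" by (rule integral_cells[symmetric, OF h]) (simp add: h_def)
  also have "\<dots> \<le> (LINT x|lborel. osc R u x)"
    using osc_nonneg[of R u] by (intro integral_mono h osc_energy(2)[OF u]) (auto simp: h_def indicator_def)
  finally show ?thesis .
qed

lemma energy_le_osc_coarse:
  assumes u: "u \<in> V" and R: "0 < R"
    and inb: "\<And>T. T \<in> \<T> \<Longrightarrow> \<exists>z r. cball z r \<subseteq> T \<and> R \<le> r / 2"
  shows "uball TYPE('a) / 4 ^ (DIM('a) + 2) / 2 ^ DIM('a) * R ^ (DIM('a) + 2) * energy u \<le> (LINT x|lborel. osc R u x)"
proof -
  define c where "c = uball TYPE('a) / 4 ^ (DIM('a) + 2) / 2 ^ DIM('a) * R ^ (DIM('a) + 2)"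
  have "c * energy u = (\<Sum>T\<in>\<T>. c * (measure lborel T * (norm (cell_grad u T))\<^sup>2))"
    by (simp add: energy_def sum_distrib_left)
  also have "\<dots> \<le> (\<Sum>T\<in>\<T>. (LINT x|lborel. indicator T x * osc R u x))"
  proof (rule sum_mono)
    fix T assume T: "T \<in> \<T>"
    then obtain z r where "cball z r \<subseteq> T" "R \<le> r / 2" using inb by blast
    then show "c * (measure lborel T * (norm (cell_grad u T))\<^sup>2) \<le> (LINT x|lborel. indicator T x * osc R u x)"
      unfolding c_def using osc_cell_lower[OF u T _ R] by blast
  qed
  also have "\<dots> \<le> (LINT x|lborel. osc R u x)" by (rule osc_sum_cells[OF fe_bbb[OF u]])
  finally show ?thesis by (simp add: c_def)
qed

section \<open>Fine meshes: cutoff and smoothing\<close>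

definition cutoff :: "real \<Rightarrow> 'a \<Rightarrow> real" where
  "cutoff \<delta> x = min 1 (infdist x (- \<Omega>) / \<delta>)"

lemma cutoff_bounds: "0 < \<delta> \<Longrightarrow> 0 \<le> cutoff \<delta> x" "cutoff \<delta> x \<le> 1"
  by (auto simp: cutoff_def infdist_nonneg)

lemma cutoff_zero: "x \<notin> \<Omega> \<Longrightarrow> cutoff \<delta> x = 0"
  by (simp add: cutoff_def)

lemma cutoff_lipschitz:
  assumes \<delta>: "0 < \<delta>"
  shows "\<bar>cutoff \<delta> x - cutoff \<delta> y\<bar> \<le> norm (x - y) / \<delta>"
proof -
  have "\<bar>min 1 a - min 1 b\<bar> \<le> \<bar>a - b\<bar>" for a b :: real by (auto simp: min_def)
  then have "\<bar>cutoff \<delta> x - cutoff \<delta> y\<bar> \<le> \<bar>infdist x (- \<Omega>) / \<delta> - infdist y (- \<Omega>) / \<delta>\<bar>"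
    unfolding cutoff_def .
  also have "\<dots> = \<bar>infdist x (- \<Omega>) - infdist y (- \<Omega>)\<bar> / \<delta>" using \<delta> by (simp add: diff_divide_distrib[symmetric])
  also have "\<dots> \<le> norm (x - y) / \<delta>"
    using \<delta> infdist_triangle_abs[of x "- \<Omega>" y] by (intro divide_right_mono) (auto simp: dist_norm)
  finally show ?thesis .
qed

text \<open>An average of \<open>u\<close> need not vanish at boundary vertices. With the cutoff it
  does, so that the interpolant has these values at all vertices of a cell and not only at the
  interior nodes.\<close>

definition interp_val :: "real \<Rightarrow> ('a \<Rightarrow> real) \<Rightarrow> 'a \<Rightarrow> real" where
  "interp_val \<delta> u x = cutoff \<delta> x * smooth \<delta> u x"

text \<open>Where the cutoff is active, \<open>z\<close> sees a fixed fraction of a ball outside \<open>\<Omega>\<close>, on which \<open>u\<close> vanishes.\<close>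

lemma strip_bound:
  assumes ext: "\<forall>x s. x \<in> frontier \<Omega> \<and> 0 < s \<and> s \<le> s\<^sub>0 \<longrightarrow> (\<exists>y. ball y (c * s) \<subseteq> ball x s - \<Omega>)"
    and c: "0 < c" and \<delta>: "0 < \<delta>" "\<delta> \<le> s\<^sub>0" and H: "0 \<le> H" and u: "u \<in> V"
    and p: "p \<in> closure \<Omega>" "cutoff \<delta> p < 1" and z: "norm (p - z) \<le> H * \<delta>"
  shows "(u z)\<^sup>2 \<le> 1 / (uball TYPE('a) * c ^ DIM('a)) * (osc ((H + 2) * \<delta>) u z / \<delta> ^ DIM('a))"
proof -
  have "infdist p (- \<Omega>) < \<delta>" using p(2) \<delta>(1) by (auto simp: cutoff_def min_def field_simps split: if_splits)
  then obtain x where x: "x \<in> frontier \<Omega>" "dist p x < \<delta>"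
    using near_frontier[OF p(1) _ dom_nonUNIV open_dom] by blast
  obtain y where y: "ball y (c * \<delta>) \<subseteq> ball x \<delta> - \<Omega>" using ext x(1) \<delta> by blast
  have "ball x \<delta> \<subseteq> ball z ((H + 2) * \<delta>)"
  proof
    fix w assume "w \<in> ball x \<delta>"
    then have "dist z w < norm (p - z) + \<delta> + \<delta>"
      using x(2) dist_triangle[of z w x] dist_triangle[of z x p] by (simp add: dist_norm norm_minus_commute)
    then show "w \<in> ball z ((H + 2) * \<delta>)" using z by (simp add: algebra_simps)
  qed
  then have "uball TYPE('a) * (c * \<delta>) ^ DIM('a) * (u z)\<^sup>2 \<le> osc ((H + 2) * \<delta>) u z"
    using y c \<delta> fe_zero[OF u] by (intro osc_zero_ball[OF fe_bbb[OF u], of _ y]) auto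
  moreover have "0 < uball TYPE('a) * (c * \<delta>) ^ DIM('a)" using c \<delta> uball_pos[where 'a = 'a] by simp
  ultimately have "(u z)\<^sup>2 \<le> osc ((H + 2) * \<delta>) u z / (uball TYPE('a) * (c * \<delta>) ^ DIM('a))"
    by (simp add: pos_le_divide_eq mult.commute)
  then show ?thesis by (simp add: power_mult_distrib)
qed

end

lemma square_add_le: "(a + b)\<^sup>2 \<le> 2 * a\<^sup>2 + 2 * (b::real)\<^sup>2"
  using zero_le_power2[of "a - b"] by (simp add: power2_eq_square algebra_simps)

text \<open>Both estimates of \<open>interp_val_bounds\<close> end with 2 C1 + 2 (2 C1 + 2 C2),
  where C1 comes from smoothing and C2 from the exterior ball.\<close>

definition interp_const :: "'a::euclidean_space itself \<Rightarrow> real \<Rightarrow> real \<Rightarrow> real" where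
  "interp_const _ c H = 6 * smooth_const TYPE('a) (H + 2) + 4 * (1 / (uball TYPE('a) * c ^ DIM('a)))"

lemma interp_const_nonneg: "0 < c \<Longrightarrow> 0 \<le> H \<Longrightarrow> 0 \<le> interp_const TYPE('a::euclidean_space) c H"
  unfolding interp_const_def using uball_pos[where 'a = 'a] smooth_const_nonneg[of "H + 2", where 'a = 'a] by simp

context fe_mesh
begin

text \<open>Where the cutoff equals 1, only smoothing errors occur. Where it is smaller,
  \<open>strip_bound\<close> makes \<open>u z\<close> small, hence also the average; removing a part
  of the average, or multiplying it by a variation of the cutoff, then costs no more than the
  smoothing error in order of magnitude.\<close>

lemma interp_val_bounds:
  assumes ext: "\<forall>x s. x \<in> frontier \<Omega> \<and> 0 < s \<and> s \<le> s\<^sub>0 \<longrightarrow> (\<exists>y. ball y (c * s) \<subseteq> ball x s - \<Omega>)"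
    and c: "0 < c" and \<delta>: "0 < \<delta>" "\<delta> \<le> s\<^sub>0" and H: "0 \<le> H" and u: "u \<in> V"
    and p: "p \<in> closure \<Omega>" "norm (p - z) \<le> H * \<delta>"
  shows "(interp_val \<delta> u p - u z)\<^sup>2 \<le> interp_const TYPE('a) c H * (osc ((H + 2) * \<delta>) u z / \<delta> ^ DIM('a))"
    and "p' \<in> closure \<Omega> \<Longrightarrow> norm (p' - z) \<le> H * \<delta> \<Longrightarrow>
      (interp_val \<delta> u p - interp_val \<delta> u p')\<^sup>2
        \<le> (norm (p - p') / \<delta>)\<^sup>2 * (interp_const TYPE('a) c H * (osc ((H + 2) * \<delta>) u z / \<delta> ^ DIM('a)))"
proof -
  define Q where "Q = osc ((H + 2) * \<delta>) u z / \<delta> ^ DIM('a)"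
  define C1 C2 where "C1 = smooth_const TYPE('a) (H + 2)" and "C2 = 1 / (uball TYPE('a) * c ^ DIM('a))"
  have Q: "0 \<le> Q" unfolding Q_def using \<delta> by (intro divide_nonneg_nonneg osc_nonneg) auto
  have C: "0 \<le> C1" "0 \<le> C2" using H c uball_pos[where 'a = 'a] by (auto simp: C1_def C2_def intro!: smooth_const_nonneg)
  note bu = fe_bbb[OF u]
  have S: "(smooth \<delta> u q - u z)\<^sup>2 \<le> C1 * Q" if "norm (q - z) \<le> H * \<delta>" for q
    using smooth_approx[OF \<delta>(1) bu, of "H + 2" q z] that H \<delta> by (simp add: C1_def Q_def algebra_simps)
  have Uz: "(u z)\<^sup>2 \<le> C2 * Q" if "cutoff \<delta> q < 1" "q \<in> closure \<Omega>" "norm (q - z) \<le> H * \<delta>" for q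
    using strip_bound[OF ext c \<delta> H u that(2,1,3)] by (simp add: C2_def Q_def)
  have SB: "(smooth \<delta> u q)\<^sup>2 \<le> 2 * (C1 * Q) + 2 * (C2 * Q)"
    if "(u z)\<^sup>2 \<le> C2 * Q" "norm (q - z) \<le> H * \<delta>" for q
    using square_add_le[of "smooth \<delta> u q - u z" "u z"] S[OF that(2)] that(1) by simp
  have "(interp_val \<delta> u p - u z)\<^sup>2 \<le> 2 * (C1 * Q) + 2 * (2 * (C1 * Q) + 2 * (C2 * Q))"
  proof (cases "cutoff \<delta> p < 1")
    case True
    have e: "interp_val \<delta> u p - u z = (smooth \<delta> u p - u z) + - ((1 - cutoff \<delta> p) * smooth \<delta> u p)"
      by (simp add: interp_val_def algebra_simps)
    have "(interp_val \<delta> u p - u z)\<^sup>2 \<le> 2 * (smooth \<delta> u p - u z)\<^sup>2 + 2 * ((1 - cutoff \<delta> p) * smooth \<delta> u p)\<^sup>2"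
      using square_add_le[of "smooth \<delta> u p - u z" "- ((1 - cutoff \<delta> p) * smooth \<delta> u p)"]
      unfolding e power2_minus .
    moreover have "((1 - cutoff \<delta> p) * smooth \<delta> u p)\<^sup>2 \<le> 1 * (smooth \<delta> u p)\<^sup>2"
      unfolding power_mult_distrib using cutoff_bounds(1)[OF \<delta>(1), of p] cutoff_bounds(2)[of \<delta> p]
      by (intro mult_right_mono power_le_one) auto
    ultimately show ?thesis using S[OF p(2)] SB[OF Uz[OF True p] p(2)] by argo
  next
    case False
    then have "cutoff \<delta> p = 1" using cutoff_bounds(2)[of \<delta> p] by simp
    then have e: "interp_val \<delta> u p = smooth \<delta> u p" by (simp add: interp_val_def)
    show ?thesis unfolding e using S[OF p(2)] mult_nonneg_nonneg[OF C(1) Q] mult_nonneg_nonneg[OF C(2) Q] by argo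
  qed
  then show "(interp_val \<delta> u p - u z)\<^sup>2 \<le> interp_const TYPE('a) c H * (osc ((H + 2) * \<delta>) u z / \<delta> ^ DIM('a))"
    unfolding interp_const_def C1_def[symmetric] C2_def[symmetric] Q_def[symmetric] by (simp add: algebra_simps)
  assume p': "p' \<in> closure \<Omega>" "norm (p' - z) \<le> H * \<delta>"
  define A where "A = (norm (p - p') / \<delta>)\<^sup>2"
  have sl: "(smooth \<delta> u p - smooth \<delta> u p')\<^sup>2 \<le> A * (C1 * Q)"
    using smooth_lipschitz[OF \<delta>(1) bu, of "H + 2" p z p'] p p' H \<delta> by (simp add: C1_def Q_def A_def algebra_simps)
  have "(interp_val \<delta> u p - interp_val \<delta> u p')
    = cutoff \<delta> p * (smooth \<delta> u p - smooth \<delta> u p') + (cutoff \<delta> p - cutoff \<delta> p') * smooth \<delta> u p'"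
    by (simp add: interp_val_def algebra_simps)
  then have "(interp_val \<delta> u p - interp_val \<delta> u p')\<^sup>2
    \<le> 2 * (cutoff \<delta> p * (smooth \<delta> u p - smooth \<delta> u p'))\<^sup>2 + 2 * ((cutoff \<delta> p - cutoff \<delta> p') * smooth \<delta> u p')\<^sup>2"
    using square_add_le by metis
  moreover have "(cutoff \<delta> p * (smooth \<delta> u p - smooth \<delta> u p'))\<^sup>2 \<le> A * (C1 * Q)"
  proof -
    have "(cutoff \<delta> p * (smooth \<delta> u p - smooth \<delta> u p'))\<^sup>2 \<le> 1 * (smooth \<delta> u p - smooth \<delta> u p')\<^sup>2"
      unfolding power_mult_distrib using cutoff_bounds(1)[OF \<delta>(1), of p] cutoff_bounds(2)[of \<delta> p]
      by (intro mult_right_mono power_le_one) auto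
    with sl show ?thesis by simp
  qed
  \<comment> \<open>If one of the two points lies in the strip, that point gives the bound on
    \<open>u z\<close>, which then controls the average at \<open>p'\<close>; otherwise both cutoffs
    are 1 and the term is zero.\<close>
  moreover have "((cutoff \<delta> p - cutoff \<delta> p') * smooth \<delta> u p')\<^sup>2 \<le> A * (2 * (C1 * Q) + 2 * (C2 * Q))"
  proof (cases "cutoff \<delta> p < 1 \<or> cutoff \<delta> p' < 1")
    case True
    then have "(u z)\<^sup>2 \<le> C2 * Q" using Uz p p' by blast
    note s = SB[OF this p'(2)]
    have "\<bar>cutoff \<delta> p - cutoff \<delta> p'\<bar>\<^sup>2 \<le> (norm (p - p') / \<delta>)\<^sup>2"
      by (intro power_mono cutoff_lipschitz \<delta>) simp
    then show ?thesis unfolding power_mult_distrib using s by (intro mult_mono) (auto simp: A_def)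
  next
    case False
    then have "cutoff \<delta> p = 1" "cutoff \<delta> p' = 1" using cutoff_bounds(2)[of \<delta> p] cutoff_bounds(2)[of \<delta> p'] by auto
    then show ?thesis using C Q by (simp add: A_def)
  qed
  ultimately have "(interp_val \<delta> u p - interp_val \<delta> u p')\<^sup>2 \<le> 2 * (A * (C1 * Q)) + 2 * (A * (2 * (C1 * Q) + 2 * (C2 * Q)))"
    by linarith
  then show "(interp_val \<delta> u p - interp_val \<delta> u p')\<^sup>2
        \<le> (norm (p - p') / \<delta>)\<^sup>2 * (interp_const TYPE('a) c H * (osc ((H + 2) * \<delta>) u z / \<delta> ^ DIM('a)))"
    unfolding interp_const_def C1_def[symmetric] C2_def[symmetric] Q_def[symmetric] A_def[symmetric]
    by (simp add: algebra_simps)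
qed

end

context fe_nodes
begin

text \<open>Values on a cell are convex combinations of vertex values. The free reference
  \<open>c\<close> serves both for errors against \<open>u z\<close> and for differences of two
  values of \<open>v\<close>.\<close>

lemma fe_near_vertices:
  assumes v: "v \<in> V" and T: "T \<in> \<T>" and x: "x \<in> T" and D: "\<And>q. q \<in> verts T \<Longrightarrow> \<bar>v q - c\<bar> \<le> D"
  shows "\<bar>v x - c\<bar> \<le> D"
proof -
  obtain b where b: "\<forall>q\<in>verts T. 0 \<le> b q" "sum b (verts T) = 1" "(\<Sum>q\<in>verts T. b q *\<^sub>R q) = x"
    using cell_convex_combination[OF T x] by blast
  have "v x - c = (\<Sum>q\<in>verts T. b q * v q) - (\<Sum>q\<in>verts T. b q) * c"
    using fe_convex_combination[OF v T b(2,3) x] b(2) by simp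
  also have "\<dots> = (\<Sum>q\<in>verts T. b q * (v q - c))"
    by (simp only: sum_distrib_right sum_subtractf[symmetric] right_diff_distrib)
  finally have "\<bar>v x - c\<bar> \<le> (\<Sum>q\<in>verts T. \<bar>b q * (v q - c)\<bar>)" by simp
  also have "\<dots> \<le> (\<Sum>q\<in>verts T. b q * D)"
    using b(1) D by (intro sum_mono) (auto simp: abs_mult intro: mult_left_mono)
  also have "\<dots> = D" by (simp add: sum_distrib_right[symmetric] b(2))
  finally show ?thesis .
qed

text \<open>Moving from the centre of an inscribed ball by \<open>r\<close> along the gradient stays
  in the cell and changes \<open>v\<close> by exactly \<open>r * norm (cell_grad v T)\<close>; two
  applications of \<open>fe_near_vertices\<close> compare this change with vertex
  differences.\<close>

lemma cell_grad_le:
  assumes v: "v \<in> V" and T: "T \<in> \<T>" and z: "0 < r" "cball z r \<subseteq> T"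
    and D: "\<And>q q'. q \<in> verts T \<Longrightarrow> q' \<in> verts T \<Longrightarrow> \<bar>v q - v q'\<bar> \<le> D"
  shows "r * norm (cell_grad v T) \<le> D"
proof -
  obtain e where e: "norm e = 1" "inner (cell_grad v T) e = norm (cell_grad v T)"
    using gradient_direction[of "cell_grad v T"] by blast
  have zT: "z \<in> T" "z + r *\<^sub>R e \<in> T" using z e by (auto simp: subset_iff dist_norm)
  have "\<bar>v (z + r *\<^sub>R e) - v q'\<bar> \<le> D" if "q' \<in> verts T" for q'
    using D that by (intro fe_near_vertices[OF v T zT(2)])
  then have "\<bar>v z - v (z + r *\<^sub>R e)\<bar> \<le> D"
    by (intro fe_near_vertices[OF v T zT(1)]) (simp add: abs_minus_commute)
  moreover have "v (z + r *\<^sub>R e) - v z = r * norm (cell_grad v T)"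
    using fe_diff[OF v T zT(2,1)] e by simp
  ultimately show ?thesis by linarith
qed

definition quasi_interp :: "real \<Rightarrow> (nat \<Rightarrow> real) \<Rightarrow> nat \<Rightarrow> real" where
  "quasi_interp \<delta> X i = interp_val \<delta> (comb X) (p i)"

lemma quasi_interp_vertex:
  assumes "T \<in> \<T>" "q \<in> verts T"
  shows "comb (quasi_interp \<delta> X) q = interp_val \<delta> (comb X) q"
proof (cases "q \<in> \<Omega>")
  case True
  then show ?thesis using vertex_node[OF assms True] by (auto simp: comb_node quasi_interp_def)
next
  case False
  then show ?thesis using fe_zero[OF comb_fe] cutoff_zero by (simp add: interp_val_def)
qed

text \<open>The gradient is constant on \<open>T\<close>, so it may be compared with the oscillation
  at any \<open>z\<close> in \<open>T\<close>. Doing this at every \<open>z\<close> makes the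
  estimate pointwise; integrating it over the cells then involves no overlapping patches.\<close>

lemma quasi_interp_cell:
  assumes ext: "\<forall>x s. x \<in> frontier \<Omega> \<and> 0 < s \<and> s \<le> s\<^sub>0 \<longrightarrow> (\<exists>y. ball y (c * s) \<subseteq> ball x s - \<Omega>)"
    and c: "0 < c" and \<delta>: "0 < \<delta>" "\<delta> \<le> s\<^sub>0" and H: "0 \<le> H"
    and sr: "shape_regular C\<^sub>s \<T>" and C: "C\<^sub>s \<le> C" "0 < C"
    and T: "T \<in> \<T>" "z \<in> T" and diam: "diameter T \<le> H * \<delta>"
  shows "(norm (cell_grad (comb (quasi_interp \<delta> X)) T))\<^sup>2 + (comb (quasi_interp \<delta> X) z - comb X z)\<^sup>2 / \<delta>\<^sup>2
    \<le> (16 * C\<^sup>2 + 1) * interp_const TYPE('a) c H / \<delta> ^ (DIM('a) + 2) * osc ((H + 2) * \<delta>) (comb X) z"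
proof -
  define u v where "u = comb X" and "v = comb (quasi_interp \<delta> X)"
  have u: "u \<in> V" and v: "v \<in> V" by (auto simp: u_def v_def comb_fe)
  define Q where "Q = interp_const TYPE('a) c H * (osc ((H + 2) * \<delta>) u z / \<delta> ^ DIM('a))"
  have Q: "0 \<le> Q" unfolding Q_def using \<delta> interp_const_nonneg[OF c H]
    by (intro divide_nonneg_nonneg mult_nonneg_nonneg osc_nonneg) auto
  have near: "norm (q - q') \<le> diameter T" if "q \<in> T" "q' \<in> T" for q q'
    using diameter_bounded_bound[OF cell_bounded[OF T(1)] that] by (simp add: dist_norm)
  have pv: "q \<in> closure \<Omega>" "norm (q - z) \<le> H * \<delta>" "q \<in> T" "v q = interp_val \<delta> u q" if "q \<in> verts T" for q
    using that verts_subset[of T] cell_subset[OF T(1)] near[of q z] T diam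
      quasi_interp_vertex[OF T(1) that] by (auto simp: u_def v_def)
  have "\<bar>v z - u z\<bar> \<le> sqrt Q"
  proof (rule fe_near_vertices[OF v T])
    fix q assume q: "q \<in> verts T"
    have "(v q - u z)\<^sup>2 \<le> Q" unfolding pv(4)[OF q] Q_def
      by (rule interp_val_bounds(1)[OF ext c \<delta> H u pv(1,2)[OF q]])
    then show "\<bar>v q - u z\<bar> \<le> sqrt Q" by (metis real_sqrt_abs real_sqrt_le_iff)
  qed
  then have "\<bar>v z - u z\<bar>\<^sup>2 \<le> (sqrt Q)\<^sup>2" by (rule power_mono) simp
  then have "(v z - u z)\<^sup>2 \<le> Q" using Q by simp
  then have 1: "(v z - u z)\<^sup>2 / \<delta>\<^sup>2 \<le> Q / \<delta>\<^sup>2" by (rule divide_right_mono) simp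
  obtain y r where y: "0 < r" "cball y r \<subseteq> T" "diameter T \<le> 4 * C * r"
    using cell_inball[OF T(1) sr C] by blast
  \<comment> \<open>Vertex differences are proportional to the diameter, which shape regularity
    bounds by \<open>4 * C * r\<close>. The radius \<open>r\<close> cancels, and with it the mesh
    size.\<close>
  have "r * norm (cell_grad v T) \<le> (4 * C * r) / \<delta> * sqrt Q"
  proof (rule cell_grad_le[OF v T(1) y(1,2)])
    fix q q' assume q: "q \<in> verts T" "q' \<in> verts T"
    have "(v q - v q')\<^sup>2 \<le> (norm (q - q') / \<delta>)\<^sup>2 * Q" unfolding pv(4)[OF q(1)] pv(4)[OF q(2)] Q_def
      by (rule interp_val_bounds(2)[OF ext c \<delta> H u pv(1,2)[OF q(1)] pv(1,2)[OF q(2)]])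
    then have "\<bar>v q - v q'\<bar> \<le> sqrt ((norm (q - q') / \<delta>)\<^sup>2 * Q)" by (metis real_sqrt_abs real_sqrt_le_iff)
    also have "\<dots> = norm (q - q') / \<delta> * sqrt Q" using \<delta> by (simp add: real_sqrt_mult)
    also have "\<dots> \<le> (4 * C * r) / \<delta> * sqrt Q"
      using near[OF pv(3)[OF q(1)] pv(3)[OF q(2)]] y(3) \<delta> Q by (intro mult_right_mono divide_right_mono) auto
    finally show "\<bar>v q - v q'\<bar> \<le> (4 * C * r) / \<delta> * sqrt Q" .
  qed
  also have "\<dots> = r * (4 * C / \<delta> * sqrt Q)" by simp
  finally have "norm (cell_grad v T) \<le> 4 * C / \<delta> * sqrt Q" by (rule mult_left_le_imp_le[OF _ y(1)])
  then have "(norm (cell_grad v T))\<^sup>2 \<le> (4 * C / \<delta> * sqrt Q)\<^sup>2" by (rule power_mono) simp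
  also have "\<dots> = 16 * C\<^sup>2 * Q / \<delta>\<^sup>2" using Q by (simp add: power_mult_distrib power_divide)
  finally have "(norm (cell_grad v T))\<^sup>2 + (v z - u z)\<^sup>2 / \<delta>\<^sup>2 \<le> 16 * C\<^sup>2 * Q / \<delta>\<^sup>2 + Q / \<delta>\<^sup>2" using 1 by (rule add_mono)
  also have "\<dots> = (16 * C\<^sup>2 + 1) * interp_const TYPE('a) c H / \<delta> ^ (DIM('a) + 2) * osc ((H + 2) * \<delta>) u z"
    by (simp add: Q_def power_add add_divide_distrib[symmetric] algebra_simps power2_eq_square)
  finally show ?thesis by (simp add: u_def v_def)
qed

lemma quasi_interp_bound:
  assumes ext: "\<forall>x s. x \<in> frontier \<Omega> \<and> 0 < s \<and> s \<le> s\<^sub>0 \<longrightarrow> (\<exists>y. ball y (c * s) \<subseteq> ball x s - \<Omega>)"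
    and c: "0 < c" and \<delta>: "0 < \<delta>" "\<delta> \<le> s\<^sub>0" and H: "0 \<le> H"
    and sr: "shape_regular C\<^sub>s \<T>" and C: "C\<^sub>s \<le> C" "0 < C"
    and diam: "\<And>T. T \<in> \<T> \<Longrightarrow> diameter T \<le> H * \<delta>"
  shows "energy (comb (quasi_interp \<delta> X)) + (LINT x|lborel. (comb (quasi_interp \<delta> X) x - comb X x)\<^sup>2) / \<delta>\<^sup>2
    \<le> (16 * C\<^sup>2 + 1) * interp_const TYPE('a) c H / \<delta> ^ (DIM('a) + 2) * (LINT z|lborel. osc ((H + 2) * \<delta>) (comb X) z)"
proof -
  define u v where "u = comb X" and "v = comb (quasi_interp \<delta> X)"
  have u: "u \<in> V" and v: "v \<in> V" by (auto simp: u_def v_def comb_fe)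
  define A where "A = (16 * C\<^sup>2 + 1) * interp_const TYPE('a) c H / \<delta> ^ (DIM('a) + 2)"
  have A: "0 \<le> A" using interp_const_nonneg[OF c H, where 'a = 'a] \<delta> by (simp add: A_def)
  define w where "w x = (v x - u x)\<^sup>2" for x
  have bw: "bbb w" unfolding w_def[abs_def] power2_eq_square by (intro bbb_mult bbb_diff fe_bbb u v)
  have "(LINT x|lborel. w x) = (\<Sum>T\<in>\<T>. (LINT x|lborel. indicator T x * w x))"
  proof (rule integral_cells[OF bbb_integrable[OF bw]])
    fix x assume "x \<notin> closure \<Omega>"
    then have "x \<notin> \<Omega>" using closure_subset by blast
    then show "w x = 0" using fe_zero[OF u] fe_zero[OF v] by (simp add: w_def)
  qed
  then have "energy v + (LINT x|lborel. w x) / \<delta>\<^sup>2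
    = (\<Sum>T\<in>\<T>. measure lborel T * (norm (cell_grad v T))\<^sup>2 + (LINT x|lborel. indicator T x * w x) / \<delta>\<^sup>2)"
    by (simp add: energy_def sum.distrib sum_divide_distrib)
  also have "\<dots> \<le> (\<Sum>T\<in>\<T>. A * (LINT x|lborel. indicator T x * osc ((H + 2) * \<delta>) u x))"
  proof (rule sum_mono)
    fix T assume T: "T \<in> \<T>"
    note iw = bbb_integrable[OF indicator_bbb_mult[OF bw cell_closed[OF T]]]
    have "measure lborel T * (norm (cell_grad v T))\<^sup>2 + (LINT x|lborel. indicator T x * w x) / \<delta>\<^sup>2
      = (LINT x|lborel. indicator T x * (norm (cell_grad v T))\<^sup>2 + (indicator T x * w x) / \<delta>\<^sup>2)"
    proof -
      have "(LINT x|lborel. indicator T x * (norm (cell_grad v T))\<^sup>2 + (indicator T x * w x) / \<delta>\<^sup>2)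
        = (LINT x|lborel. indicator T x * (norm (cell_grad v T))\<^sup>2) + (LINT x|lborel. (indicator T x * w x) / \<delta>\<^sup>2)"
        by (rule Bochner_Integration.integral_add[OF cell_indicator_integrable[OF T]]) (use iw in simp)
      then show ?thesis by simp
    qed
    also have "\<dots> \<le> (LINT x|lborel. A * (indicator T x * osc ((H + 2) * \<delta>) u x))"
    proof (rule integral_mono)
      show "integrable lborel (\<lambda>x. indicator T x * (norm (cell_grad v T))\<^sup>2 + (indicator T x * w x) / \<delta>\<^sup>2)"
        by (rule Bochner_Integration.integrable_add[OF cell_indicator_integrable[OF T]]) (use iw in simp)
      show "integrable lborel (\<lambda>x. A * (indicator T x * osc ((H + 2) * \<delta>) u x))"
        using integrable_mult_indicator[OF _ osc_energy(2)[OF fe_bbb[OF u]], of T "(H + 2) * \<delta>"] cell_closed[OF T]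
        by (simp add: borel_closed)
      show "indicator T x * (norm (cell_grad v T))\<^sup>2 + (indicator T x * w x) / \<delta>\<^sup>2
          \<le> A * (indicator T x * osc ((H + 2) * \<delta>) u x)" for x
        using quasi_interp_cell[OF ext c \<delta> H sr C T _ diam[OF T], of x X]
        by (cases "x \<in> T") (auto simp: u_def v_def w_def A_def)
    qed
    finally show "measure lborel T * (norm (cell_grad v T))\<^sup>2 + (LINT x|lborel. indicator T x * w x) / \<delta>\<^sup>2
      \<le> A * (LINT x|lborel. indicator T x * osc ((H + 2) * \<delta>) u x)" by simp
  qed
  also have "\<dots> = A * (\<Sum>T\<in>\<T>. (LINT x|lborel. indicator T x * osc ((H + 2) * \<delta>) u x))"
    by (simp add: sum_distrib_left)
  also have "\<dots> \<le> A * (LINT z|lborel. osc ((H + 2) * \<delta>) u z)"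
    by (intro mult_left_mono osc_sum_cells fe_bbb u A)
  finally show ?thesis by (simp add: u_def v_def w_def A_def)
qed

end

section \<open>Symmetric matrices\<close>

hide_const (open) Finite_Cartesian_Product.vec Finite_Cartesian_Product.mat Determinants.det
no_notation Inner_Product.real_inner_class.inner (infix \<open>\<bullet>\<close> 70)
no_notation Finite_Cartesian_Product.vec_nth (infixl \<open>$\<close> 90)

section \<open>Real spectra and principal square roots\<close>

lemma symmetric_scalar_prod:
  fixes A :: "real mat"
  assumes "A \<in> carrier_mat n n" "transpose_mat A = A" "x \<in> carrier_vec n" "y \<in> carrier_vec n"
  shows "x \<bullet> (A *\<^sub>v y) = (A *\<^sub>v x) \<bullet> y"
  using assms
  by (metis transpose_vec_mult_scalar comm_scalar_prod mult_mat_vec_carrier)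

lemma scalar_prod_self_nonneg: "0 \<le> x \<bullet> (x :: real vec)"
  by (simp add: scalar_prod_def sum_nonneg)

lemma scalar_prod_self_pos:
  fixes x :: "real vec"
  assumes "x \<in> carrier_vec n" "x \<noteq> 0\<^sub>v n"
  shows "0 < x \<bullet> x"
proof -
  obtain i where i: "i < n" "x $ i \<noteq> 0"
    using assms by (metis carrier_vecD eq_vecI index_zero_vec)
  have "(x $ i)\<^sup>2 \<le> x \<bullet> x"
    unfolding scalar_prod_def using i assms
    by (auto simp: power2_eq_square intro!: member_le_sum[where f = "\<lambda>i. x $ i * x $ i"])
  then show ?thesis using i by (smt (verit) zero_less_power2)
qed

text \<open>Let \<open>a\<close> and \<open>b\<close> be the real and imaginary parts of a complex
  eigenvector. Symmetry forces \<open>Im l * (a \<bullet> a + b \<bullet> b) = 0\<close>; once the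
  eigenvalue is real, whichever of \<open>a\<close> and \<open>b\<close> is nonzero is a real
  eigenvector.\<close>

lemma symmetric_complex_eigenvalue:
  fixes A :: "real mat"
  assumes A: "A \<in> carrier_mat n n" and sym: "transpose_mat A = A"
    and ev: "eigenvalue (map_mat complex_of_real A) l"
  shows "\<exists>x \<in> carrier_vec n. x \<noteq> 0\<^sub>v n \<and> A *\<^sub>v x = Re l \<cdot>\<^sub>v x \<and> Im l = 0"
proof -
  from ev A obtain w where w: "w \<in> carrier_vec n" "w \<noteq> 0\<^sub>v n"
    "map_mat complex_of_real A *\<^sub>v w = l \<cdot>\<^sub>v w"
    by (auto simp: eigenvalue_def eigenvector_def)
  define a where "a = map_vec Re w"
  define b where "b = map_vec Im w"
  have ab: "a \<in> carrier_vec n" "b \<in> carrier_vec n" using w by (auto simp: a_def b_def)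
  have comp: "(\<Sum>j<n. complex_of_real (A $$ (i,j)) * w $ j) = l * w $ i" if "i < n" for i
  proof -
    have "(map_mat complex_of_real A *\<^sub>v w) $ i = (l \<cdot>\<^sub>v w) $ i" by (simp only: w(3))
    then show ?thesis using that w(1) A by (simp add: scalar_prod_def lessThan_atLeast0)
  qed
  have Aa: "A *\<^sub>v a = Re l \<cdot>\<^sub>v a - Im l \<cdot>\<^sub>v b"
    using arg_cong[OF comp, of _ Re] A ab w
    by (intro eq_vecI) (auto simp: a_def b_def scalar_prod_def lessThan_atLeast0)
  have Ab: "A *\<^sub>v b = Re l \<cdot>\<^sub>v b + Im l \<cdot>\<^sub>v a"
    using arg_cong[OF comp, of _ Im] A ab w
    by (intro eq_vecI) (auto simp: a_def b_def scalar_prod_def lessThan_atLeast0)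
  have "a \<bullet> (A *\<^sub>v b) = (A *\<^sub>v a) \<bullet> b"
    by (rule symmetric_scalar_prod[OF A sym ab])
  then have "Im l * (a \<bullet> a + b \<bullet> b) = 0"
    using ab unfolding Aa Ab
    by (simp add: scalar_prod_add_distrib[of _ n] minus_scalar_prod_distrib[of _ n] algebra_simps)
  moreover have ne: "a \<noteq> 0\<^sub>v n \<or> b \<noteq> 0\<^sub>v n"
  proof (rule ccontr)
    assume "\<not> ?thesis"
    then have "\<And>i. i < n \<Longrightarrow> Re (w $ i) = 0 \<and> Im (w $ i) = 0"
      using w by (metis a_def b_def carrier_vecD index_map_vec(1) index_zero_vec(1))
    then have "w = 0\<^sub>v n" using w by (intro eq_vecI) (auto simp: complex_eq_iff)
    with w show False by simp
  qed
  then have "a \<bullet> a + b \<bullet> b > 0"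
    using ab scalar_prod_self_pos scalar_prod_self_nonneg
    by (metis add_nonneg_pos add_pos_nonneg)
  ultimately have im: "Im l = 0" by simp
  then have "A *\<^sub>v a = Re l \<cdot>\<^sub>v a" "A *\<^sub>v b = Re l \<cdot>\<^sub>v b"
    using Aa Ab ab by auto
  with ne ab im show ?thesis by blast
qed

lemma symmetric_eigenvector_exists:
  fixes A :: "real mat"
  assumes "A \<in> carrier_mat n n" "transpose_mat A = A" "0 < n"
  shows "\<exists>l. \<exists>x \<in> carrier_vec n. x \<noteq> 0\<^sub>v n \<and> A *\<^sub>v x = l \<cdot>\<^sub>v x"
proof -
  have "spectrum (map_mat complex_of_real A) \<noteq> {}"
    using assms by (intro spectrum_non_empty[of _ n]) auto
  then obtain l where "eigenvalue (map_mat complex_of_real A) l" by (auto simp: spectrum_def)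
  from symmetric_complex_eigenvalue[OF assms(1,2) this] show ?thesis by blast
qed

text \<open>The Householder reflection that exchanges \<open>v\<close> and the first unit vector. It
  is symmetric and its own inverse, so conjugation by it needs no separate transpose.\<close>

lemma householder_exists:
  fixes v :: "real vec"
  assumes v: "v \<in> carrier_vec n" and n: "0 < n" and v1: "v \<bullet> v = 1"
  shows "\<exists>Q \<in> carrier_mat n n. transpose_mat Q = Q \<and> Q * Q = 1\<^sub>m n \<and> Q *\<^sub>v unit_vec n 0 = v"
proof (cases "v = unit_vec n 0")
  case True
  then show ?thesis by (intro bexI[of _ "1\<^sub>m n"]) auto
next
  case False
  define w where "w = v - unit_vec n 0"
  have w: "w \<in> carrier_vec n" using v by (simp add: w_def)
  have wne: "w \<noteq> 0\<^sub>v n"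
  proof
    assume w0: "w = 0\<^sub>v n"
    have "v $ i - unit_vec n 0 $ i = 0" if "i < n" for i
    proof -
      have "v $ i - unit_vec n 0 $ i = w $ i" using that v by (simp add: w_def)
      also have "\<dots> = 0" using that by (simp add: w0)
      finally show ?thesis .
    qed
    then show False using False v by (metis carrier_vecD eq_vecI eq_iff_diff_eq_0 index_unit_vec(3))
  qed
  define s where "s = w \<bullet> w"
  have s: "0 < s" unfolding s_def by (rule scalar_prod_self_pos[OF w wne])
  \<comment> \<open>Since \<open>v\<close> has norm 1, the first entry of \<open>w\<close> is
    \<open>- s / 2\<close>, which is what makes the first column of the reflection equal to
    \<open>v\<close>.\<close>
  have s2: "s = 2 - 2 * v $ 0"
    using v n v1
    by (simp add: s_def w_def scalar_prod_minus_distrib[of _ n] minus_scalar_prod_distrib[of _ n] comm_scalar_prod[of _ n])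
  have sw: "(\<Sum>k<n. w $ k * w $ k) = s"
    using w by (simp add: s_def scalar_prod_def lessThan_atLeast0)
  define Q where "Q = Matrix.mat n n (\<lambda>(i,j). (if i = j then 1 else 0) - 2 / s * (w $ i * w $ j))"
  have Qc: "Q \<in> carrier_mat n n" by (simp add: Q_def)
  have t: "transpose_mat Q = Q" by (rule eq_matI) (auto simp: Q_def)
  have QQ: "Q * Q = 1\<^sub>m n"
  proof (rule eq_matI)
    fix i j assume ij: "i < dim_row (1\<^sub>m n :: real mat)" "j < dim_col (1\<^sub>m n :: real mat)"
    have "(Q * Q) $$ (i, j) = (\<Sum>k<n. Q $$ (i, k) * Q $$ (k, j))"
      using ij Qc by (simp add: scalar_prod_def lessThan_atLeast0)
    also have "\<dots> = (\<Sum>k<n. (if i = k then (if k = j then 1 else 0) else 0)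
        - (if i = k then 2 / s * (w $ k * w $ j) else 0) - (if k = j then 2 / s * (w $ i * w $ k) else 0)
        + 4 / s\<^sup>2 * (w $ i * w $ j) * (w $ k * w $ k))"
      using ij by (intro sum.cong) (auto simp: Q_def algebra_simps power2_eq_square)
    also have "\<dots> = (if i = j then 1 else 0) - 4 / s * (w $ i * w $ j) + 4 / s\<^sup>2 * (w $ i * w $ j) * s"
    proof -
      have "(\<Sum>k<n. 4 / s\<^sup>2 * (w $ i * w $ j) * (w $ k * w $ k)) = 4 / s\<^sup>2 * (w $ i * w $ j) * s"
        by (simp only: sum_distrib_left[symmetric] sw)
      then show ?thesis
        using ij by (simp only: sum.distrib sum_subtractf) (simp add: sum.delta sum.delta')
    qed
    also have "\<dots> = (1\<^sub>m n) $$ (i, j)"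
      using ij s by (simp add: power2_eq_square)
    finally show "(Q * Q) $$ (i, j) = (1\<^sub>m n) $$ (i, j)" .
  qed (use Qc in auto)
  have "Q *\<^sub>v unit_vec n 0 = v"
  proof (rule eq_vecI)
    fix i assume i: "i < dim_vec v"
    have "(Q *\<^sub>v unit_vec n 0) $ i = (if i = 0 then 1 else 0) - 2 / s * (w $ i * w $ 0)"
      using i v n by (simp add: Q_def)
    also have "w $ 0 = - s / 2" using s2 v n by (simp add: w_def)
    finally show "(Q *\<^sub>v unit_vec n 0) $ i = v $ i"
      using i v n s by (simp add: w_def)
  qed (use v Qc in auto)
  then show ?thesis using Qc t QQ by blast
qed

text \<open>Deflation: a reflection moves an eigenvector to the first coordinate, symmetry splits
  the conjugated matrix into the eigenvalue and a smaller block, and the roots of the two blocks are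
  conjugated back.\<close>

lemma psd_sqrt_exists:
  fixes B :: "real mat"
  assumes "B \<in> carrier_mat n n" "transpose_mat B = B" "\<And>x. x \<in> carrier_vec n \<Longrightarrow> 0 \<le> quad_form B x"
  shows "\<exists>S \<in> carrier_mat n n. transpose_mat S = S \<and> (\<forall>x\<in>carrier_vec n. 0 \<le> quad_form S x) \<and> S * S = B"
  using assms
proof (induction n arbitrary: B)
  case 0
  then show ?case by (intro bexI[of _ B]) auto
next
  case (Suc n)
  obtain l x where x: "x \<in> carrier_vec (Suc n)" "x \<noteq> 0\<^sub>v (Suc n)" "B *\<^sub>v x = l \<cdot>\<^sub>v x"
    using symmetric_eigenvector_exists[OF Suc.prems(1,2)] by auto
  define v where "v = (1 / sqrt (x \<bullet> x)) \<cdot>\<^sub>v x"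
  have xx: "x \<bullet> x > 0" by (rule scalar_prod_self_pos[OF x(1,2)])
  have v: "v \<in> carrier_vec (Suc n)" using x by (simp add: v_def)
  have v1: "v \<bullet> v = 1" using x xx by (simp add: v_def)
  have Bv: "B *\<^sub>v v = l \<cdot>\<^sub>v v"
    using x Suc.prems(1) by (simp add: v_def mult_mat_vec[of _ "Suc n"] smult_smult_assoc mult.commute)
  have l: "0 \<le> l"
    using Suc.prems(3)[OF v] v v1 by (simp add: quad_form_def Bv)
  obtain Q where Q: "Q \<in> carrier_mat (Suc n) (Suc n)" "transpose_mat Q = Q" "Q * Q = 1\<^sub>m (Suc n)"
    "Q *\<^sub>v unit_vec (Suc n) 0 = v"
    using householder_exists[OF v _ v1] by auto
  define C where "C = Q * B * Q"
  have C: "C \<in> carrier_mat (Suc n) (Suc n)" using Q Suc.prems by (simp add: C_def)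
  have Ct: "transpose_mat C = C"
    using Q Suc.prems by (simp add: C_def transpose_mult[of _ "Suc n" "Suc n" _ "Suc n"] assoc_mult_mat[of _ "Suc n" "Suc n" _ "Suc n" _ "Suc n"])
  have Qv: "Q *\<^sub>v v = unit_vec (Suc n) 0"
    using Q(1,3) by (simp add: Q(4)[symmetric] assoc_mult_mat_vec[symmetric, of _ "Suc n" "Suc n"])
  have Ce: "C *\<^sub>v unit_vec (Suc n) 0 = l \<cdot>\<^sub>v unit_vec (Suc n) 0"
    using Q Suc.prems(1) v
    by (simp add: C_def assoc_mult_mat_vec[of _ "Suc n" "Suc n" _ "Suc n"] Bv mult_mat_vec[of _ "Suc n"] Qv)
  have C0: "C $$ (i, 0) = (if i = 0 then l else 0)" if "i < Suc n" for i
  proof -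
    have "C $$ (i, 0) = (C *\<^sub>v unit_vec (Suc n) 0) $ i" using C that by simp
    then show ?thesis using that by (simp add: Ce)
  qed
  have C0': "C $$ (0, i) = (if i = 0 then l else 0)" if "i < Suc n" for i
    using C0[OF that] C that by (metis Ct carrier_matD index_transpose_mat(1) zero_less_Suc)
  define C' where "C' = Matrix.mat n n (\<lambda>(i,j). C $$ (Suc i, Suc j))"
  have C'c: "C' \<in> carrier_mat n n" by (simp add: C'_def)
  have Cb: "C = four_block_mat (Matrix.mat 1 1 (\<lambda>_. l)) (0\<^sub>m 1 n) (0\<^sub>m n 1) C'"
    by (rule eq_matI) (use C in \<open>auto simp: C'_def C0 C0' four_block_mat_def Let_def\<close>)
  have C't: "transpose_mat C' = C'"
    by (rule eq_matI)
      (use C in \<open>auto simp: C'_def, metis Ct Suc_mono carrier_matD index_transpose_mat(1)\<close>)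
  have Cpos: "0 \<le> quad_form C y" if y: "y \<in> carrier_vec (Suc n)" for y
  proof -
    have "quad_form C y = quad_form B (Q *\<^sub>v y)"
      using y Q Suc.prems(1) symmetric_scalar_prod[OF Q(1,2), of y "B *\<^sub>v (Q *\<^sub>v y)"]
      by (simp add: quad_form_def C_def assoc_mult_mat_vec[of _ "Suc n" "Suc n" _ "Suc n"])
    then show ?thesis using Suc.prems(3)[of "Q *\<^sub>v y"] Q y by simp
  qed
  have block_quad: "quad_form (four_block_mat (Matrix.mat 1 1 (\<lambda>_. a)) (0\<^sub>m 1 n) (0\<^sub>m n 1) D) y
      = a * (y $ 0)\<^sup>2 + quad_form D (vec n (\<lambda>i. y $ Suc i))"
    if "y \<in> carrier_vec (Suc n)" "D \<in> carrier_mat n n" for a y and D :: "real mat"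
    using that
    by (auto simp: quad_form_def scalar_prod_def four_block_mat_def Let_def sum.atLeast0_lessThan_Suc_shift power2_eq_square
        simp del: sum.op_ivl_Suc)
  have "0 \<le> quad_form C' y" if y: "y \<in> carrier_vec n" for y
  proof -
    define z where "z = vec (Suc n) (\<lambda>i. if i = 0 then 0 else y $ (i - 1))"
    have "vec n (\<lambda>i. z $ Suc i) = y" using y by (auto simp: z_def)
    then have "quad_form C z = quad_form C' y"
      unfolding Cb using C'c by (subst block_quad) (auto simp: z_def)
    then show ?thesis using Cpos[of z] by (simp add: z_def)
  qed
  from Suc.IH[OF C'c C't this] obtain S' where S': "S' \<in> carrier_mat n n" "transpose_mat S' = S'"
    "\<forall>x\<in>carrier_vec n. 0 \<le> quad_form S' x" "S' * S' = C'" by blast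
  define T where "T = four_block_mat (Matrix.mat 1 1 (\<lambda>_. sqrt l)) (0\<^sub>m 1 n) (0\<^sub>m n 1) S'"
  have T: "T \<in> carrier_mat (Suc n) (Suc n)" using S' by (simp add: T_def four_block_carrier_mat[of _ 1 1 _ n n, simplified])
  have Tt: "transpose_mat T = T"
    unfolding T_def using S'
    by (subst transpose_four_block_mat[of _ 1 1 _ n _ n]) (auto intro!: cong_four_block_mat eq_matI)
  have TT: "T * T = C"
    unfolding T_def Cb using S' l
    by (subst mult_four_block_mat[of _ 1 1 _ n _ n _ _ 1 _ n])
       (auto intro!: cong_four_block_mat eq_matI simp: scalar_prod_def)
  have Tpos: "0 \<le> quad_form T y" if "y \<in> carrier_vec (Suc n)" for y
    unfolding T_def using that S' l by (subst block_quad) auto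
  define S where "S = Q * T * Q"
  have S: "S \<in> carrier_mat (Suc n) (Suc n)" using Q T by (simp add: S_def)
  have St: "transpose_mat S = S"
    using Q T Tt by (simp add: S_def transpose_mult[of _ "Suc n" "Suc n" _ "Suc n"] assoc_mult_mat[of _ "Suc n" "Suc n" _ "Suc n" _ "Suc n"])
  have QQ: "Q * (Q * Z) = Z" if "Z \<in> carrier_mat (Suc n) (Suc n)" for Z
    using Q that by (metis assoc_mult_mat left_mult_one_mat)
  have SS: "S * S = B"
  proof -
    have "S * S = Q * (T * T) * Q"
      using Q T QQ[of "T * Q"] by (simp add: S_def assoc_mult_mat[of _ "Suc n" "Suc n" _ "Suc n" _ "Suc n"])
    also have "\<dots> = Q * (Q * (B * (Q * Q)))"
      unfolding TT C_def using Q(1) Suc.prems(1) by (simp add: assoc_mult_mat[of _ "Suc n" "Suc n" _ "Suc n" _ "Suc n"])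
    also have "\<dots> = B" using Q Suc.prems(1) QQ[of B] by simp
    finally show ?thesis .
  qed
  have "0 \<le> quad_form S y" if y: "y \<in> carrier_vec (Suc n)" for y
  proof -
    have "quad_form S y = quad_form T (Q *\<^sub>v y)"
      using y Q T symmetric_scalar_prod[OF Q(1,2), of y "T *\<^sub>v (Q *\<^sub>v y)"]
      by (simp add: quad_form_def S_def assoc_mult_mat_vec[of _ "Suc n" "Suc n" _ "Suc n"])
    then show ?thesis using Tpos[of "Q *\<^sub>v y"] Q y by simp
  qed
  then show ?case using S St SS by blast
qed

lemma psd_cauchy_schwarz:
  fixes M :: "real mat"
  assumes M: "M \<in> carrier_mat n n" "transpose_mat M = M"
    and pos: "\<forall>x\<in>carrier_vec n. 0 \<le> quad_form M x"
    and x: "x \<in> carrier_vec n" and y: "y \<in> carrier_vec n"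
  shows "(x \<bullet> (M *\<^sub>v y))\<^sup>2 \<le> quad_form M x * quad_form M y"
proof -
  define a b c where "a = quad_form M x" and "b = x \<bullet> (M *\<^sub>v y)" and "c = quad_form M y"
  have c: "0 \<le> c" using pos y by (simp add: c_def)
  have yx: "y \<bullet> (M *\<^sub>v x) = b"
    unfolding b_def using symmetric_scalar_prod[OF M x y] M x y
    by (metis comm_scalar_prod mult_mat_vec_carrier)
  have q: "0 \<le> a + 2 * t * b + t\<^sup>2 * c" for t
  proof -
    have "quad_form M (x + t \<cdot>\<^sub>v y) = a + 2 * t * b + t\<^sup>2 * c"
      using M x y yx
      by (simp add: quad_form_def a_def b_def c_def mult_add_distrib_mat_vec[of _ n n] mult_mat_vec[of _ n n]
          scalar_prod_add_distrib[of _ n] add_scalar_prod_distrib[of _ n] algebra_simps power2_eq_square)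
    moreover have "x + t \<cdot>\<^sub>v y \<in> carrier_vec n" using x y by simp
    ultimately show ?thesis using pos by metis
  qed
  have "b\<^sup>2 \<le> a * c"
  proof (cases "c = 0")
    case True
    have "b = 0"
    proof (rule ccontr)
      assume b: "b \<noteq> 0"
      \<comment> \<open>For \<open>c = 0\<close> the quadratic in \<open>t\<close> is affine and
        would take the value -1 at this \<open>t\<close>.\<close>
      have "a + 2 * (- (a + 1) / (2 * b)) * b = -1" using b by (simp add: field_simps)
      with q[of "- (a + 1) / (2 * b)"] True show False by simp
    qed
    then show ?thesis using True by simp
  next
    case False
    then have "c > 0" using c by simp
    then show ?thesis using q[of "- b / c"] by (simp add: field_simps power2_eq_square)
  qed
  then show ?thesis by (simp add: a_def b_def c_def)
qed

lemma mat_inv_inverse: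
  fixes A :: "real mat"
  assumes A: "A \<in> carrier_mat n n" and inj: "\<forall>x\<in>carrier_vec n. A *\<^sub>v x = 0\<^sub>v n \<longrightarrow> x = 0\<^sub>v n"
  shows "mat_inv A \<in> carrier_mat n n" "A * mat_inv A = 1\<^sub>m n" "mat_inv A * A = 1\<^sub>m n"
proof -
  have "det A \<noteq> 0" using det_0_iff_vec_prod_zero[OF A] inj by auto
  then have "A \<in> Units (ring_mat TYPE(real) n ())" using det_non_zero_imp_unit[OF A] by auto
  then obtain B where "mat_inverse A = Some B" using mat_inverse(1)[OF A, where b = "()"] by force
  with mat_inverse(2)[OF A this]
  show "mat_inv A \<in> carrier_mat n n" "A * mat_inv A = 1\<^sub>m n" "mat_inv A * A = 1\<^sub>m n" by auto
qed

lemma inverse_symmetric: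
  fixes A :: "real mat"
  assumes A: "A \<in> carrier_mat n n" "transpose_mat A = A" and B: "B \<in> carrier_mat n n" "A * B = 1\<^sub>m n" "B * A = 1\<^sub>m n"
  shows "transpose_mat B = B"
proof -
  have "transpose_mat B * A = 1\<^sub>m n"
    using transpose_mult[OF A(1) B(1)] A B by simp
  then have "transpose_mat B * (A * B) = B"
    using A B by (metis assoc_mult_mat left_mult_one_mat transpose_carrier_mat)
  then show ?thesis using B by simp
qed

lemma quad_form_pos_injective:
  fixes A :: "real mat"
  assumes "\<forall>x\<in>carrier_vec n. x \<noteq> 0\<^sub>v n \<longrightarrow> 0 < quad_form A x"
  shows "\<forall>x\<in>carrier_vec n. A *\<^sub>v x = 0\<^sub>v n \<longrightarrow> x = 0\<^sub>v n"
  using assms by (force simp: quad_form_def)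

lemma trace_mult_comm:
  fixes A B :: "real mat"
  assumes "A \<in> carrier_mat n n" "B \<in> carrier_mat n n"
  shows "(\<Sum>i<n. (A * B) $$ (i,i)) = (\<Sum>i<n. (B * A) $$ (i,i))"
proof -
  have "(\<Sum>i<n. (A * B) $$ (i,i)) = (\<Sum>i<n. \<Sum>k<n. A $$ (i,k) * B $$ (k,i))"
    using assms by (simp add: scalar_prod_def lessThan_atLeast0)
  also have "\<dots> = (\<Sum>k<n. \<Sum>i<n. B $$ (k,i) * A $$ (i,k))"
    by (subst sum.swap) (simp add: mult.commute)
  also have "\<dots> = (\<Sum>i<n. (B * A) $$ (i,i))"
    using assms by (simp add: scalar_prod_def lessThan_atLeast0)
  finally show ?thesis .
qed

lemma diag_conjugate:
  fixes D S :: "real mat"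
  assumes "D \<in> carrier_mat n n" "transpose_mat D = D" "S \<in> carrier_mat n n" "i < n"
  shows "(D * (S * D)) $$ (i,i) = quad_form S (col D i)"
proof -
  have "row D i = col D i" using assms by (metis carrier_matD(2) row_transpose)
  moreover have "col (S * D) i = S *\<^sub>v col D i" using assms by (intro col_mult2) auto
  ultimately show ?thesis using assms by (simp add: quad_form_def)
qed

text \<open>With \<open>D = S - T\<close>, the equation \<open>S D + D T = 0\<close> makes the nonnegative traces of \<open>D S D\<close> and \<open>D T D\<close> sum to zero.\<close>

lemma psd_sqrt_unique:
  fixes S T :: "real mat"
  assumes S: "S \<in> carrier_mat n n" "transpose_mat S = S" "\<forall>x\<in>carrier_vec n. 0 \<le> quad_form S x"
    and T: "T \<in> carrier_mat n n" "transpose_mat T = T" "\<forall>x\<in>carrier_vec n. 0 \<le> quad_form T x"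
    and eq: "S * S = T * T"
    and pd: "\<forall>x\<in>carrier_vec n. x \<noteq> 0\<^sub>v n \<longrightarrow> 0 < quad_form (S * S) x"
  shows "S = T"
proof -
  define D where "D = S - T"
  have D: "D \<in> carrier_mat n n" using S T by (auto simp: D_def)
  have Dt: "transpose_mat D = D" using S T by (simp add: D_def transpose_minus[of _ n n])
  have cancel: "A - B + (B - C) = A - C"
    if "A \<in> carrier_mat n n" "B \<in> carrier_mat n n" "C \<in> carrier_mat n n" for A B C :: "real mat"
    by (rule eq_matI) (use that in auto)
  have "S * D + D * T = S * S - S * T + (S * T - T * T)"
    using S T by (simp add: D_def mult_minus_distrib_mat[of _ n n] minus_mult_distrib_mat[of _ n n])
  also have "\<dots> = S * S - T * T" using S T by (intro cancel) auto
  also have "\<dots> = 0\<^sub>m n n" using S T eq by auto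
  finally have z: "S * D + D * T = 0\<^sub>m n n" .
  have "D * (S * D) + D * (D * T) = D * (S * D + D * T)"
    using S T D by (simp add: mult_add_distrib_mat[of _ n n _ n])
  then have z2: "D * (S * D) + D * (D * T) = 0\<^sub>m n n" using D by (simp add: z)
  have "(\<Sum>i<n. (D * (S * D)) $$ (i,i)) + (\<Sum>i<n. (D * (D * T)) $$ (i,i)) = 0"
  proof -
    have "(D * (S * D)) $$ (i,i) + (D * (D * T)) $$ (i,i) = 0" if "i < n" for i
      using arg_cong[OF z2, of "\<lambda>M. M $$ (i,i)"] that S T D by simp
    then show ?thesis by (simp add: sum.distrib[symmetric])
  qed
  also have "(\<Sum>i<n. (D * (D * T)) $$ (i,i)) = (\<Sum>i<n. (D * (T * D)) $$ (i,i))"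
    using trace_mult_comm[of D n "D * T"] S T D by (simp add: assoc_mult_mat[of _ n n _ n _ n])
  also have "(\<Sum>i<n. (D * (T * D)) $$ (i,i)) = (\<Sum>i<n. quad_form T (col D i))"
    by (intro sum.cong refl diag_conjugate[OF D Dt T(1)]) simp
  also have "(\<Sum>i<n. (D * (S * D)) $$ (i,i)) = (\<Sum>i<n. quad_form S (col D i))"
    by (intro sum.cong refl diag_conjugate[OF D Dt S(1)]) simp
  finally have "(\<Sum>i<n. quad_form S (col D i) + quad_form T (col D i)) = 0"
    by (simp only: sum.distrib)
  then have 0: "quad_form S (col D i) = 0" if "i < n" for i
    using that S(3) T(3) D
    by (subst (asm) sum_nonneg_eq_0_iff) (auto intro!: add_nonneg_nonneg simp: add_nonneg_eq_0_iff)
  have "col D i = 0\<^sub>v n" if i: "i < n" for i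
  proof -
    define y where "y = col D i"
    have y: "y \<in> carrier_vec n" using D i by (auto simp: y_def)
    \<comment> \<open>A vanishing \<open>quad_form S y\<close> passes to \<open>S * S\<close> by
      Cauchy-Schwarz for \<open>S\<close>, and \<open>S * S\<close> is positive definite; this
      removes every column of \<open>D\<close>.\<close>
    have "(y \<bullet> (S *\<^sub>v (S *\<^sub>v y)))\<^sup>2 \<le> 0"
      using psd_cauchy_schwarz[OF S y, of "S *\<^sub>v y"] 0[OF i] S(1) y by (simp add: y_def)
    then have "quad_form (S * S) y = 0"
      using S y by (simp add: quad_form_def assoc_mult_mat_vec[of _ n n _ n])
    then show ?thesis using pd y by (auto simp: y_def)
  qed
  then have "D $$ (i,j) = 0" if "i < n" "j < n" for i j
    using that D by (metis carrier_matD index_col index_zero_vec(1))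
  then have "S $$ (i,j) = T $$ (i,j)" if "i < n" "j < n" for i j
    using that S T by (simp add: D_def)
  then show ?thesis using S T by (intro eq_matI) auto
qed

lemma mat_sqrt_properties:
  fixes B :: "real mat"
  assumes B: "B \<in> carrier_mat n n" "transpose_mat B = B"
    and pd: "\<forall>x\<in>carrier_vec n. x \<noteq> 0\<^sub>v n \<longrightarrow> 0 < quad_form B x"
  shows "mat_sqrt B \<in> carrier_mat n n" "transpose_mat (mat_sqrt B) = mat_sqrt B"
    "mat_sqrt B * mat_sqrt B = B"
proof -
  have psd: "0 \<le> quad_form B x" if "x \<in> carrier_vec n" for x
    using pd that B(1) by (cases "x = 0\<^sub>v n") (auto simp: quad_form_def less_imp_le)
  let ?P = "\<lambda>S. S \<in> carrier_mat (dim_row B) (dim_row B) \<and> transpose_mat S = S \<and>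
     (\<forall>X\<in>carrier_vec (dim_row B). 0 \<le> quad_form S X) \<and> S * S = B"
  obtain S where S: "?P S" using psd_sqrt_exists[OF B psd] B by auto
  have uniq: "T = S" if "?P S" "?P T" for S T
  proof (rule psd_sqrt_unique)
    show "T \<in> carrier_mat n n" "S \<in> carrier_mat n n" "transpose_mat T = T" "transpose_mat S = S" "T * T = S * S"
      using that B(1) by auto
    show "\<forall>x\<in>carrier_vec n. 0 \<le> quad_form T x" "\<forall>x\<in>carrier_vec n. 0 \<le> quad_form S x"
      using that B(1) by auto
    show "\<forall>x\<in>carrier_vec n. x \<noteq> 0\<^sub>v n \<longrightarrow> 0 < quad_form (T * T) x"
      using that pd by simp
  qed
  have "?P (mat_sqrt B)" unfolding mat_sqrt_def
    by (rule theI[of ?P, OF S]) (rule uniq[OF S])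
  then show "mat_sqrt B \<in> carrier_mat n n" "transpose_mat (mat_sqrt B) = mat_sqrt B"
    "mat_sqrt B * mat_sqrt B = B" using B by auto
qed

text \<open>For an eigenvector \<open>x\<close> of \<open>X\<close> let
  \<open>R *\<^sub>v y = x\<close>; then \<open>B *\<^sub>v y = R *\<^sub>v x\<close>, so the
  eigenvalue is the quotient of \<open>quad_form A (B *\<^sub>v y)\<close> by
  \<open>quad_form B y\<close>. The hypotheses can therefore be stated without the square
  root.\<close>

lemma preconditioned_spectrum:
  fixes A B :: "real mat"
  assumes A: "A \<in> carrier_mat n n" "transpose_mat A = A"
    and B: "B \<in> carrier_mat n n" "transpose_mat B = B"
    and pd: "\<forall>x\<in>carrier_vec n. x \<noteq> 0\<^sub>v n \<longrightarrow> 0 < quad_form B x"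
    and c: "0 < c"
    and lower: "\<And>x. x \<in> carrier_vec n \<Longrightarrow> c * quad_form B x \<le> quad_form A (B *\<^sub>v x)"
    and upper: "\<And>x. x \<in> carrier_vec n \<Longrightarrow> quad_form A (B *\<^sub>v x) \<le> C * quad_form B x"
  defines "X \<equiv> mat_sqrt B * A * mat_sqrt B"
  shows "spectrum (map_mat complex_of_real X) \<subseteq> complex_of_real ` {c..C}"
    and "0 < n \<Longrightarrow> spectral_cond X \<le> C / c"
proof -
  define R where "R = mat_sqrt B"
  have R: "R \<in> carrier_mat n n" "transpose_mat R = R" "R * R = B"
    unfolding R_def using mat_sqrt_properties[OF B pd] by auto
  have X: "X \<in> carrier_mat n n" using R A by (simp add: X_def R_def)
  have Xt: "transpose_mat X = X"
  proof -
    have "transpose_mat (R * A * R) = transpose_mat R * transpose_mat (R * A)"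
      by (rule transpose_mult) (use R(1) A(1) in auto)
    also have "transpose_mat (R * A) = transpose_mat A * transpose_mat R"
      by (rule transpose_mult) (use R(1) A(1) in auto)
    also have "transpose_mat R * (transpose_mat A * transpose_mat R) = R * A * R"
      unfolding R(2) A(2) by (rule assoc_mult_mat[symmetric]) (use R(1) A(1) in auto)
    finally show ?thesis by (simp add: X_def R_def)
  qed
  have Rinj: "\<forall>x\<in>carrier_vec n. R *\<^sub>v x = 0\<^sub>v n \<longrightarrow> x = 0\<^sub>v n"
  proof (intro ballI impI)
    fix x :: "real Matrix.vec" assume that: "x \<in> carrier_vec n" "R *\<^sub>v x = 0\<^sub>v n"
    have "B *\<^sub>v x = R *\<^sub>v (R *\<^sub>v x)" unfolding R(3)[symmetric] using R that by (intro assoc_mult_mat_vec) auto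
    also have "\<dots> = 0\<^sub>v n" using R that by auto
    finally show "x = 0\<^sub>v n" using quad_form_pos_injective[OF pd] that by blast
  qed
  have ev: "c \<le> l \<and> l \<le> C" if x: "x \<in> carrier_vec n" "x \<noteq> 0\<^sub>v n" "X *\<^sub>v x = l \<cdot>\<^sub>v x" for l x
  proof -
    define y where "y = mat_inv R *\<^sub>v x"
    have y: "y \<in> carrier_vec n" using mat_inv_inverse(1)[OF R(1) Rinj] x by (auto simp: y_def)
    have Ry: "R *\<^sub>v y = x"
      using mat_inv_inverse[OF R(1) Rinj] R x
      by (simp add: y_def assoc_mult_mat_vec[symmetric, of _ n n _ n])
    have By: "B *\<^sub>v y = R *\<^sub>v x"
      unfolding R(3)[symmetric] using R(1) y by (simp add: assoc_mult_mat_vec[of _ n n _ n] Ry)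
    have "x \<bullet> x = x \<bullet> (R *\<^sub>v y)" by (simp add: Ry)
    also have "\<dots> = (R *\<^sub>v x) \<bullet> y" by (rule symmetric_scalar_prod[OF R(1,2) x(1) y])
    also have "\<dots> = quad_form B y"
      using R x y by (simp add: quad_form_def By comm_scalar_prod[of _ n])
    finally have xx: "x \<bullet> x = quad_form B y" .
    have "l * (x \<bullet> x) = x \<bullet> (X *\<^sub>v x)" using x by simp
    also have "\<dots> = x \<bullet> (R *\<^sub>v (A *\<^sub>v (R *\<^sub>v x)))"
      using R A x by (simp add: X_def R_def[symmetric] assoc_mult_mat_vec[of _ n n _ n])
    also have "\<dots> = (R *\<^sub>v x) \<bullet> (A *\<^sub>v (R *\<^sub>v x))"
      using R A x by (intro symmetric_scalar_prod) auto
    also have "\<dots> = quad_form A (B *\<^sub>v y)" by (simp add: quad_form_def By)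
    finally have "l * (x \<bullet> x) = quad_form A (B *\<^sub>v y)" .
    moreover have "0 < x \<bullet> x" using scalar_prod_self_pos[OF x(1,2)] .
    ultimately show ?thesis using lower[OF y] upper[OF y]
      unfolding xx[symmetric] by (metis mult_le_cancel_right_pos)
  qed
  show "spectrum (map_mat complex_of_real X) \<subseteq> complex_of_real ` {c..C}"
  proof
    fix l assume "l \<in> spectrum (map_mat complex_of_real X)"
    then obtain x where x: "x \<in> carrier_vec n" "x \<noteq> 0\<^sub>v n" "X *\<^sub>v x = Re l \<cdot>\<^sub>v x" "Im l = 0"
      using symmetric_complex_eigenvalue[OF X Xt] by (auto simp: spectrum_def)
    then have "l = complex_of_real (Re l)" by (simp add: complex_eq_iff)
    with ev[OF x(1-3)] show "l \<in> complex_of_real ` {c..C}" by (metis atLeastAtMost_iff imageI)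
  qed
  have sp: "spectrum X \<subseteq> {c..C}"
    using ev X by (auto simp: spectrum_def eigenvalue_def eigenvector_def)
  have fin: "finite (spectrum X)" by (rule card_finite_spectrum[OF X])
  show "spectral_cond X \<le> C / c" if n: "0 < n"
  proof -
    have "spectrum X \<noteq> {}"
      using symmetric_eigenvector_exists[OF X Xt n] X
      by (auto simp: spectrum_def eigenvalue_def eigenvector_def)
    then have "Max (spectrum X) \<in> {c..C}" "Min (spectrum X) \<in> {c..C}"
      using Max_in[OF fin] Min_in[OF fin] sp by blast+
    then show ?thesis unfolding spectral_cond_def using c by (intro frac_le) auto
  qed
qed

text \<open>The additive Schwarz argument. Upper bound: \<open>B *\<^sub>v x\<close> is the sum of
  its \<open>G\<close> part and its \<open>D\<close> part, and the parallelogram law for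
  \<open>A\<close> separates them at the cost of a factor 2. Lower bound: for
  \<open>y = B *\<^sub>v x\<close> split by \<open>dec\<close>, \<open>quad_form B x\<close> is
  \<open>x \<bullet> v + x \<bullet> w\<close>, and Cauchy-Schwarz pairs \<open>K\<close> and
  \<open>D\<close> with their inverses, whose forms at \<open>x\<close> are bounded by that of
  \<open>B\<close> up to the factors \<open>1 / c\<^sub>G\<close> and
  \<open>1 / \<tau>\<close>.\<close>

lemma preconditioner_bounds:
  fixes A K D G :: "real mat"
  assumes A: "A \<in> carrier_mat n n" "transpose_mat A = A"
    and Apos: "\<And>x. x \<in> carrier_vec n \<Longrightarrow> 0 \<le> quad_form A x"
    and K: "K \<in> carrier_mat n n" "transpose_mat K = K"
    and Kpd: "\<forall>x\<in>carrier_vec n. x \<noteq> 0\<^sub>v n \<longrightarrow> 0 < quad_form K x"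
    and D: "D \<in> carrier_mat n n" "transpose_mat D = D"
    and Dpd: "\<forall>x\<in>carrier_vec n. x \<noteq> 0\<^sub>v n \<longrightarrow> 0 < quad_form D x"
    and G: "local_solver c\<^sub>G C\<^sub>G K n G" and cG: "0 < c\<^sub>G" "0 < C\<^sub>G" and t: "0 < \<tau>"
    and a: "0 < a1" "0 < a2" and b: "0 < b"
    and AK: "\<And>x. x \<in> carrier_vec n \<Longrightarrow> quad_form A x \<le> a1 * quad_form K x"
    and AD: "\<And>x. x \<in> carrier_vec n \<Longrightarrow> quad_form A x \<le> a2 / \<tau> * quad_form D x"
    and dec: "\<And>y. y \<in> carrier_vec n \<Longrightarrow> \<exists>v w. v \<in> carrier_vec n \<and> w \<in> carrier_vec n \<and> y = v + w \<and>
       quad_form K v + quad_form D w / \<tau> \<le> b * quad_form A y"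
  defines "B \<equiv> G + \<tau> \<cdot>\<^sub>m mat_inv D"
  defines "X \<equiv> mat_sqrt B * A * mat_sqrt B"
  defines "c \<equiv> 1 / (2 * (1 / c\<^sub>G + 1) * b)" and "C \<equiv> 2 * (a1 * C\<^sub>G + a2)"
  shows "spectrum (map_mat complex_of_real X) \<subseteq> complex_of_real ` {c..C}"
    and "0 < n \<Longrightarrow> spectral_cond X \<le> C / c"
proof -
  have psd: "0 \<le> quad_form M x" if "x \<in> carrier_vec n" "M \<in> carrier_mat n n"
    "\<forall>x\<in>carrier_vec n. x \<noteq> 0\<^sub>v n \<longrightarrow> 0 < quad_form M x" for M x
    using that by (cases "x = 0\<^sub>v n") (auto simp: quad_form_def less_imp_le)
  define Ki Di where "Ki = mat_inv K" and "Di = mat_inv D"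
  note Ki = mat_inv_inverse[OF K(1) quad_form_pos_injective[OF Kpd], folded Ki_def]
  note Di = mat_inv_inverse[OF D(1) quad_form_pos_injective[OF Dpd], folded Di_def]
  have Kit: "transpose_mat Ki = Ki" using inverse_symmetric[OF K Ki] by blast
  have Dit: "transpose_mat Di = Di" using inverse_symmetric[OF D Di] by blast
  have inv1: "M *\<^sub>v (Mi *\<^sub>v x) = x" if "M \<in> carrier_mat n n" "Mi \<in> carrier_mat n n" "M * Mi = 1\<^sub>m n"
    "x \<in> carrier_vec n" for M Mi :: "real mat" and x
    using assoc_mult_mat_vec[OF that(1,2,4)] one_mult_mat_vec[OF that(4)] by (simp add: that(3))
  have qinv: "quad_form Mi x = quad_form M (Mi *\<^sub>v x)"
    if "M \<in> carrier_mat n n" "Mi \<in> carrier_mat n n" "M * Mi = 1\<^sub>m n" "x \<in> carrier_vec n" for M Mi x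
    using that inv1[OF that] comm_scalar_prod[of x n "Mi *\<^sub>v x"] by (auto simp: quad_form_def)
  have Dipos: "\<forall>x\<in>carrier_vec n. x \<noteq> 0\<^sub>v n \<longrightarrow> 0 < quad_form Di x"
  proof (intro ballI impI)
    fix x :: "real Matrix.vec" assume x: "x \<in> carrier_vec n" "x \<noteq> 0\<^sub>v n"
    have "Di *\<^sub>v x \<noteq> 0\<^sub>v n" 
    proof
      assume 0: "Di *\<^sub>v x = 0\<^sub>v n"
      have "x = D *\<^sub>v 0\<^sub>v n" using inv1[OF D(1) Di(1,2) x(1)] unfolding 0 by (rule sym)
      also have "D *\<^sub>v 0\<^sub>v n = 0\<^sub>v n" by (rule eq_vecI) (use D(1) in auto)
      finally show False using x(2) by blast
    qed
    moreover have "Di *\<^sub>v x \<in> carrier_vec n" using x(1) Di(1) by auto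
    ultimately show "0 < quad_form Di x" using Dpd qinv[OF D(1) Di(1,2) x(1)] by metis
  qed
  have Kinn: "0 \<le> quad_form Ki x" if x: "x \<in> carrier_vec n" for x
    using psd[OF mult_mat_vec_carrier[OF Ki(1) x] K(1) Kpd] qinv[OF K(1) Ki(1,2) x] by argo
  have Gc: "G \<in> carrier_mat n n" "transpose_mat G = G"
    and Gl: "\<And>x. x \<in> carrier_vec n \<Longrightarrow> c\<^sub>G * quad_form Ki x \<le> quad_form G x"
    and Gu: "\<And>x. x \<in> carrier_vec n \<Longrightarrow> quad_form G x \<le> C\<^sub>G * quad_form Ki x"
    using G by (auto simp: local_solver_def Ki_def)
  have Gposb: "\<forall>x\<in>carrier_vec n. 0 \<le> quad_form G x"
  proof
    fix x :: "real Matrix.vec" assume x: "x \<in> carrier_vec n"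
    show "0 \<le> quad_form G x" using Gl[OF x] Kinn[OF x] cG by (smt (verit) mult_nonneg_nonneg)
  qed
  note Gpos = bspec[OF Gposb]
  have B: "B = G + \<tau> \<cdot>\<^sub>m Di" "B \<in> carrier_mat n n" "transpose_mat B = B"
  proof -
    show B: "B = G + \<tau> \<cdot>\<^sub>m Di" by (simp add: B_def Di_def)
    show "B \<in> carrier_mat n n" unfolding B using Gc(1) Di(1) by auto
    have "transpose_mat B = transpose_mat G + \<tau> \<cdot>\<^sub>m transpose_mat Di"
      unfolding B by (rule eq_matI) (use Gc(1) Di(1) in auto)
    then show "transpose_mat B = B" by (simp add: Gc(2) Dit B)
  qed
  have Bv: "B *\<^sub>v x = G *\<^sub>v x + \<tau> \<cdot>\<^sub>v (Di *\<^sub>v x)" if "x \<in> carrier_vec n" for x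
  proof -
    have "(\<tau> \<cdot>\<^sub>m Di) *\<^sub>v x = \<tau> \<cdot>\<^sub>v (Di *\<^sub>v x)"
      by (rule eq_vecI) (use that Di(1) in \<open>auto simp: scalar_prod_def sum_distrib_left mult.assoc\<close>)
    then show ?thesis using that Gc(1) Di(1) by (simp add: B(1) add_mult_distrib_mat_vec[of _ n n])
  qed
  have Bq: "quad_form B x = quad_form G x + \<tau> * quad_form Di x" if x: "x \<in> carrier_vec n" for x
    using x Gc Di by (simp add: quad_form_def Bv scalar_prod_add_distrib[of _ n])
  have Bpd: "\<forall>x\<in>carrier_vec n. x \<noteq> 0\<^sub>v n \<longrightarrow> 0 < quad_form B x"
    using Bq Gpos Dipos t by (simp add: add_nonneg_pos)
  have c: "0 < c" using b cG by (auto simp: c_def intro!: mult_pos_pos add_pos_pos)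
  \<comment> \<open>From G \<le> C K^{-1} follows G K G \<le> C G without any square root: for
    \<open>q = quad_form K (G *\<^sub>v x)\<close>, Cauchy-Schwarz for \<open>G\<close> bounds the
    square of \<open>q\<close> by a multiple of \<open>q\<close> itself.\<close>
  have GKG: "quad_form K (G *\<^sub>v x) \<le> C\<^sub>G * quad_form G x" if x: "x \<in> carrier_vec n" for x
  proof -
    define s where "s = G *\<^sub>v x"
    define q where "q = quad_form K s"
    have s: "s \<in> carrier_vec n" using Gc x by (auto simp: s_def)
    have Ks: "K *\<^sub>v s \<in> carrier_vec n" using K s by auto
    have q: "q = x \<bullet> (G *\<^sub>v (K *\<^sub>v s))"
      using symmetric_scalar_prod[OF Gc x Ks] by (simp add: q_def quad_form_def s_def)
    have KiKs: "Ki *\<^sub>v (K *\<^sub>v s) = s" by (rule inv1) (use Ki K s in auto)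
    have "quad_form Ki (K *\<^sub>v s) = q"
      using Ks s by (simp add: quad_form_def KiKs q_def comm_scalar_prod[of _ n])
    then have "quad_form G (K *\<^sub>v s) \<le> C\<^sub>G * q" using Gu[OF Ks] by simp
    moreover have "q\<^sup>2 \<le> quad_form G x * quad_form G (K *\<^sub>v s)"
      using psd_cauchy_schwarz[OF Gc Gposb x Ks] by (simp add: q)
    ultimately have le: "q\<^sup>2 \<le> quad_form G x * (C\<^sub>G * q)"
      using Gpos[OF x] by (smt (verit) mult_left_mono)
    have "0 \<le> q" using psd[OF s K(1) Kpd] by (simp add: q_def)
    then show ?thesis using le Gpos[OF x] cG
      by (cases "q = 0") (auto simp: q_def[symmetric] s_def[symmetric] power2_eq_square mult_ac)
  qed
  have upper: "quad_form A (B *\<^sub>v x) \<le> C * quad_form B x" if x: "x \<in> carrier_vec n" for x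
  proof -
    define v w where "v = G *\<^sub>v x" and "w = \<tau> \<cdot>\<^sub>v (Di *\<^sub>v x)"
    have vw: "v \<in> carrier_vec n" "w \<in> carrier_vec n" using Gc Di x by (auto simp: v_def w_def)
    have par: "quad_form A (v + w) + quad_form A (v - w) = 2 * quad_form A v + 2 * quad_form A w"
      using A vw
      by (simp add: quad_form_def mult_add_distrib_mat_vec[of _ n n] mult_minus_distrib_mat_vec[of _ n n]
          scalar_prod_add_distrib[of _ n] add_scalar_prod_distrib[of _ n]
          scalar_prod_minus_distrib[of _ n] minus_scalar_prod_distrib[of _ n])
    have Dw: "quad_form D w = \<tau>\<^sup>2 * quad_form Di x"
      using D Di x by (simp add: qinv[OF D(1) Di(1,2)] w_def)
        (simp add: quad_form_def mult_mat_vec[of _ n n] power2_eq_square)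
    have "quad_form A (B *\<^sub>v x) \<le> 2 * quad_form A v + 2 * quad_form A w"
      using par Apos[of "v - w"] vw by (simp add: Bv[OF x] v_def[symmetric] w_def[symmetric])
    also have "\<dots> \<le> 2 * (a1 * (C\<^sub>G * quad_form G x)) + 2 * (a2 / \<tau> * (\<tau>\<^sup>2 * quad_form Di x))"
      using AK[OF vw(1)] AD[OF vw(2)] GKG[OF x] a unfolding Dw v_def
      by (smt (verit) mult_left_mono)
    also have "\<dots> = 2 * (a1 * C\<^sub>G) * quad_form G x + 2 * a2 * (\<tau> * quad_form Di x)"
      using t by (simp add: power2_eq_square)
    also have "\<dots> \<le> C * quad_form G x + C * (\<tau> * quad_form Di x)"
      using Gpos[OF x] psd[OF x Di(1) Dipos] a cG t unfolding C_def
      by (intro add_mono mult_right_mono) auto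
    finally show ?thesis by (simp add: Bq[OF x] algebra_simps)
  qed
  have lower: "c * quad_form B x \<le> quad_form A (B *\<^sub>v x)" if x: "x \<in> carrier_vec n" for x
  proof -
    define y where "y = B *\<^sub>v x"
    have y: "y \<in> carrier_vec n" using B x by (auto simp: y_def)
    obtain v w where vw: "v \<in> carrier_vec n" "w \<in> carrier_vec n" "y = v + w"
      "quad_form K v + quad_form D w / \<tau> \<le> b * quad_form A y" using dec[OF y] by auto
    define q g m where "q = quad_form B x" and "g = quad_form G x" and "m = \<tau> * quad_form Di x"
    have gm: "q = g + m" "0 \<le> g" "0 \<le> m"
      using Bq[OF x] Gpos[OF x] psd[OF x Di(1) Dipos] t by (auto simp: q_def g_def m_def)
    have cs: "(x \<bullet> z)\<^sup>2 \<le> quad_form Mi x * quad_form M z"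
      if M: "M \<in> carrier_mat n n" "transpose_mat M = M" "\<forall>x\<in>carrier_vec n. x \<noteq> 0\<^sub>v n \<longrightarrow> 0 < quad_form M x"
        and Mi: "Mi \<in> carrier_mat n n" "M * Mi = 1\<^sub>m n" and z: "z \<in> carrier_vec n" for M Mi z
    proof -
      have Mx: "Mi *\<^sub>v x \<in> carrier_vec n" using Mi x by auto
      have "x \<bullet> z = (Mi *\<^sub>v x) \<bullet> (M *\<^sub>v z)"
        using symmetric_scalar_prod[OF M(1,2) Mx z] inv1[OF M(1) Mi x] by simp
      then show ?thesis
        using psd_cauchy_schwarz[OF M(1,2) _ Mx z] psd[OF _ M(1) M(3)] qinv[OF M(1) Mi x] by simp
    qed
    have xv: "(x \<bullet> v)\<^sup>2 \<le> g / c\<^sub>G * quad_form K v"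
    proof -
      have "quad_form Ki x \<le> g / c\<^sub>G" using Gl[OF x] cG by (simp add: g_def field_simps)
      then show ?thesis using cs[OF K Kpd Ki(1,2) vw(1)] psd[OF vw(1) K(1) Kpd]
        by (smt (verit) mult_right_mono)
    qed
    have xw: "(x \<bullet> w)\<^sup>2 \<le> m * (quad_form D w / \<tau>)"
      using cs[OF D Dpd Di(1,2) vw(2)] t by (simp add: m_def)
    define k d where "k = quad_form K v" and "d = quad_form D w / \<tau>"
    have kd: "0 \<le> k" "0 \<le> d" using psd[OF vw(1) K(1) Kpd] psd[OF vw(2) D(1) Dpd] t by (auto simp: k_def d_def)
    have "q = x \<bullet> v + x \<bullet> w"
      using x vw by (simp add: q_def quad_form_def y_def[symmetric] scalar_prod_add_distrib[of _ n])
    then have "q\<^sup>2 \<le> 2 * (x \<bullet> v)\<^sup>2 + 2 * (x \<bullet> w)\<^sup>2"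
      using sum_squares_ge_zero[of "x \<bullet> v - x \<bullet> w" 0] by (simp add: power2_eq_square algebra_simps)
    also have "\<dots> \<le> 2 * (g / c\<^sub>G * k) + 2 * (m * d)" using xv xw by (simp add: k_def d_def)
    also have "\<dots> \<le> 2 * ((1 / c\<^sub>G + 1) * q * (k + d))"
    proof -
      have "g / c\<^sub>G * k + m * d \<le> (1 / c\<^sub>G * q) * (k + d) + q * (k + d)"
        using gm kd cG by (intro add_mono mult_mono) (auto simp: divide_right_mono)
      also have "\<dots> = (1 / c\<^sub>G + 1) * q * (k + d)" by (simp add: distrib_right)
      finally show ?thesis by linarith
    qed
    also have "\<dots> \<le> 2 * ((1 / c\<^sub>G + 1) * q * (b * quad_form A y))"
      using vw(4) gm cG by (intro mult_left_mono) (auto simp: k_def d_def)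
    finally have le: "q * q \<le> q * (2 * (1 / c\<^sub>G + 1) * b * quad_form A y)"
      by (simp add: power2_eq_square algebra_simps)
    have "q \<le> 2 * (1 / c\<^sub>G + 1) * b * quad_form A y"
    proof (cases "q = 0")
      case True
      then show ?thesis using Apos[OF y] b cG by simp
    next
      case False
      then show ?thesis using le gm by simp
    qed
    moreover have "0 < 2 * (1 / c\<^sub>G + 1) * b" using b cG by (auto intro!: mult_pos_pos add_pos_pos)
    ultimately show ?thesis
      unfolding c_def q_def y_def by (simp add: divide_le_eq mult.commute)
  qed
  show "spectrum (map_mat complex_of_real X) \<subseteq> complex_of_real ` {c..C}" "0 < n \<Longrightarrow> spectral_cond X \<le> C / c"
    unfolding X_def using preconditioned_spectrum[OF A B(2,3) Bpd c lower upper] by auto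
qed

section \<open>Spectral equivalence\<close>

lemma transl_commute: "transl u v s = transl v u s"
  by (simp add: transl_def mult.commute)

lemma transl_sum_left:
  assumes "\<And>i. i \<in> I \<Longrightarrow> bbb (f i)" "bbb v"
  shows "transl (\<lambda>x. \<Sum>i\<in>I. X i * f i x) v s = (\<Sum>i\<in>I. X i * transl (f i) v s)"
proof -
  have "transl (\<lambda>x. \<Sum>i\<in>I. X i * f i x) v s
      = (LINT x|lborel. (\<Sum>i\<in>I. X i * ((f i (x + s) - f i x) * (v (x + s) - v x))))"
    unfolding transl_def
    by (intro Bochner_Integration.integral_cong)
      (simp_all add: sum_subtractf[symmetric] right_diff_distrib[symmetric] sum_distrib_right mult.assoc)
  also have "\<dots> = (\<Sum>i\<in>I. (LINT x|lborel. X i * ((f i (x + s) - f i x) * (v (x + s) - v x))))"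
    using assms by (intro Bochner_Integration.integral_sum bbb_integrable bbb_scale bbb_transl_integrand)
  also have "\<dots> = (\<Sum>i\<in>I. X i * transl (f i) v s)" by (simp add: transl_def)
  finally show ?thesis .
qed

lemma (in averaged_kernel_setup) nform_sum_left:
  assumes \<delta>: "0 < \<delta>" and f: "\<And>i. i \<in> I \<Longrightarrow> bbb (f i)" and v: "bbb v"
  shows "nform \<delta> (\<lambda>x. \<Sum>i\<in>I. X i * f i x) v = (\<Sum>i\<in>I. X i * nform \<delta> (f i) v)"
proof -
  let ?k = "\<lambda>s. averaged_kernel \<Z> \<rho> (s /\<^sub>R \<delta>)"
  have k: "bbb ?k" by (rule bbb_dilate[OF averaged_bbb \<delta>])
  have "(LINT s|lborel. ?k s * transl (\<lambda>x. \<Sum>i\<in>I. X i * f i x) v s)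
      = (LINT s|lborel. (\<Sum>i\<in>I. X i * (?k s * transl (f i) v s)))"
    by (simp add: transl_sum_left[OF f v] sum_distrib_left mult_ac)
  also have "\<dots> = (\<Sum>i\<in>I. (LINT s|lborel. X i * (?k s * transl (f i) v s)))"
    using kernel_form(4)[OF k f v] by (intro Bochner_Integration.integral_sum) simp
  also have "\<dots> = (\<Sum>i\<in>I. X i * (LINT s|lborel. ?k s * transl (f i) v s))" by simp
  finally show ?thesis by (simp add: nform_def sum_distrib_left mult_ac)
qed

lemma (in averaged_kernel_setup) nform_commute: "nform \<delta> u v = nform \<delta> v u"
  by (simp add: nform_def transl_commute[of u v])

lemma quad_form_sum:
  assumes "x \<in> carrier_vec n"
  shows "quad_form (Matrix.mat n n f) x = (\<Sum>i<n. \<Sum>j<n. x $ i * f (i, j) * x $ j)"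
  using assms
  by (simp add: quad_form_def scalar_prod_def lessThan_atLeast0 sum_distrib_left mult.assoc)

text \<open>The constant of \<open>energy_le_osc_coarse\<close> at radius
  \<open>r\<^sub>0 / 2 * \<delta>\<close> without its power of \<delta>, times the lower bound of
  the kernel.\<close>

definition coarse_const :: "'a::euclidean_space itself \<Rightarrow> real \<Rightarrow> real \<Rightarrow> real" where
  "coarse_const _ \<rho>\<^sub>0 r\<^sub>0 = uball TYPE('a) / 4 ^ (DIM('a) + 2) / 2 ^ DIM('a) * (r\<^sub>0 / 2) ^ (DIM('a) + 2) * \<rho>\<^sub>0"

lemma coarse_const_pos: "0 < \<rho>\<^sub>0 \<Longrightarrow> 0 < r\<^sub>0 \<Longrightarrow> 0 < coarse_const TYPE('a::euclidean_space) \<rho>\<^sub>0 r\<^sub>0"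
  using uball_pos[where 'a = 'a] by (simp add: coarse_const_def)

section \<open>The matrices as quadratic forms of finite element functions\<close>

locale fe_kernel = fe_nodes \<Omega> \<T> N p \<phi> + averaged_kernel_setup M\<^sub>\<rho> \<rho>\<^sub>0 r\<^sub>0 \<rho> P \<Z>
  for \<Omega> :: "'a::euclidean_space set" and \<T> N p \<phi> M\<^sub>\<rho> \<rho>\<^sub>0 r\<^sub>0 and \<rho> :: "'a \<Rightarrow> real" and P \<Z>
begin

lemma nform_comb:
  assumes "0 < \<delta>"
  shows "nform \<delta> (comb X) (comb X) = (\<Sum>i<N. \<Sum>j<N. X i * nform \<delta> (\<phi> j) (\<phi> i) * X j)"
proof -
  have b: "bbb (\<phi> i)" if "i \<in> {..<N}" for i using that by (intro fe_bbb basis_fe) simp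
  have "nform \<delta> (comb X) v = (\<Sum>i<N. X i * nform \<delta> (\<phi> i) v)" if "bbb v" for v
    using nform_sum_left[of \<delta> "{..<N}" \<phi> v X, OF assms b that] by (simp add: comb_def[abs_def])
  then have e: "nform \<delta> (comb X) v = (\<Sum>i<N. X i * nform \<delta> v (\<phi> i))" if "bbb v" for v
    using that by (simp add: nform_commute[of \<delta> v])
  have "nform \<delta> (comb X) (comb X) = (\<Sum>i<N. X i * nform \<delta> (comb X) (\<phi> i))"
    by (rule e) (intro fe_bbb comb_fe)
  also have "\<dots> = (\<Sum>i<N. X i * (\<Sum>j<N. X j * nform \<delta> (\<phi> i) (\<phi> j)))"
    using b by (intro sum.cong refl) (simp add: e)
  also have "\<dots> = (\<Sum>i<N. \<Sum>j<N. X i * nform \<delta> (\<phi> j) (\<phi> i) * X j)"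
    by (simp add: sum_distrib_left mult_ac nform_commute[of \<delta> "\<phi> _" "\<phi> _"])
  finally show ?thesis .
qed

lemma stiffness_quad:
  assumes \<delta>: "0 < \<delta>" and x: "x \<in> carrier_vec N"
  shows "quad_form (nonlocal_stiffness_mat \<Omega> \<delta> (averaged_kernel \<Z> \<rho>) N \<phi>) x = nform \<delta> (comb (($) x)) (comb (($) x))"
proof -
  have "nonlocal_form \<Omega> \<delta> (averaged_kernel \<Z> \<rho>) (\<phi> j) (\<phi> i) = nform \<delta> (\<phi> j) (\<phi> i)" if "i < N" "j < N" for i j
    using that by (intro nonlocal_form_eq \<delta> fe_bbb fe_zero_ext basis_fe)
  then show ?thesis
    unfolding nonlocal_stiffness_mat_def quad_form_sum[OF x] nform_comb[OF \<delta>] by simp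
qed

lemma stiffness_symmetric:
  assumes \<delta>: "0 < \<delta>"
  shows "transpose_mat (nonlocal_stiffness_mat \<Omega> \<delta> (averaged_kernel \<Z> \<rho>) N \<phi>) = nonlocal_stiffness_mat \<Omega> \<delta> (averaged_kernel \<Z> \<rho>) N \<phi>"
proof -
  have "nonlocal_form \<Omega> \<delta> (averaged_kernel \<Z> \<rho>) (\<phi> j) (\<phi> i) = nform \<delta> (\<phi> j) (\<phi> i)" if "i < N" "j < N" for i j
    using that by (intro nonlocal_form_eq \<delta> fe_bbb fe_zero_ext basis_fe)
  then show ?thesis
    by (intro eq_matI) (auto simp: nonlocal_stiffness_mat_def nform_commute)
qed

lemma local_entry:
  assumes "i < N" "j < N"
  shows "(LINT x:\<Omega>|lebesgue. inner (grad (\<phi> j) x) (grad (\<phi> i) x))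
    = (\<Sum>T\<in>\<T>. measure lborel T * inner (cell_grad (\<phi> i) T) (cell_grad (\<phi> j) T))"
  using fe_stiffness[OF basis_fe[OF assms(2)] basis_fe[OF assms(1)]]
  by (simp only: inner_commute[of "cell_grad (\<phi> j) _"])

lemma local_quad:
  assumes x: "x \<in> carrier_vec N"
  shows "quad_form (local_stiffness_mat \<Omega> N \<phi>) x = energy (comb (($) x))"
proof -
  have "energy (comb (($) x)) = (\<Sum>T\<in>\<T>. measure lborel T * (\<Sum>i<N. \<Sum>j<N. x $ j * (x $ i * inner (cell_grad (\<phi> i) T) (cell_grad (\<phi> j) T))))"
    unfolding energy_def power2_norm_eq_inner
    by (intro sum.cong refl, simp only: comb_grad inner_sum_left)
      (simp only: inner_sum_right inner_scaleR_left inner_scaleR_right sum_distrib_left)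
  also have "\<dots> = (\<Sum>T\<in>\<T>. \<Sum>i<N. \<Sum>j<N. x $ i * (measure lborel T * inner (cell_grad (\<phi> i) T) (cell_grad (\<phi> j) T)) * x $ j)"
    by (simp only: sum_distrib_left, intro sum.cong refl) (simp add: mult_ac)
  also have "\<dots> = (\<Sum>i<N. \<Sum>T\<in>\<T>. \<Sum>j<N. x $ i * (measure lborel T * inner (cell_grad (\<phi> i) T) (cell_grad (\<phi> j) T)) * x $ j)"
    by (rule sum.swap)
  also have "\<dots> = (\<Sum>i<N. \<Sum>j<N. \<Sum>T\<in>\<T>. x $ i * (measure lborel T * inner (cell_grad (\<phi> i) T) (cell_grad (\<phi> j) T)) * x $ j)"
    by (intro sum.cong refl sum.swap)
  also have "\<dots> = quad_form (local_stiffness_mat \<Omega> N \<phi>) x"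
    unfolding local_stiffness_mat_def quad_form_sum[OF x]
    by (simp add: local_entry sum_distrib_left sum_distrib_right)
  finally show ?thesis by simp
qed

lemma local_symmetric: "transpose_mat (local_stiffness_mat \<Omega> N \<phi>) = local_stiffness_mat \<Omega> N \<phi>"
  by (intro eq_matI) (auto simp: local_stiffness_mat_def inner_commute)

lemma local_pos:
  assumes x: "x \<in> carrier_vec N" "x \<noteq> 0\<^sub>v N"
  shows "0 < quad_form (local_stiffness_mat \<Omega> N \<phi>) x"
proof (rule ccontr)
  assume "\<not> ?thesis"
  then have "energy (comb (($) x)) \<le> 0" by (simp add: local_quad[OF x(1)])
  then have "comb (($) x) (p i) = 0" for i by (rule energy_zero_imp_zero[OF comb_fe])
  then have "x $ i = 0" if "i < N" for i using comb_node[OF that, of "($) x"] by simp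
  then have "x = 0\<^sub>v N" using x(1) by (intro eq_vecI) auto
  with x(2) show False by simp
qed

lemma lumped_entry: "i < N \<Longrightarrow> (LINT x:\<Omega>|lebesgue. \<phi> i x) = (LINT x|lborel. \<phi> i x)"
proof -
  assume i: "i < N"
  have "(LINT x:\<Omega>|lebesgue. \<phi> i x) = (LINT x|lebesgue. \<phi> i x)"
    unfolding set_lebesgue_integral_def using fe_zero[OF basis_fe[OF i]]
    by (intro Bochner_Integration.integral_cong) (auto simp: indicator_def)
  also have "\<dots> = (LINT x|lborel. \<phi> i x)"
    using bbb_measurable[OF fe_bbb[OF basis_fe[OF i]]] by (intro integral_completion) simp
  finally show ?thesis .
qed

lemma lumped_quad_sum:
  assumes x: "x \<in> carrier_vec N"
  shows "quad_form (lumped_mass_mat \<Omega> N \<phi>) x = (\<Sum>i<N. (x $ i)\<^sup>2 * (LINT y|lborel. \<phi> i y))"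
proof -
  have "quad_form (lumped_mass_mat \<Omega> N \<phi>) x = (\<Sum>i<N. \<Sum>j<N. if j = i then (x $ i)\<^sup>2 * (LINT y|lborel. \<phi> i y) else 0)"
    unfolding lumped_mass_mat_def quad_form_sum[OF x]
    by (intro sum.cong refl) (auto simp: lumped_entry power2_eq_square)
  then show ?thesis by simp
qed

lemma lumped_quad:
  assumes x: "x \<in> carrier_vec N"
  shows "quad_form (lumped_mass_mat \<Omega> N \<phi>) x = (LINT y|lborel. lump (($) x) y)"
proof -
  have "(LINT y|lborel. lump (($) x) y) = (\<Sum>i<N. (LINT y|lborel. (x $ i)\<^sup>2 * \<phi> i y))"
    unfolding lump_def comb_def
    by (intro Bochner_Integration.integral_sum bbb_integrable bbb_scale fe_bbb basis_fe) simp
  then show ?thesis by (simp add: lumped_quad_sum[OF x])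
qed

lemma lumped_pos:
  assumes x: "x \<in> carrier_vec N" "x \<noteq> 0\<^sub>v N"
  shows "0 < quad_form (lumped_mass_mat \<Omega> N \<phi>) x"
proof -
  obtain i where i: "i < N" "x $ i \<noteq> 0" using x by (metis carrier_vecD eq_vecI index_zero_vec)
  show ?thesis unfolding lumped_quad_sum[OF x(1)]
    using i integral_basis_pos by (intro sum_pos2[of _ i]) (auto intro!: mult_nonneg_nonneg less_imp_le[OF integral_basis_pos])
qed

lemma lumped_symmetric: "transpose_mat (lumped_mass_mat \<Omega> N \<phi>) = lumped_mass_mat \<Omega> N \<phi>"
  by (intro eq_matI) (auto simp: lumped_mass_mat_def)

section \<open>Two-sided bounds for the nonlocal form\<close>

lemma nform_le_energy:
  assumes \<delta>: "0 < \<delta>"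
  shows "nform \<delta> (comb X) (comb X) \<le> M\<^sub>\<rho> * energy (comb X)"
proof -
  have E: "0 \<le> energy (comb X)" by (simp add: energy_def sum_nonneg)
  have "nform \<delta> (comb X) (comb X) \<le> (\<delta>\<^sup>2 * energy (comb X)) / \<delta>\<^sup>2 * kernel_mass \<rho>"
  proof (rule nform_upper[OF \<delta> fe_bbb[OF comb_fe]])
    show "0 \<le> \<delta>\<^sup>2 * energy (comb X)" using E by simp
    show "transl (comb X) (comb X) s \<le> \<delta>\<^sup>2 * energy (comb X)" if "norm s \<le> \<delta>" for s
    proof -
      have "(norm s)\<^sup>2 \<le> \<delta>\<^sup>2" using that by (intro power_mono) auto
      then have "(norm s)\<^sup>2 * energy (comb X) \<le> \<delta>\<^sup>2 * energy (comb X)" using E by (rule mult_right_mono)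
      then show ?thesis using transl_le_energy[OF comb_fe, of X s] by linarith
    qed
  qed
  also have "\<dots> = kernel_mass \<rho> * energy (comb X)" using \<delta> by simp
  also have "\<dots> \<le> M\<^sub>\<rho> * energy (comb X)" by (intro mult_right_mono kernel_mass_bounds E)
  finally show ?thesis .
qed

lemma nform_le_lump:
  assumes \<delta>: "0 < \<delta>"
  shows "nform \<delta> (comb X) (comb X) \<le> 2 / (beta_const \<rho> * \<delta>\<^sup>2) * (LINT y|lborel. lump X y)"
proof -
  note b = fe_bbb[OF comb_fe]
  have b2: "bbb (\<lambda>x. (comb X x)\<^sup>2)" unfolding power2_eq_square by (intro bbb_mult b)
  have "nform \<delta> (comb X) (comb X) \<le> (4 * (LINT x|lborel. (comb X x)\<^sup>2)) / \<delta>\<^sup>2 * kernel_mass \<rho>"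
    using transl_le_square[OF b] by (intro nform_upper[OF \<delta> b]) auto
  also have "\<dots> \<le> (4 * (LINT x|lborel. lump X x)) / \<delta>\<^sup>2 * kernel_mass \<rho>"
    using kernel_mass_pos comb_square_le_lump[of X] b2 fe_bbb[OF comb_fe, of "\<lambda>i. (X i)\<^sup>2", folded lump_def]
    by (intro mult_right_mono divide_right_mono mult_left_mono integral_mono bbb_integrable) auto
  \<comment> \<open>\<open>beta_const\<close> is half the reciprocal of the kernel mass, so the 4 of
    \<open>transl_le_square\<close> leaves the absolute constant 2.\<close>
  also have "\<dots> = 2 / (beta_const \<rho> * \<delta>\<^sup>2) * (LINT y|lborel. lump X y)"
    using kernel_mass_pos by (simp add: beta_const_def)
  finally show ?thesis .
qed

text \<open>\<open>Y\<close> holds the coefficients of the smooth part. The factor is the sum of the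
  constants of the two regimes, so one statement covers both; \<open>n\<close> counts the doublings
  from the radius seen by the kernel to the radius \<open>(H + 2) * \<delta>\<close> of the
  quasi-interpolation. The remainder is still measured in L2, not in the lumped mass.\<close>

lemma decomposition:
  assumes ext: "\<forall>x s. x \<in> frontier \<Omega> \<and> 0 < s \<and> s \<le> s\<^sub>0 \<longrightarrow> (\<exists>y. ball y (c * s) \<subseteq> ball x s - \<Omega>)"
    and c: "0 < c" and \<delta>: "0 < \<delta>" "\<delta> \<le> s\<^sub>0"
    and sr: "shape_regular C\<^sub>s \<T>" and Cs: "C\<^sub>s \<le> C" "0 < C"
    and qu: "quasi_uniform C\<^sub>q \<T>" and Cq: "C\<^sub>q \<le> C'" "0 < C'"
    and H: "H = 4 * C * C'" and n: "H + 2 \<le> 2 ^ n * (r\<^sub>0 / 2)"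
  shows "\<exists>Y. energy (comb Y) + (LINT x|lborel. (comb Y x - comb X x)\<^sup>2) / \<delta>\<^sup>2
    \<le> (1 / coarse_const TYPE('a) \<rho>\<^sub>0 r\<^sub>0 + (16 * C\<^sup>2 + 1) * interp_const TYPE('a) c H * (4 ^ n * (2 ^ n) ^ DIM('a)) / \<rho>\<^sub>0)
       * nform \<delta> (comb X) (comb X)"
proof -
  define u where "u = comb X"
  define a where "a = nform \<delta> u u"
  have u: "u \<in> V" by (simp add: u_def comb_fe)
  note bu = fe_bbb[OF u]
  have H0: "0 \<le> H" using Cs Cq by (simp add: H)
  have cc: "0 < coarse_const TYPE('a) \<rho>\<^sub>0 r\<^sub>0" using \<rho>0 r0(1) by (rule coarse_const_pos)
  define F where "F = (LINT z|lborel. osc (r\<^sub>0 / 2 * \<delta>) u z)"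
  have F0: "0 \<le> F" unfolding F_def by (intro integral_nonneg_AE AE_I2 osc_nonneg)
  have Fa: "\<rho>\<^sub>0 / \<delta> ^ (DIM('a) + 2) * F \<le> a" unfolding F_def a_def by (rule nform_lower[OF \<delta>(1) bu])
  then have a0: "0 \<le> a" using F0 \<rho>0 \<delta> by (smt (verit) divide_nonneg_nonneg mult_nonneg_nonneg zero_le_power)
  have Fle: "F \<le> \<delta> ^ (DIM('a) + 2) / \<rho>\<^sub>0 * a" using Fa \<rho>0 \<delta> by (simp add: field_simps)
  define B where "B = (16 * C\<^sup>2 + 1) * interp_const TYPE('a) c H * (4 ^ n * (2 ^ n) ^ DIM('a)) / \<rho>\<^sub>0"
  have B0: "0 \<le> B" using interp_const_nonneg[OF c H0, where 'a = 'a] \<rho>0 by (simp add: B_def)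
  \<comment> \<open>In the second case quasi-uniformity and shape regularity give
    \<open>H * \<delta> \<le> 4 * C * C' * r\<close> for an inscribed ball of radius
    \<open>r\<close> in each simplex, and \<open>H = 4 * C * C'\<close> reduces this to
    \<open>\<delta> \<le> r\<close>.\<close>
  consider "mesh_size \<T> \<le> H * \<delta>" | "H * \<delta> \<le> mesh_size \<T>" by linarith
  then have "\<exists>Y. energy (comb Y) + (LINT x|lborel. (comb Y x - u x)\<^sup>2) / \<delta>\<^sup>2 \<le> (1 / coarse_const TYPE('a) \<rho>\<^sub>0 r\<^sub>0 + B) * a"
  proof cases
    case 1
    have diam: "diameter T \<le> H * \<delta>" if "T \<in> \<T>" for T
    proof -
      have "diameter T \<le> mesh_size \<T>" unfolding mesh_size_def using finite_mesh that by (intro Max_ge) auto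
      then show ?thesis using 1 by linarith
    qed
    define Y where "Y = quasi_interp \<delta> X"
    have e1: "energy (comb Y) + (LINT x|lborel. (comb Y x - u x)\<^sup>2) / \<delta>\<^sup>2
      \<le> (16 * C\<^sup>2 + 1) * interp_const TYPE('a) c H / \<delta> ^ (DIM('a) + 2) * (LINT z|lborel. osc ((H + 2) * \<delta>) u z)"
      unfolding Y_def u_def by (rule quasi_interp_bound[OF ext c \<delta> H0 sr Cs diam])
    have le: "(LINT z|lborel. osc ((H + 2) * \<delta>) u z) \<le> 4 ^ n * (2 ^ n) ^ DIM('a) * (\<delta> ^ (DIM('a) + 2) / \<rho>\<^sub>0 * a)"
    proof -
    have "(LINT z|lborel. osc ((H + 2) * \<delta>) u z) \<le> (LINT z|lborel. osc (2 ^ n * (r\<^sub>0 / 2 * \<delta>)) u z)"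
    proof (rule integral_mono[OF osc_energy(2)[OF bu] osc_energy(2)[OF bu]])
      have "(H + 2) * \<delta> \<le> 2 ^ n * (r\<^sub>0 / 2) * \<delta>" using n \<delta> by (intro mult_right_mono) auto
      then show "osc ((H + 2) * \<delta>) u z \<le> osc (2 ^ n * (r\<^sub>0 / 2 * \<delta>)) u z" for z
        by (intro osc_mono bu) (simp add: mult.assoc)
    qed
    also have "\<dots> \<le> 4 ^ n * (2 ^ n) ^ DIM('a) * F" unfolding F_def by (rule osc_energy_doubling[OF bu])
    also have "\<dots> \<le> 4 ^ n * (2 ^ n) ^ DIM('a) * (\<delta> ^ (DIM('a) + 2) / \<rho>\<^sub>0 * a)"
      by (intro mult_left_mono Fle) auto
    finally show ?thesis .
    qed
    have K: "0 \<le> (16 * C\<^sup>2 + 1) * interp_const TYPE('a) c H / \<delta> ^ (DIM('a) + 2)"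
      using interp_const_nonneg[OF c H0, where 'a = 'a] \<delta> by simp
    note e1
    also note mult_left_mono[OF le K]
    also have "(16 * C\<^sup>2 + 1) * interp_const TYPE('a) c H / \<delta> ^ (DIM('a) + 2)
        * (4 ^ n * (2 ^ n) ^ DIM('a) * (\<delta> ^ (DIM('a) + 2) / \<rho>\<^sub>0 * a)) = B * a" using \<delta> by (simp add: B_def)
    also have "\<dots> \<le> (1 / coarse_const TYPE('a) \<rho>\<^sub>0 r\<^sub>0 + B) * a" using cc a0 by (intro mult_right_mono) auto
    finally show ?thesis by blast
  next
    case 2
    have R: "0 < r\<^sub>0 / 2 * \<delta>" using r0 \<delta> by simp
    have inb: "\<exists>z r. cball z r \<subseteq> T \<and> r\<^sub>0 / 2 * \<delta> \<le> r / 2" if T: "T \<in> \<T>" for T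
    proof -
      obtain z r where z: "0 < r" "cball z r \<subseteq> T" "diameter T \<le> 4 * C * r"
        using cell_inball[OF T sr Cs] by blast
      have "H * \<delta> \<le> C\<^sub>q * diameter T" using 2 qu T by (auto simp: quasi_uniform_def)
      also have "\<dots> \<le> C' * diameter T" using Cq cell_diameter_pos[OF T] by (intro mult_right_mono) auto
      also have "\<dots> \<le> C' * (4 * C * r)" using z Cq by (intro mult_left_mono) auto
      finally have "(4 * C * C') * \<delta> \<le> (4 * C * C') * r" by (simp add: H mult_ac)
      then have "\<delta> \<le> r" using Cs Cq by simp
      moreover have "r\<^sub>0 * \<delta> \<le> 1 * \<delta>" using r0 \<delta> by (intro mult_right_mono) auto
      ultimately have "r\<^sub>0 / 2 * \<delta> \<le> r / 2" by simp
      with z(2) show ?thesis by blast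
    qed
    have "uball TYPE('a) / 4 ^ (DIM('a) + 2) / 2 ^ DIM('a) * (r\<^sub>0 / 2 * \<delta>) ^ (DIM('a) + 2) * energy u \<le> F"
      unfolding F_def by (rule energy_le_osc_coarse[OF u R inb])
    also have "\<dots> \<le> \<delta> ^ (DIM('a) + 2) / \<rho>\<^sub>0 * a" by (rule Fle)
    finally have "\<delta> ^ (DIM('a) + 2) * (coarse_const TYPE('a) \<rho>\<^sub>0 r\<^sub>0 / \<rho>\<^sub>0 * energy u) \<le> \<delta> ^ (DIM('a) + 2) * (a / \<rho>\<^sub>0)"
      using \<rho>0 unfolding power_mult_distrib[of "r\<^sub>0 / 2" \<delta>] coarse_const_def by (simp add: mult_ac)
    then have "coarse_const TYPE('a) \<rho>\<^sub>0 r\<^sub>0 / \<rho>\<^sub>0 * energy u \<le> a / \<rho>\<^sub>0"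
      by (rule mult_left_le_imp_le) (use \<delta> in simp)
    then have "coarse_const TYPE('a) \<rho>\<^sub>0 r\<^sub>0 * energy u \<le> a" using \<rho>0 by (simp add: field_simps)
    then have "energy u \<le> 1 / coarse_const TYPE('a) \<rho>\<^sub>0 r\<^sub>0 * a" using cc by (simp add: field_simps)
    also have "\<dots> \<le> (1 / coarse_const TYPE('a) \<rho>\<^sub>0 r\<^sub>0 + B) * a" using B0 a0 by (intro mult_right_mono) auto
    finally show ?thesis unfolding u_def by (intro exI[of _ X]) simp
  qed
  then show ?thesis by (simp add: u_def a_def B_def)
qed

text \<open>Passing from the L2 norm of the remainder to the lumped mass turns
  \<open>b\<^sub>0\<close> into \<open>b\<close>: dividing by
  \<open>beta_const \<rho> * \<delta>\<^sup>2\<close> brings in twice the kernel mass, and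
  \<open>integral_lump_upper\<close> the dimensional factor.\<close>

lemma preconditioned_bounds:
  assumes ext: "\<forall>x s. x \<in> frontier \<Omega> \<and> 0 < s \<and> s \<le> s\<^sub>0 \<longrightarrow> (\<exists>y. ball y (c * s) \<subseteq> ball x s - \<Omega>)"
    and c: "0 < c" and \<delta>: "0 < \<delta>" "\<delta> \<le> s\<^sub>0"
    and sr: "shape_regular C\<^sub>s \<T>" and Cs: "C\<^sub>s \<le> C" "0 < C"
    and qu: "quasi_uniform C\<^sub>q \<T>" and Cq: "C\<^sub>q \<le> C'" "0 < C'"
    and H: "H = 4 * C * C'" and n: "H + 2 \<le> 2 ^ n * (r\<^sub>0 / 2)"
    and b\<^sub>0: "b\<^sub>0 = 1 / coarse_const TYPE('a) \<rho>\<^sub>0 r\<^sub>0 + (16 * C\<^sup>2 + 1) * interp_const TYPE('a) c H * (4 ^ n * (2 ^ n) ^ DIM('a)) / \<rho>\<^sub>0"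
    and b: "b = (1 + 2 * M\<^sub>\<rho> * ((real DIM('a) + 1) * (8 * 2 ^ DIM('a) + 2))) * b\<^sub>0"
    and G: "local_solver c\<^sub>G C\<^sub>G (local_stiffness_mat \<Omega> N \<phi>) N G" and cG: "0 < c\<^sub>G" "0 < C\<^sub>G"
  defines "R \<equiv> mat_sqrt (preconditioner \<Omega> \<delta> \<rho> N \<phi> G)"
  defines "X \<equiv> R * nonlocal_stiffness_mat \<Omega> \<delta> (averaged_kernel \<Z> \<rho>) N \<phi> * R"
  shows "spectrum (map_mat complex_of_real X) \<subseteq> complex_of_real ` {1 / (2 * (1 / c\<^sub>G + 1) * b)..2 * (M\<^sub>\<rho> * C\<^sub>G + 2)}"
    and "0 < N \<Longrightarrow> spectral_cond X \<le> 2 * (M\<^sub>\<rho> * C\<^sub>G + 2) / (1 / (2 * (1 / c\<^sub>G + 1) * b))"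
proof -
  define A K D where "A = nonlocal_stiffness_mat \<Omega> \<delta> (averaged_kernel \<Z> \<rho>) N \<phi>"
    and "K = local_stiffness_mat \<Omega> N \<phi>" and "D = lumped_mass_mat \<Omega> N \<phi>"
  define \<tau> where "\<tau> = beta_const \<rho> * \<delta>\<^sup>2"
  define Cd where "Cd = (real DIM('a) + 1) * (8 * 2 ^ DIM('a) + 2)"
  have Cd: "0 < Cd" by (auto simp: Cd_def intro!: mult_pos_pos add_pos_pos)
  have M: "0 < M\<^sub>\<rho>" using kernel_mass_pos kernel_mass_bounds(2) by linarith
  have \<tau>: "0 < \<tau>" using kernel_mass_pos \<delta> by (simp add: \<tau>_def beta_const_def)
  have H0: "0 \<le> H" using Cs Cq by (simp add: H)
  have cc: "0 < coarse_const TYPE('a) \<rho>\<^sub>0 r\<^sub>0" using \<rho>0 r0(1) by (rule coarse_const_pos)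
  have b0pos: "0 < b\<^sub>0"
    unfolding b\<^sub>0 using cc interp_const_nonneg[OF c H0, where 'a = 'a] \<rho>0 by (intro add_pos_nonneg) auto
  have bpos: "0 < b" unfolding b Cd_def[symmetric] using b0pos M Cd by (intro mult_pos_pos add_pos_pos) auto
  have car: "A \<in> carrier_mat N N" "K \<in> carrier_mat N N" "D \<in> carrier_mat N N"
    by (auto simp: A_def K_def D_def nonlocal_stiffness_mat_def local_stiffness_mat_def lumped_mass_mat_def)
  have sym: "transpose_mat A = A" "transpose_mat K = K" "transpose_mat D = D"
    unfolding A_def K_def D_def by (rule stiffness_symmetric[OF \<delta>(1)] local_symmetric lumped_symmetric)+
  have Aq: "quad_form A x = nform \<delta> (comb (($) x)) (comb (($) x))" if "x \<in> carrier_vec N" for x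
    unfolding A_def by (rule stiffness_quad[OF \<delta>(1) that])
  have Kq: "quad_form K x = energy (comb (($) x))" if "x \<in> carrier_vec N" for x
    unfolding K_def by (rule local_quad[OF that])
  have Dq: "quad_form D x = (LINT y|lborel. lump (($) x) y)" if "x \<in> carrier_vec N" for x
    unfolding D_def by (rule lumped_quad[OF that])
  have Apos: "0 \<le> quad_form A x" if x: "x \<in> carrier_vec N" for x
    unfolding Aq[OF x] nform_def using \<delta> averaged_nonneg transl_nonneg
    by (intro mult_nonneg_nonneg integral_nonneg_AE AE_I2) auto
  have dec: "\<exists>v w. v \<in> carrier_vec N \<and> w \<in> carrier_vec N \<and> y = v + w \<and>
       quad_form K v + quad_form D w / \<tau> \<le> b * quad_form A y" if y: "y \<in> carrier_vec N" for y
  proof -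
    obtain Y where Y: "energy (comb Y) + (LINT x|lborel. (comb Y x - comb (($) y) x)\<^sup>2) / \<delta>\<^sup>2 \<le> b\<^sub>0 * quad_form A y"
      using decomposition[OF ext c \<delta> sr Cs qu Cq H n] unfolding b\<^sub>0 Aq[OF y] by blast
    define v where "v = Matrix.vec N Y"
    define w where "w = y - v"
    have vw: "v \<in> carrier_vec N" "w \<in> carrier_vec N" "y = v + w" using y by (auto simp: v_def w_def)
    have cv: "comb (($) v) = comb Y" by (rule HOL.ext) (auto simp: comb_def v_def intro!: sum.cong)
    have cw: "(comb (($) w) x)\<^sup>2 = (comb Y x - comb (($) y) x)\<^sup>2" for x
    proof -
      have "comb (($) w) x = comb (($) y) x - comb Y x"
        using y unfolding comb_def sum_subtractf[symmetric] by (intro sum.cong) (auto simp: w_def v_def left_diff_distrib)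
      then show ?thesis by (simp add: power2_commute)
    qed
    define I where "I = (LINT x|lborel. (comb Y x - comb (($) y) x)\<^sup>2)"
    have I0: "0 \<le> I" unfolding I_def by (intro integral_nonneg_AE) auto
    have E0: "0 \<le> energy (comb Y)" by (simp add: energy_def sum_nonneg)
    have "quad_form D w \<le> Cd * I"
      unfolding Dq[OF vw(2)] I_def Cd_def using integral_lump_upper[of "($) w"] by (simp only: cw)
    then have "quad_form D w / \<tau> \<le> Cd * I / \<tau>" using \<tau> by (simp add: divide_right_mono)
    also have "\<dots> = 2 * kernel_mass \<rho> * Cd * (I / \<delta>\<^sup>2)"
      using kernel_mass_pos by (simp add: \<tau>_def beta_const_def)
    also have "\<dots> \<le> 2 * M\<^sub>\<rho> * Cd * (I / \<delta>\<^sup>2)"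
      using kernel_mass_bounds(2) Cd I0 by (intro mult_right_mono) auto
    finally have "quad_form K v + quad_form D w / \<tau> \<le> energy (comb Y) + 2 * M\<^sub>\<rho> * Cd * (I / \<delta>\<^sup>2)"
      by (simp add: Kq[OF vw(1)] cv)
    also have "\<dots> \<le> (1 + 2 * M\<^sub>\<rho> * Cd) * energy (comb Y) + (1 + 2 * M\<^sub>\<rho> * Cd) * (I / \<delta>\<^sup>2)"
      using E0 I0 M Cd by (intro add_mono mult_right_mono) (auto simp: mult_le_cancel_right1)
    also have "\<dots> = (1 + 2 * M\<^sub>\<rho> * Cd) * (energy (comb Y) + I / \<delta>\<^sup>2)" by (simp only: distrib_left)
    also have "\<dots> \<le> (1 + 2 * M\<^sub>\<rho> * Cd) * (b\<^sub>0 * quad_form A y)"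
      using Y M Cd by (intro mult_left_mono) (auto simp: I_def)
    also have "\<dots> = b * quad_form A y" by (simp add: b Cd_def)
    finally show ?thesis using vw by blast
  qed
  have Kpd: "\<forall>x\<in>carrier_vec N. x \<noteq> 0\<^sub>v N \<longrightarrow> 0 < quad_form K x" unfolding K_def using local_pos by blast
  have Dpd: "\<forall>x\<in>carrier_vec N. x \<noteq> 0\<^sub>v N \<longrightarrow> 0 < quad_form D x" unfolding D_def using lumped_pos by blast
  have AK: "quad_form A x \<le> M\<^sub>\<rho> * quad_form K x" if "x \<in> carrier_vec N" for x
    unfolding Aq[OF that] Kq[OF that] by (rule nform_le_energy[OF \<delta>(1)])
  have AD: "quad_form A x \<le> 2 / \<tau> * quad_form D x" if "x \<in> carrier_vec N" for x
    unfolding Aq[OF that] Dq[OF that] \<tau>_def by (rule nform_le_lump[OF \<delta>(1)])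
  note main = preconditioner_bounds[OF car(1) sym(1) Apos car(2) sym(2) Kpd car(3) sym(3) Dpd
      G[folded K_def] cG \<tau> M _ bpos AK AD dec]
  show "spectrum (map_mat complex_of_real X) \<subseteq> complex_of_real ` {1 / (2 * (1 / c\<^sub>G + 1) * b)..2 * (M\<^sub>\<rho> * C\<^sub>G + 2)}"
    unfolding X_def R_def preconditioner_def using main(1) by (simp add: A_def D_def \<tau>_def)
  show "0 < N \<Longrightarrow> spectral_cond X \<le> 2 * (M\<^sub>\<rho> * C\<^sub>G + 2) / (1 / (2 * (1 / c\<^sub>G + 1) * b))"
    unfolding X_def R_def preconditioner_def using main(2) by (simp add: A_def D_def \<tau>_def)
qed

end

text \<open>The spectrum is taken over the complex numbers so that its being real is part of the
  claim. For \<open>N = 0\<close> it is empty and has no extreme elements, hence the condition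
  \<open>0 < N\<close> in the second assertion.\<close>

theorem theorem2p2:
  fixes \<Omega> :: "(real ^ 'd) set"
    and M\<^sub>\<rho> \<rho>\<^sub>0 r\<^sub>0 c\<^sub>G C\<^sub>G C\<^sub>s C\<^sub>q :: real
  assumes "lipschitz_polyhedral_domain \<Omega>"
    and "0 < M\<^sub>\<rho>" and "0 < \<rho>\<^sub>0" and "0 < r\<^sub>0" and "r\<^sub>0 \<le> 1" and "0 < c\<^sub>G" and "0 < C\<^sub>G"
  shows "\<exists>\<delta>\<^sub>0 c C. 0 < \<delta>\<^sub>0 \<and> 0 < c \<and> 0 < C \<and>
    (\<forall>\<delta> (\<rho> :: real ^ 'd \<Rightarrow> real) P \<Z> \<T> N p \<phi> G.
       0 < \<delta> \<longrightarrow> \<delta> \<le> \<delta>\<^sub>0 \<longrightarrow>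
       admissible_kernel M\<^sub>\<rho> \<rho>\<^sub>0 r\<^sub>0 \<rho> \<longrightarrow>
       admissible_polytope P \<longrightarrow>
       admissible_partition r\<^sub>0 P \<Z> \<longrightarrow>
       conforming_mesh \<Omega> \<T> \<longrightarrow> shape_regular C\<^sub>s \<T> \<longrightarrow> quasi_uniform C\<^sub>q \<T> \<longrightarrow>
       nodal_basis \<Omega> \<T> N p \<phi> \<longrightarrow>
       local_solver c\<^sub>G C\<^sub>G (local_stiffness_mat \<Omega> N \<phi>) N G \<longrightarrow>
       (let A = nonlocal_stiffness_mat \<Omega> \<delta> (averaged_kernel \<Z> \<rho>) N \<phi>;
            R = mat_sqrt (preconditioner \<Omega> \<delta> \<rho> N \<phi> G);
            X = R * A * R
        in spectrum (map_mat complex_of_real X) \<subseteq> complex_of_real ` {c..C} \<and>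
           (0 < N \<longrightarrow> spectral_cond X \<le> C / c)))"
proof -
  have dom: "open \<Omega>" "bounded \<Omega>" "lipschitz_boundary \<Omega>"
    using assms(1) by (auto simp: lipschitz_polyhedral_domain_def)
  obtain s\<^sub>0 e where s0: "0 < s\<^sub>0" and e: "0 < e"
    and ext: "\<forall>x s. x \<in> frontier \<Omega> \<and> 0 < s \<and> s \<le> s\<^sub>0 \<longrightarrow> (\<exists>y. ball y (e * s) \<subseteq> ball x s - \<Omega>)"
    using exterior_ball_condition[OF dom(3,2,1)] by metis
  \<comment> \<open>The maximum with 1 provides positive constants, as no sign of
    \<open>C\<^sub>s\<close> and \<open>C\<^sub>q\<close> is prescribed.\<close>
  define D H where "D = max 1 C\<^sub>s" and "H = 4 * D * max 1 C\<^sub>q"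
  obtain n where "(H + 2) / (r\<^sub>0 / 2) < 2 ^ n" using real_arch_pow[of 2] by auto
  then have n: "H + 2 \<le> 2 ^ n * (r\<^sub>0 / 2)" using assms(4) by (simp add: field_simps)
  define b\<^sub>0 where "b\<^sub>0 = 1 / coarse_const TYPE(real ^ 'd) \<rho>\<^sub>0 r\<^sub>0
    + (16 * D\<^sup>2 + 1) * interp_const TYPE(real ^ 'd) e H * (4 ^ n * (2 ^ n) ^ DIM(real ^ 'd)) / \<rho>\<^sub>0"
  define b where "b = (1 + 2 * M\<^sub>\<rho> * ((real DIM(real ^ 'd) + 1) * (8 * 2 ^ DIM(real ^ 'd) + 2))) * b\<^sub>0"
  define c C where "c = 1 / (2 * (1 / c\<^sub>G + 1) * b)" and "C = 2 * (M\<^sub>\<rho> * C\<^sub>G + 2)"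
  have H0: "0 \<le> H" by (simp add: H_def D_def)
  have "0 < b\<^sub>0" unfolding b\<^sub>0_def
    using coarse_const_pos[OF assms(3,4)] interp_const_nonneg[OF e H0] assms(3)
    by (intro add_pos_nonneg divide_nonneg_pos mult_nonneg_nonneg) auto
  then have "0 < b" unfolding b_def using assms(2) by (intro mult_pos_pos add_pos_nonneg mult_nonneg_nonneg) auto
  then have c: "0 < c" unfolding c_def using assms(6) by (intro divide_pos_pos mult_pos_pos add_pos_pos) auto
  have C: "0 < C" unfolding C_def using assms(2,7) by (intro mult_pos_pos add_pos_pos) auto
  \<comment> \<open>The witness for \<open>\<delta>\<^sub>0\<close> is the reach of the exterior
    ball condition, a quantity of \<Omega> alone.\<close>
  show ?thesis
  proof (rule exI[of _ s\<^sub>0], rule exI[of _ c], rule exI[of _ C], intro conjI allI impI s0 c C)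
    fix \<delta> and \<rho> :: "real ^ 'd \<Rightarrow> real" and P :: "(real ^ 'd) set" and \<Z> \<T> :: "(real ^ 'd) set set" and N p \<phi> G
    assume *: "0 < \<delta>" "\<delta> \<le> s\<^sub>0" "admissible_kernel M\<^sub>\<rho> \<rho>\<^sub>0 r\<^sub>0 \<rho>" "admissible_polytope P"
      "admissible_partition r\<^sub>0 P \<Z>" "conforming_mesh \<Omega> \<T>" "shape_regular C\<^sub>s \<T>" "quasi_uniform C\<^sub>q \<T>"
      "nodal_basis \<Omega> \<T> N p \<phi>" "local_solver c\<^sub>G C\<^sub>G (local_stiffness_mat \<Omega> N \<phi>) N G"
    interpret fe_kernel \<Omega> \<T> N p \<phi> M\<^sub>\<rho> \<rho>\<^sub>0 r\<^sub>0 \<rho> P \<Z>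
      by unfold_locales (use * dom assms in auto)
    note bounds = preconditioned_bounds[OF ext e *(1,2,7) _ _ *(8) _ _ H_def n b\<^sub>0_def b_def *(10) assms(6,7), folded c_def C_def]
    show "let A = nonlocal_stiffness_mat \<Omega> \<delta> (averaged_kernel \<Z> \<rho>) N \<phi>;
            R = mat_sqrt (preconditioner \<Omega> \<delta> \<rho> N \<phi> G);
            X = R * A * R
        in spectrum (map_mat complex_of_real X) \<subseteq> complex_of_real ` {c..C} \<and>
           (0 < N \<longrightarrow> spectral_cond X \<le> C / c)"
      unfolding Let_def using bounds by (simp add: D_def)
  qed
qed

end
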